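(* Let $(T,\Sigma,\mu)$, $\varphi$, $u_0$ and $\mathcal{P}_\mu$ be as described in the context. For each measurable $c\colon T\to\mathbb{R}$ with $\boldsymbol{\varphi}(c)\in\mathcal{P}_\mu$, consider the Banach space $B_c^\varphi$, its subset $\mathcal{B}_c^\varphi$, and the map $\boldsymbol{\varphi}_c\colon\mathcal{B}_c^\varphi\to\mathcal{P}_\mu$. Then the collection $\{(\mathcal{B}_c^\varphi,\boldsymbol{\varphi}_c)\}$, indexed by all measurable $c\colon T\to\mathbb{R}$ with $\boldsymbol{\varphi}(c)\in\mathcal{P}_\mu$, satisfies the conditions (bm1), (bm2), (bm3) of a $C^\infty$-Banach manifold on the set $\mathcal{P}_\mu$ (given in the context), and so equips $\mathcal{P}_\mu$ with a $C^\infty$-differentiable structure.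
   Context: $(T,\Sigma,\mu)$ is a $\sigma$-finite, non-atomic measure space. $L^0$ is the space of real-valued measurable functions on $T$, with equality $\mu$-a.e.; $\mathbb{E}[\cdot]$ is integration with respect to $\mu$; $\mathcal{P}_\mu=\{p\in L^0: p>0,\ \mathbb{E}[p]=1\}$. $\varphi$-function: $\varphi\colon T\times\overline{\mathbb{R}}\to[0,\infty]$ satisfies, for $\mu$-a.e. $t\in T$: (a1) $\varphi(t,\cdot)$ is convex and injective; (a2) $\varphi(t,-\infty)=0$ and $\varphi(t,\infty)=\infty$; (a3) $\varphi(\cdot,u)$ is measurable for all $u\in\mathbb{R}$. Moreover $\varphi(t,\cdot)$ has image $[0,\infty]$, and is continuous and strictly increasing. It is assumed in addition that $u_0\colon T\to(0,\infty)$ is a fixed measurable function such that: (a4) for every measurable $c\colon T\to\mathbb{R}$ for which $t\mapsto\varphi(t,c(t))$ is in $\mathcal{P}_\mu$, the function $t\mapsto\varphi(t,c(t)+\lambda u_0(t))$ is $\mu$-integrable for all $\lambda>0$. For $u\colon T\to\mathbb{R}$ write $\boldsymbol{\varphi}(u)(t)=\varphi(t,u(t))$ and $\boldsymbol{\varphi}'_+(u)(t)=\varphi'_+(t,u(t))$, where $\varphi'_+(t,\cdot)$ is the right-derivative of $\varphi(t,\cdot)$. For measurable $c\colon T\to\mathbb{R}$ with $\boldsymbol{\varphi}(c)$ $\mu$-integrable, put $\Phi(t,u)=\varphi(t,c(t)+u)-\varphi(t,c(t))$ for $u\ge 0$, $I_\Phi(u)=\int_T\Phi(t,|u(t)|)\,d\mu$,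 and let $L_c^\varphi=\{u\in L^0: I_\Phi(\lambda u)<\infty\text{ for some }\lambda>0\}$ be the Musielak–Orlicz space, a Banach space with the Luxemburg norm $\Vert u\Vert_\Phi=\inf\{\lambda>0: I_\Phi(u/\lambda)\le1\}$. (Equivalently, $u\in L_c^\varphi$ iff $\boldsymbol{\varphi}(c+\lambda u)$ is $\mu$-integrable for every $\lambda$ in some neighborhood of $0$.) $\mathcal{K}_c^\varphi$ is the set of all $u\in L_c^\varphi$ such that $\boldsymbol{\varphi}(c+\lambda u)$ is $\mu$-integrable for every $\lambda$ in a neighborhood of $[0,1]$. When $\boldsymbol{\varphi}(c)\in\mathcal{P}_\mu$: the normalizing function $\psi\colon\mathcal{K}_c^\varphi\to\mathbb{R}$ associated to $c$ assigns to $u$ the unique real number $\psi(u)$ such that $\boldsymbol{\varphi}(c+u-\psi(u)u_0)\in\mathcal{P}_\mu$. $B_c^\varphi=\{u\in L_c^\varphi:\mathbb{E}[u\,\boldsymbol{\varphi}'_+(c)]=0\}$ (a closed subspace of $L_c^\varphi$), $\mathcal{B}_c^\varphi=B_c^\varphi\cap\mathcal{K}_c^\varphi$, and $\boldsymbol{\varphi}_c(u)=\boldsymbol{\varphi}(c+u-\psi(u)u_0)$ for $u\in\mathcal{B}_c^\varphi$. $C^k$-Banach manifold: a set $M$ with a collection of pairs $(U_\alpha,\boldsymbol{x}_\alpha)$, where $U_\alpha$ is an open subset of a Banach space $X_\alpha$ and $\boldsymbol{x}_\alpha\colon U_\alpha\to M$ is injective, such that: (bm1) $\bigcup_\alpha\boldsymbol{x}_\alpha(U_\alpha)=M$;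 (bm2) for any $\alpha,\beta$ with $W=\boldsymbol{x}_\alpha(U_\alpha)\cap\boldsymbol{x}_\beta(U_\beta)\ne\emptyset$, the sets $\boldsymbol{x}_\alpha^{-1}(W)$ and $\boldsymbol{x}_\beta^{-1}(W)$ are open in $X_\alpha$ and $X_\beta$, respectively; (bm3) the transition map $\boldsymbol{x}_\beta^{-1}\circ\boldsymbol{x}_\alpha\colon\boldsymbol{x}_\alpha^{-1}(W)\to\boldsymbol{x}_\beta^{-1}(W)$ is a $C^k$-isomorphism. Here $M=\mathcal{P}_\mu$, $X_c=B_c^\varphi$, $U_c=\mathcal{B}_c^\varphi$, $\boldsymbol{x}_c=\boldsymbol{\varphi}_c$, $k=\infty$. *)

theory Defs
  imports "HOL-Analysis.Analysis" "HOL-Library.Extended_Nat"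
begin

section \<open>Banach spaces with an explicit carrier\<close>

text \<open>The model spaces depend on a term (the function \<open>c\<close>), so they cannot be instances of the
  type class \<^class>\<open>banach\<close>.\<close>

record 'b nspace =
  vcarrier :: "'b set"
  vadd :: "'b \<Rightarrow> 'b \<Rightarrow> 'b"
  vzero :: "'b"
  vscale :: "real \<Rightarrow> 'b \<Rightarrow> 'b"
  vnorm :: "'b \<Rightarrow> real"

definition vdiff :: "'b nspace \<Rightarrow> 'b \<Rightarrow> 'b \<Rightarrow> 'b" where
  "vdiff X u v = vadd X u (vscale X (-1) v)"

text \<open>The locale \<^locale>\<open>Metric_space\<close> demands symmetry and non-negativity of the distance on the
  whole type, whence the default value 0 off the carrier.\<close>

definition vdist :: "'b nspace \<Rightarrow> 'b \<Rightarrow> 'b \<Rightarrow> real" where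
  "vdist X u v = (if u \<in> vcarrier X \<and> v \<in> vcarrier X then vnorm X (vdiff X u v) else 0)"

definition vtopology :: "'b nspace \<Rightarrow> 'b topology" where
  "vtopology X = Metric_space.mtopology (vcarrier X) (vdist X)"

locale banach_on =
  fixes X :: "'b nspace"
  assumes add_closed: "\<lbrakk>u \<in> vcarrier X; v \<in> vcarrier X\<rbrakk> \<Longrightarrow> vadd X u v \<in> vcarrier X"
    and zero_closed: "vzero X \<in> vcarrier X"
    and scale_closed: "u \<in> vcarrier X \<Longrightarrow> vscale X a u \<in> vcarrier X"
    and add_assoc: "\<lbrakk>u \<in> vcarrier X; v \<in> vcarrier X; w \<in> vcarrier X\<rbrakk>
          \<Longrightarrow> vadd X (vadd X u v) w = vadd X u (vadd X v w)"
    and add_commute: "\<lbrakk>u \<in> vcarrier X; v \<in> vcarrier X\<rbrakk> \<Longrightarrow> vadd X u v = vadd X v u"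
    and add_zero: "u \<in> vcarrier X \<Longrightarrow> vadd X u (vzero X) = u"
    and diff_self: "u \<in> vcarrier X \<Longrightarrow> vdiff X u u = vzero X"
    and scale_add: "\<lbrakk>u \<in> vcarrier X; v \<in> vcarrier X\<rbrakk>
          \<Longrightarrow> vscale X a (vadd X u v) = vadd X (vscale X a u) (vscale X a v)"
    and add_scale: "u \<in> vcarrier X
          \<Longrightarrow> vscale X (a + b) u = vadd X (vscale X a u) (vscale X b u)"
    and scale_scale: "u \<in> vcarrier X \<Longrightarrow> vscale X a (vscale X b u) = vscale X (a * b) u"
    and scale_one: "u \<in> vcarrier X \<Longrightarrow> vscale X 1 u = u"
    and norm_nonneg: "u \<in> vcarrier X \<Longrightarrow> 0 \<le> vnorm X u"
    and norm_eq_zero: "u \<in> vcarrier X \<Longrightarrow> vnorm X u = 0 \<longleftrightarrow> u = vzero X"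
    and norm_scale: "u \<in> vcarrier X \<Longrightarrow> vnorm X (vscale X a u) = \<bar>a\<bar> * vnorm X u"
    and norm_triangle: "\<lbrakk>u \<in> vcarrier X; v \<in> vcarrier X\<rbrakk>
          \<Longrightarrow> vnorm X (vadd X u v) \<le> vnorm X u + vnorm X v"
    and complete: "Metric_space.mcomplete (vcarrier X) (vdist X)"


section \<open>Maps of class \<open>C\<^sup>k\<close>\<close>

text \<open>The \<open>j\<close>-th derivative at a point is a bounded \<open>j\<close>-linear map, i.e. an element of
  \<open>L(X, L(X, \<dots>, L(X, Y)))\<close>; its arguments are collected in a list of length \<open>j\<close> because the
  iterated operator space would be of a type depending on \<open>j\<close>.\<close>

definition multilinear_on :: "'b nspace \<Rightarrow> 'c nspace \<Rightarrow> nat \<Rightarrow> ('b list \<Rightarrow> 'c) \<Rightarrow> bool" where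
  "multilinear_on X Y j L \<longleftrightarrow>
     (\<forall>hs. length hs = j \<and> set hs \<subseteq> vcarrier X \<longrightarrow>
        L hs \<in> vcarrier Y \<and>
        (\<forall>i<j. \<forall>u\<in>vcarrier X. \<forall>v\<in>vcarrier X. \<forall>a.
           L (hs[i := vadd X u v]) = vadd Y (L (hs[i := u])) (L (hs[i := v])) \<and>
           L (hs[i := vscale X a u]) = vscale Y a (L (hs[i := u]))))"

text \<open>The operator norm of the \<open>j\<close>-linear map \<open>L\<close> is at most \<open>K\<close>.\<close>

definition op_norm_le :: "'b nspace \<Rightarrow> 'c nspace \<Rightarrow> nat \<Rightarrow> ('b list \<Rightarrow> 'c) \<Rightarrow> real \<Rightarrow> bool" where
  "op_norm_le X Y j L K \<longleftrightarrow>
     (\<forall>hs. length hs = j \<and> set hs \<subseteq> vcarrier X \<longrightarrow>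
        vnorm Y (L hs) \<le> K * prod_list (map (vnorm X) hs))"

definition bounded_multilinear_on ::
    "'b nspace \<Rightarrow> 'c nspace \<Rightarrow> nat \<Rightarrow> ('b list \<Rightarrow> 'c) \<Rightarrow> bool" where
  "bounded_multilinear_on X Y j L \<longleftrightarrow> multilinear_on X Y j L \<and> (\<exists>K. op_norm_le X Y j L K)"

definition op_continuous_on ::
    "'b nspace \<Rightarrow> 'b set \<Rightarrow> 'c nspace \<Rightarrow> nat \<Rightarrow> ('b \<Rightarrow> 'b list \<Rightarrow> 'c) \<Rightarrow> bool" where
  "op_continuous_on X U Y j F \<longleftrightarrow>
     (\<forall>u\<in>U. \<forall>\<epsilon>>0. \<exists>\<delta>>0. \<forall>v\<in>U. vdist X v u < \<delta> \<longrightarrow>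
        op_norm_le X Y j (\<lambda>hs. vdiff Y (F v hs) (F u hs)) \<epsilon>)"

text \<open>\<open>F' u\<close> is the Frechet derivative at \<open>u\<close> of the map \<open>F\<close> from \<open>U\<close> to the \<open>j\<close>-linear maps;
  as an operator from \<open>X\<close> to the \<open>j\<close>-linear maps it sends \<open>h\<close> to \<open>\<lambda>hs. F' u (h # hs)\<close>.\<close>

definition op_has_derivative_on ::
    "'b nspace \<Rightarrow> 'b set \<Rightarrow> 'c nspace \<Rightarrow> nat \<Rightarrow>
     ('b \<Rightarrow> 'b list \<Rightarrow> 'c) \<Rightarrow> ('b \<Rightarrow> 'b list \<Rightarrow> 'c) \<Rightarrow> bool" where
  "op_has_derivative_on X U Y j F F' \<longleftrightarrow>
     (\<forall>u\<in>U. \<forall>\<epsilon>>0. \<exists>\<delta>>0. \<forall>h\<in>vcarrier X. vadd X u h \<in> U \<and> vnorm X h < \<delta> \<longrightarrow>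
        op_norm_le X Y j
          (\<lambda>hs. vdiff Y (vdiff Y (F (vadd X u h) hs) (F u hs)) (F' u (h # hs)))
          (\<epsilon> * vnorm X h))"

text \<open>Here \<open>U\<close> is meant to be open; \<open>D j\<close> is the \<open>j\<close>-th derivative of \<open>f\<close>.\<close>

definition Ck_on ::
    "enat \<Rightarrow> 'b nspace \<Rightarrow> 'b set \<Rightarrow> 'c nspace \<Rightarrow> ('b \<Rightarrow> 'c) \<Rightarrow> bool" where
  "Ck_on k X U Y f \<longleftrightarrow>
     (\<exists>D :: nat \<Rightarrow> 'b \<Rightarrow> 'b list \<Rightarrow> 'c.
        (\<forall>u\<in>U. D 0 u [] = f u) \<and>
        (\<forall>j. enat j \<le> k \<longrightarrow>
           (\<forall>u\<in>U. bounded_multilinear_on X Y j (D j u)) \<and> op_continuous_on X U Y j (D j)) \<and>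
        (\<forall>j. enat j < k \<longrightarrow> op_has_derivative_on X U Y j (D j) (D (Suc j))))"

definition Ck_isomorphism ::
    "enat \<Rightarrow> 'b nspace \<Rightarrow> 'b set \<Rightarrow> 'c nspace \<Rightarrow> 'c set \<Rightarrow> ('b \<Rightarrow> 'c) \<Rightarrow> bool" where
  "Ck_isomorphism k X U Y V f \<longleftrightarrow>
     bij_betw f U V \<and> Ck_on k X U Y f \<and> Ck_on k Y V X (inv_into U f)"


section \<open>Banach manifolds\<close>

locale Ck_banach_manifold =
  fixes k :: enat
    and S :: "'m set"
    and I :: "'i set"
    and X :: "'i \<Rightarrow> 'b nspace"
    and U :: "'i \<Rightarrow> 'b set"
    and x :: "'i \<Rightarrow> 'b \<Rightarrow> 'm"
  assumes model_space: "\<alpha> \<in> I \<Longrightarrow> banach_on (X \<alpha>)"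
    and open_domain: "\<alpha> \<in> I \<Longrightarrow> openin (vtopology (X \<alpha>)) (U \<alpha>)"
    and into: "\<alpha> \<in> I \<Longrightarrow> x \<alpha> ` U \<alpha> \<subseteq> S"
    and injective: "\<alpha> \<in> I \<Longrightarrow> inj_on (x \<alpha>) (U \<alpha>)"
    and bm1: "(\<Union>\<alpha>\<in>I. x \<alpha> ` U \<alpha>) = S"
    and bm2: "\<lbrakk>\<alpha> \<in> I; \<beta> \<in> I; W = x \<alpha> ` U \<alpha> \<inter> x \<beta> ` U \<beta>; W \<noteq> {}\<rbrakk> \<Longrightarrow>
          openin (vtopology (X \<alpha>)) {u \<in> U \<alpha>. x \<alpha> u \<in> W} \<and>
          openin (vtopology (X \<beta>)) {u \<in> U \<beta>. x \<beta> u \<in> W}"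
    and bm3: "\<lbrakk>\<alpha> \<in> I; \<beta> \<in> I; W = x \<alpha> ` U \<alpha> \<inter> x \<beta> ` U \<beta>; W \<noteq> {}\<rbrakk> \<Longrightarrow>
          Ck_isomorphism k (X \<alpha>) {u \<in> U \<alpha>. x \<alpha> u \<in> W} (X \<beta>) {u \<in> U \<beta>. x \<beta> u \<in> W}
            (inv_into (U \<beta>) (x \<beta>) \<circ> x \<alpha>)"


section \<open>Measurable functions modulo equality almost everywhere\<close>

definition non_atomic :: "'a measure \<Rightarrow> bool" where
  "non_atomic M \<longleftrightarrow>
     (\<forall>A\<in>sets M. 0 < emeasure M A \<longrightarrow>
        (\<exists>B\<in>sets M. B \<subseteq> A \<and> 0 < emeasure M B \<and> emeasure M B < emeasure M A))"

text \<open>The class of \<open>f\<close>, for \<open>f\<close> equal almost everywhere to a measurable function.\<close>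

definition ae_class :: "'a measure \<Rightarrow> ('a \<Rightarrow> real) \<Rightarrow> ('a \<Rightarrow> real) set" where
  "ae_class M f = {g \<in> borel_measurable M. AE t in M. g t = f t}"

definition L0 :: "'a measure \<Rightarrow> ('a \<Rightarrow> real) set set" where
  "L0 M = ae_class M ` borel_measurable M"

text \<open>Everything below that is defined through a representative depends on its class only.\<close>

definition rep :: "('a \<Rightarrow> real) set \<Rightarrow> 'a \<Rightarrow> real" where
  "rep u = (SOME f. f \<in> u)"

definition P_mu :: "'a measure \<Rightarrow> ('a \<Rightarrow> real) set set" where
  "P_mu M = {p \<in> L0 M. (AE t in M. 0 < rep p t) \<and> integrable M (rep p) \<and> (\<integral>t. rep p t \<partial>M) = 1}"


section \<open>The Musielak--Orlicz spaces and the charts\<close>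

text \<open>In the convexity inequality the value of \<open>\<infinity> - \<infinity>\<close> in \<^typ>\<open>ereal\<close> is irrelevant, since then
  the right-hand side is infinite.\<close>

definition phi_function :: "'a measure \<Rightarrow> ('a \<Rightarrow> ereal \<Rightarrow> ennreal) \<Rightarrow> bool" where
  "phi_function M \<phi> \<longleftrightarrow>
     (AE t in M.
        (\<forall>u v. \<forall>r::real. 0 < r \<and> r < 1 \<longrightarrow>
           \<phi> t (ereal (1 - r) * u + ereal r * v) \<le> ennreal (1 - r) * \<phi> t u + ennreal r * \<phi> t v) \<and>
        inj (\<phi> t) \<and> \<phi> t (-\<infinity>) = 0 \<and> \<phi> t \<infinity> = \<infinity> \<and>
        range (\<phi> t) = UNIV \<and> continuous_on UNIV (\<phi> t) \<and> strict_mono (\<phi> t)) \<and>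
     (\<forall>u::real. (\<lambda>t. \<phi> t (ereal u)) \<in> borel_measurable M)"

text \<open>\<open>\<phi> t\<close> is well-behaved for almost all \<open>t\<close> only, so \<open>t \<mapsto> \<phi> t (u t)\<close> is
  measurable only up to a null set. Integrals of such functions are therefore taken with respect to
  the completion of \<open>M\<close>; they agree with the integrals over \<open>M\<close> of measurable versions.\<close>

definition bphi :: "('a \<Rightarrow> ereal \<Rightarrow> ennreal) \<Rightarrow> ('a \<Rightarrow> real) \<Rightarrow> 'a \<Rightarrow> real" where
  "bphi \<phi> u t = enn2real (\<phi> t (ereal (u t)))"

definition bphi_right_deriv :: "('a \<Rightarrow> ereal \<Rightarrow> ennreal) \<Rightarrow> ('a \<Rightarrow> real) \<Rightarrow> 'a \<Rightarrow> real" where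
  "bphi_right_deriv \<phi> u t =
     vector_derivative (\<lambda>y. enn2real (\<phi> t (ereal y))) (at_right (u t))"

definition phi_integrable :: "'a measure \<Rightarrow> ('a \<Rightarrow> ereal \<Rightarrow> ennreal) \<Rightarrow> ('a \<Rightarrow> real) \<Rightarrow> bool" where
  "phi_integrable M \<phi> u \<longleftrightarrow> integrable (completion M) (bphi \<phi> u)"

definition modular :: "'a measure \<Rightarrow> ('a \<Rightarrow> ereal \<Rightarrow> ennreal) \<Rightarrow> ('a \<Rightarrow> real) \<Rightarrow> ('a \<Rightarrow> real) \<Rightarrow> ennreal" where
  "modular M \<phi> c u =
     (\<integral>\<^sup>+t. \<phi> t (ereal (c t + \<bar>u t\<bar>)) - \<phi> t (ereal (c t)) \<partial>completion M)"

definition L_space :: "'a measure \<Rightarrow> ('a \<Rightarrow> ereal \<Rightarrow> ennreal) \<Rightarrow> ('a \<Rightarrow> real) \<Rightarrow> ('a \<Rightarrow> real) set nspace" where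
  "L_space M \<phi> c =
     \<lparr> vcarrier = {u \<in> L0 M. \<exists>r>0. modular M \<phi> c (\<lambda>t. r * rep u t) < \<infinity>},
       vadd = (\<lambda>u v. ae_class M (\<lambda>t. rep u t + rep v t)),
       vzero = ae_class M (\<lambda>t. 0),
       vscale = (\<lambda>a u. ae_class M (\<lambda>t. a * rep u t)),
       vnorm = (\<lambda>u. Inf {r::real. 0 < r \<and> modular M \<phi> c (\<lambda>t. rep u t / r) \<le> 1}) \<rparr>"

definition K_set :: "'a measure \<Rightarrow> ('a \<Rightarrow> ereal \<Rightarrow> ennreal) \<Rightarrow> ('a \<Rightarrow> real) \<Rightarrow> ('a \<Rightarrow> real) set set" where
  "K_set M \<phi> c =
     {u \<in> vcarrier (L_space M \<phi> c).
        \<exists>N::real set. open N \<and> {0..1} \<subseteq> N \<and>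
          (\<forall>r\<in>N. phi_integrable M \<phi> (\<lambda>t. c t + r * rep u t))}"

definition B_space :: "'a measure \<Rightarrow> ('a \<Rightarrow> ereal \<Rightarrow> ennreal) \<Rightarrow> ('a \<Rightarrow> real) \<Rightarrow> ('a \<Rightarrow> real) set nspace" where
  "B_space M \<phi> c =
     (L_space M \<phi> c)
       \<lparr> vcarrier := {u \<in> vcarrier (L_space M \<phi> c).
           (\<integral>t. rep u t * bphi_right_deriv \<phi> c t \<partial>completion M) = 0} \<rparr>"

definition B_domain :: "'a measure \<Rightarrow> ('a \<Rightarrow> ereal \<Rightarrow> ennreal) \<Rightarrow> ('a \<Rightarrow> real) \<Rightarrow> ('a \<Rightarrow> real) set set" where
  "B_domain M \<phi> c = vcarrier (B_space M \<phi> c) \<inter> K_set M \<phi> c"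

definition normalizing ::
    "'a measure \<Rightarrow> ('a \<Rightarrow> ereal \<Rightarrow> ennreal) \<Rightarrow> ('a \<Rightarrow> real) \<Rightarrow> ('a \<Rightarrow> real) \<Rightarrow> ('a \<Rightarrow> real) set \<Rightarrow> real" where
  "normalizing M \<phi> u0 c u =
     (THE s. ae_class M (bphi \<phi> (\<lambda>t. c t + rep u t - s * u0 t)) \<in> P_mu M)"

definition phi_chart ::
    "'a measure \<Rightarrow> ('a \<Rightarrow> ereal \<Rightarrow> ennreal) \<Rightarrow> ('a \<Rightarrow> real) \<Rightarrow> ('a \<Rightarrow> real)
     \<Rightarrow> ('a \<Rightarrow> real) set \<Rightarrow> ('a \<Rightarrow> real) set" where
  "phi_chart M \<phi> u0 c u =
     ae_class M (bphi \<phi> (\<lambda>t. c t + rep u t - normalizing M \<phi> u0 c u * u0 t))"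

end

theory Submission
  imports Defs "HOL-Real_Asymp.Real_Asymp"
begin

text \<open>Suppose that the chart at \<open>c\<close> sends \<open>u\<close>, and the chart at \<open>d\<close> sends \<open>v\<close>, to the same density. Since
  \<open>\<phi> t\<close> is injective, \<open>c + u - s u0 = d + v - r u0\<close> almost everywhere for two real numbers \<open>s\<close>, \<open>r\<close>.
  So \<open>v\<close> equals \<open>c + u - d\<close> up to a multiple of \<open>u0\<close>, and the multiple is determined by the
  condition \<open>E[v \<phi>'\<^sub>+(d)] = 0\<close>: \<open>v\<close> is the projection of \<open>c + u - d\<close> along \<open>u0\<close> onto the kernel of
  the functional \<open>w \<mapsto> E[w \<phi>'\<^sub>+(d)]\<close>. Transition maps are therefore restrictions of affine maps with a
  bounded linear part (lemma \<open>transition_Ck\<close>), and such maps are of class \<open>C\<^sup>k\<close> for every \<open>k\<close>: the first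
  derivative is constant and the higher ones vanish (lemma \<open>Ck_on_affine\<close>).

  For this to make sense the linear part must be bounded from the space at \<open>c\<close> to the space at \<open>d\<close>,
  although the two Luxemburg norms come from different modulars. If the charts overlap at a density
  \<open>\<phi>(e)\<close>, then \<open>\<phi>\<close> is integrable along the segments from \<open>c\<close> to \<open>e\<close> and from \<open>d\<close> to \<open>e\<close>, and a little
  beyond their endpoints. With an integrable point beyond \<open>e\<close>, convexity of \<open>\<phi>\<close> bounds \<open>\<phi>(e + a w)\<close> by a
  convex combination of the value of \<open>\<phi>\<close> there and of \<open>\<phi>(c + w)\<close>; so the spaces at \<open>c\<close> and \<open>e\<close> are the same, with
  equivalent norms, and likewise those at \<open>d\<close> and \<open>e\<close> (lemmas \<open>base_change\<close> and
  \<open>overlap_base_change\<close>). The same convexity argument shows that the set of directions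
  \<open>u\<close> for which \<open>\<phi>\<close> is integrable along the segment from \<open>c\<close> to \<open>c + u\<close>, and a little beyond its endpoints,
  is open (\<open>arc_integrable_open\<close>) and invariant under adding multiples of \<open>u0\<close>
  (\<open>arc_integrable_add_u0\<close>). Hence the domains of the charts are open, and the overlap of two charts is
  described, inside the domain at \<open>c\<close>, by the open condition that \<open>c + u - d\<close> be such a direction at \<open>d\<close>
  (\<open>overlap_iff\<close>, \<open>overlap_open\<close>).

  Charts are well defined because \<open>s \<mapsto> E[\<phi>(c + u - s u0)]\<close> is convex, strictly decreasing and tends to
  \<open>0\<close>, so that it takes the value \<open>1\<close> exactly once (\<open>ex1_normalizing\<close>). They are injective because \<open>u0\<close> lies
  outside the kernel of \<open>w \<mapsto> E[w \<phi>'\<^sub>+(c)]\<close>. Completeness of the model spaces is the usual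
  Riesz--Fischer argument (\<open>orlicz_fast_Cauchy_converges\<close>).

  All the analysis is done for representatives and for a real-valued version \<open>g\<close> of \<open>\<phi>\<close> that is well
  behaved at every point; \<open>\<phi>\<close> and \<open>g\<close> agree almost everywhere (\<open>phi_function_model\<close>).\<close>

section \<open>Normed spaces with an explicit carrier\<close>

text \<open>The axioms of a Banach space except completeness. They already yield the metric, which is what a
  proof of completeness has to start from.\<close>

locale normed_on =
  fixes X :: "'b nspace"
  assumes add_closed: "\<lbrakk>u \<in> vcarrier X; v \<in> vcarrier X\<rbrakk> \<Longrightarrow> vadd X u v \<in> vcarrier X"
    and zero_closed: "vzero X \<in> vcarrier X"
    and scale_closed: "u \<in> vcarrier X \<Longrightarrow> vscale X a u \<in> vcarrier X"
    and add_assoc: "\<lbrakk>u \<in> vcarrier X; v \<in> vcarrier X; w \<in> vcarrier X\<rbrakk>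
          \<Longrightarrow> vadd X (vadd X u v) w = vadd X u (vadd X v w)"
    and add_commute: "\<lbrakk>u \<in> vcarrier X; v \<in> vcarrier X\<rbrakk> \<Longrightarrow> vadd X u v = vadd X v u"
    and add_zero: "u \<in> vcarrier X \<Longrightarrow> vadd X u (vzero X) = u"
    and diff_self: "u \<in> vcarrier X \<Longrightarrow> vdiff X u u = vzero X"
    and scale_add: "\<lbrakk>u \<in> vcarrier X; v \<in> vcarrier X\<rbrakk>
          \<Longrightarrow> vscale X a (vadd X u v) = vadd X (vscale X a u) (vscale X a v)"
    and add_scale: "u \<in> vcarrier X
          \<Longrightarrow> vscale X (a + b) u = vadd X (vscale X a u) (vscale X b u)"
    and scale_scale: "u \<in> vcarrier X \<Longrightarrow> vscale X a (vscale X b u) = vscale X (a * b) u"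
    and scale_one: "u \<in> vcarrier X \<Longrightarrow> vscale X 1 u = u"
    and norm_nonneg: "u \<in> vcarrier X \<Longrightarrow> 0 \<le> vnorm X u"
    and norm_eq_zero: "u \<in> vcarrier X \<Longrightarrow> vnorm X u = 0 \<longleftrightarrow> u = vzero X"
    and norm_scale: "u \<in> vcarrier X \<Longrightarrow> vnorm X (vscale X a u) = \<bar>a\<bar> * vnorm X u"
    and norm_triangle: "\<lbrakk>u \<in> vcarrier X; v \<in> vcarrier X\<rbrakk>
          \<Longrightarrow> vnorm X (vadd X u v) \<le> vnorm X u + vnorm X v"
begin

lemma diff_closed: "\<lbrakk>u \<in> vcarrier X; v \<in> vcarrier X\<rbrakk> \<Longrightarrow> vdiff X u v \<in> vcarrier X"
  by (simp add: vdiff_def add_closed scale_closed)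

lemma norm_zero: "vnorm X (vzero X) = 0"
  using norm_eq_zero zero_closed by blast

lemma scale_zero: "vscale X a (vzero X) = vzero X"
  using norm_eq_zero[OF scale_closed[OF zero_closed]] norm_scale[OF zero_closed] norm_zero by simp

lemma diff_zero: "u \<in> vcarrier X \<Longrightarrow> vdiff X u (vzero X) = u"
  by (simp add: vdiff_def scale_zero add_zero)

lemma diff_add:
  assumes "u \<in> vcarrier X" "v \<in> vcarrier X"
  shows "vadd X (vdiff X u v) v = u"
proof -
  have "vadd X (vdiff X u v) v = vadd X u (vadd X (vscale X (-1) v) v)"
    using assms by (simp add: vdiff_def add_assoc scale_closed)
  also have "vadd X (vscale X (-1) v) v = vdiff X v v"
    using assms by (simp add: vdiff_def add_commute scale_closed)
  finally show ?thesis using assms by (simp add: diff_self add_zero)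
qed

lemma add_diff:
  assumes "u \<in> vcarrier X" "v \<in> vcarrier X"
  shows "vdiff X (vadd X u v) u = v"
proof -
  have "vdiff X (vadd X u v) u = vadd X (vadd X v u) (vscale X (-1) u)"
    using assms by (simp add: vdiff_def add_commute)
  also have "\<dots> = vadd X v (vdiff X u u)"
    using assms by (simp add: vdiff_def add_assoc scale_closed)
  finally show ?thesis using assms by (simp add: diff_self add_zero)
qed

lemma norm_diff_commute:
  assumes "u \<in> vcarrier X" "v \<in> vcarrier X"
  shows "vnorm X (vdiff X u v) = vnorm X (vdiff X v u)"
proof -
  have "vscale X (-1) (vdiff X u v) = vadd X (vscale X (-1) u) v"
    using assms by (simp add: vdiff_def scale_add scale_closed scale_scale scale_one)
  also have "\<dots> = vdiff X v u"
    using assms by (simp add: vdiff_def add_commute scale_closed)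
  finally show ?thesis
    using norm_scale[OF diff_closed[OF assms], of "-1"] by simp
qed

lemma norm_diff_triangle:
  assumes "u \<in> vcarrier X" "v \<in> vcarrier X" "w \<in> vcarrier X"
  shows "vnorm X (vdiff X u w) \<le> vnorm X (vdiff X u v) + vnorm X (vdiff X v w)"
proof -
  have "vdiff X u w = vadd X (vadd X (vdiff X u v) v) (vscale X (-1) w)"
    using assms by (simp add: diff_add) (simp add: vdiff_def)
  also have "\<dots> = vadd X (vdiff X u v) (vdiff X v w)"
    using assms by (simp add: add_assoc diff_closed scale_closed) (simp add: vdiff_def)
  finally show ?thesis
    using assms by (simp add: norm_triangle diff_closed)
qed

lemma dist_eq: "\<lbrakk>u \<in> vcarrier X; v \<in> vcarrier X\<rbrakk> \<Longrightarrow> vdist X u v = vnorm X (vdiff X u v)"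
  by (simp add: vdist_def)

sublocale met: Metric_space "vcarrier X" "vdist X"
proof
  fix u v show "0 \<le> vdist X u v" by (simp add: vdist_def norm_nonneg diff_closed)
next
  fix u v show "vdist X u v = vdist X v u" by (simp add: vdist_def norm_diff_commute)
next
  fix u v assume *: "u \<in> vcarrier X" "v \<in> vcarrier X"
  have "vadd X (vzero X) v = v" using add_commute[OF zero_closed *(2)] add_zero[OF *(2)] by simp
  then have "vdiff X u v = vzero X \<longleftrightarrow> u = v" using diff_add[OF *] diff_self[OF *(1)] by force
  then show "vdist X u v = 0 \<longleftrightarrow> u = v"
    using norm_eq_zero[OF diff_closed[OF *]] * by (simp add: dist_eq)
next
  fix u v w assume "u \<in> vcarrier X" "v \<in> vcarrier X" "w \<in> vcarrier X"
  then show "vdist X u w \<le> vdist X u v + vdist X v w"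
    by (simp add: vdist_def norm_diff_triangle)
qed

lemma openin_vtopology:
  "openin (vtopology X) U \<longleftrightarrow> U \<subseteq> vcarrier X \<and>
     (\<forall>u\<in>U. \<exists>r>0. \<forall>v\<in>vcarrier X. vnorm X (vdiff X v u) < r \<longrightarrow> v \<in> U)"
  unfolding vtopology_def met.openin_mtopology
proof (intro conj_cong refl iffI ballI allI impI)
  fix u assume U: "U \<subseteq> vcarrier X" and u: "u \<in> U"
  have *: "met.mball u r = {v \<in> vcarrier X. vnorm X (vdiff X v u) < r}" for r
  proof -
    have uX: "u \<in> vcarrier X" using U u by blast
    have "vdist X u v = vnorm X (vdiff X v u)" if "v \<in> vcarrier X" for v
      using dist_eq[OF uX that] norm_diff_commute[OF uX that] by (rule trans)
    then show ?thesis unfolding met.mball_def using uX by auto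
  qed
  show "\<exists>r>0. \<forall>v\<in>vcarrier X. vnorm X (vdiff X v u) < r \<longrightarrow> v \<in> U"
    if asm: "\<forall>x. x \<in> U \<longrightarrow> (\<exists>r>0. met.mball x r \<subseteq> U)"
  proof -
    obtain r where "r > 0" "met.mball u r \<subseteq> U" using asm u by blast
    then show ?thesis unfolding * by blast
  qed
  show "\<exists>r>0. met.mball u r \<subseteq> U"
    if asm: "\<forall>u\<in>U. \<exists>r>0. \<forall>v\<in>vcarrier X. vnorm X (vdiff X v u) < r \<longrightarrow> v \<in> U"
  proof -
    obtain r where "r > 0" "\<forall>v\<in>vcarrier X. vnorm X (vdiff X v u) < r \<longrightarrow> v \<in> U"
      using asm u by blast
    then show ?thesis unfolding * by blast
  qed
qed

text \<open>A Cauchy sequence has a subsequence whose consecutive distances decrease geometrically, and a Cauchy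
  sequence with a convergent subsequence converges. So completeness has to be checked only for
  sequences whose increments are summable, which is the form that the Riesz--Fischer argument needs.\<close>

lemma mcompleteI_fast:
  assumes "\<And>u. \<lbrakk>\<And>n. u n \<in> vcarrier X; \<And>n. vnorm X (vdiff X (u (Suc n)) (u n)) < (1/2) ^ n\<rbrakk>
     \<Longrightarrow> \<exists>l\<in>vcarrier X. (\<lambda>n. vnorm X (vdiff X (u n) l)) \<longlonglongrightarrow> 0"
  shows "met.mcomplete"
  unfolding met.mcomplete_def
proof (intro allI impI)
  fix u assume C: "met.MCauchy u"
  then have uX: "u n \<in> vcarrier X" for n
    unfolding met.MCauchy_def by auto
  have "\<exists>N. \<forall>n m. N \<le> n \<longrightarrow> N \<le> m \<longrightarrow> vdist X (u n) (u m) < (1/2)^k" for k :: nat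
    using C unfolding met.MCauchy_def by (meson half_gt_zero_iff zero_less_one zero_less_power)
  then obtain N where N: "\<And>k n m. N k \<le> n \<Longrightarrow> N k \<le> m \<Longrightarrow> vdist X (u n) (u m) < (1/2)^k"
    by metis
  define r where "r = rec_nat (N 0) (\<lambda>k x. max (Suc x) (N (Suc k)))"
  have r0: "r 0 = N 0" and rS: "\<And>k. r (Suc k) = max (Suc (r k)) (N (Suc k))"
    by (simp_all add: r_def)
  have "strict_mono r" by (rule strict_monoI_Suc) (simp add: rS)
  have rN: "N k \<le> r k" for k by (cases k) (simp_all add: r0 rS)
  have "vnorm X (vdiff X ((u \<circ> r) (Suc k)) ((u \<circ> r) k)) < (1/2)^k" for k
    using N[of k "r (Suc k)" "r k"] rN[of k] uX by (simp add: dist_eq rS)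
  then obtain l where l: "l \<in> vcarrier X" "(\<lambda>n. vnorm X (vdiff X ((u \<circ> r) n) l)) \<longlonglongrightarrow> 0"
    using assms[of "u \<circ> r"] uX by auto
  then have "limitin met.mtopology (u \<circ> r) l sequentially"
    using uX by (simp add: met.limitin_metric_dist_null dist_eq)
  then have "limitin met.mtopology u l sequentially"
    using met.MCauchy_convergent_subsequence[OF C \<open>strict_mono r\<close>] by blast
  then show "\<exists>x. limitin met.mtopology u x sequentially" ..
qed

end

lemma banach_onI:
  assumes "normed_on X" and "Metric_space.mcomplete (vcarrier X) (vdist X)"
  shows "banach_on X"
  using assms unfolding banach_on_def normed_on_def
  by (elim conjE) (intro conjI; assumption)

lemma normed_on_subspace:
  assumes "normed_on X" and S: "S \<subseteq> vcarrier X" "vzero X \<in> S"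
    and "\<And>u v. \<lbrakk>u \<in> S; v \<in> S\<rbrakk> \<Longrightarrow> vadd X u v \<in> S" "\<And>a u. u \<in> S \<Longrightarrow> vscale X a u \<in> S"
  shows "normed_on (X\<lparr>vcarrier := S\<rparr>)"
proof -
  interpret X: normed_on X by fact
  have S': "u \<in> S \<Longrightarrow> u \<in> vcarrier X" for u using S by auto
  have d: "vdiff (X\<lparr>vcarrier := S\<rparr>) = vdiff X" by (simp add: vdiff_def fun_eq_iff)
  have com: "\<lbrakk>u \<in> S; v \<in> S\<rbrakk> \<Longrightarrow> vadd X u v = vadd X v u" for u v
    using X.add_commute S' by blast
  show ?thesis
    by (rule normed_on.intro, simp_all only: d nspace.simps)
      (simp_all add: S assms(4,5) S' X.add_assoc X.add_zero X.diff_self X.scale_add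
        X.add_scale X.scale_scale X.scale_one X.norm_nonneg X.norm_eq_zero X.norm_scale
        X.norm_triangle, erule (1) com)
qed

section \<open>Affine maps are smooth\<close>

lemma op_norm_le_0: "op_norm_le X Y 0 L K \<longleftrightarrow> vnorm Y (L []) \<le> K"
  by (simp add: op_norm_le_def)

lemma op_norm_le_Suc_0:
  "op_norm_le X Y (Suc 0) L K \<longleftrightarrow> (\<forall>h\<in>vcarrier X. vnorm Y (L [h]) \<le> K * vnorm X h)"
  unfolding op_norm_le_def by (auto simp: length_Suc_conv)

lemma multilinear_on_0: "multilinear_on X Y 0 L \<longleftrightarrow> L [] \<in> vcarrier Y"
  by (simp add: multilinear_on_def)

lemma multilinear_on_Suc_0:
  assumes "\<And>h. h \<in> vcarrier X \<Longrightarrow> L [h] \<in> vcarrier Y"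
    and "\<And>h k. \<lbrakk>h \<in> vcarrier X; k \<in> vcarrier X\<rbrakk> \<Longrightarrow> L [vadd X h k] = vadd Y (L [h]) (L [k])"
    and "\<And>a h. h \<in> vcarrier X \<Longrightarrow> L [vscale X a h] = vscale Y a (L [h])"
  shows "multilinear_on X Y (Suc 0) L"
  unfolding multilinear_on_def
proof (intro allI impI conjI ballI; elim conjE)
  fix hs assume "length hs = Suc 0" "set hs \<subseteq> vcarrier X"
  then obtain h where h: "hs = [h]" "h \<in> vcarrier X" by (auto simp: length_Suc_conv)
  show "L hs \<in> vcarrier Y" using h assms(1) by simp
  fix i u v a assume i: "i < Suc 0" and uv: "u \<in> vcarrier X" "v \<in> vcarrier X"
  show "L (hs[i := vadd X u v]) = vadd Y (L (hs[i := u])) (L (hs[i := v]))"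
    using i h assms(2)[OF uv] by simp
  show "L (hs[i := vscale X a u]) = vscale Y a (L (hs[i := u]))"
    using i h assms(3)[OF uv(1)] by simp
qed

text \<open>The derivatives of such a map are \<open>f\<close> itself, the constant \<open>A\<close>, and zero from order two on, so
  continuity of \<open>f\<close> is the only condition with content; it follows from the bound on \<open>A\<close>. The hypothesis
  is local to \<open>U\<close> because \<open>f\<close> is only compared with itself at points of \<open>U\<close>.\<close>

lemma Ck_on_affine:
  assumes X: "normed_on X" and Y: "normed_on Y" and U: "U \<subseteq> vcarrier X"
    and f: "\<And>u. u \<in> U \<Longrightarrow> f u \<in> vcarrier Y"
    and A: "\<And>h. h \<in> vcarrier X \<Longrightarrow> A h \<in> vcarrier Y"
    and A_add: "\<And>h k. \<lbrakk>h \<in> vcarrier X; k \<in> vcarrier X\<rbrakk> \<Longrightarrow> A (vadd X h k) = vadd Y (A h) (A k)"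
    and A_scale: "\<And>a h. h \<in> vcarrier X \<Longrightarrow> A (vscale X a h) = vscale Y a (A h)"
    and A_bound: "\<And>h. h \<in> vcarrier X \<Longrightarrow> vnorm Y (A h) \<le> K * vnorm X h"
    and affine: "\<And>u h. \<lbrakk>u \<in> U; h \<in> vcarrier X; vadd X u h \<in> U\<rbrakk>
                   \<Longrightarrow> f (vadd X u h) = vadd Y (f u) (A h)"
  shows "Ck_on k X U Y f"
proof -
  interpret X: normed_on X by fact
  interpret Y: normed_on Y by fact
  define D where "D j u hs = (case j of 0 \<Rightarrow> f u | Suc 0 \<Rightarrow> A (hd hs) | _ \<Rightarrow> vzero Y)"
    for j :: nat and u hs
  have D0: "D 0 = (\<lambda>u hs. f u)" and D1: "D (Suc 0) = (\<lambda>u hs. A (hd hs))"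
    and D2: "\<And>j. D (Suc (Suc j)) = (\<lambda>u hs. vzero Y)"
    by (auto simp: D_def fun_eq_iff)
  have pos: "0 \<le> prod_list (map (vnorm X) hs)" if "set hs \<subseteq> vcarrier X" for hs
    using that by (induction hs) (auto simp: X.norm_nonneg)
  have small: "\<exists>\<delta>>0. \<forall>v\<in>U. vdist X v u < \<delta> \<longrightarrow> vnorm Y (vdiff Y (f v) (f u)) \<le> \<epsilon>"
    if u: "u \<in> U" and e: "\<epsilon> > 0" for u \<epsilon>
  proof (intro exI conjI ballI impI)
    show "0 < \<epsilon> / (\<bar>K\<bar> + 1)" using e by simp
    fix v assume v: "v \<in> U" and d: "vdist X v u < \<epsilon> / (\<bar>K\<bar> + 1)"
    let ?h = "vdiff X v u"
    have uX: "u \<in> vcarrier X" "v \<in> vcarrier X" using u v U by auto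
    have h: "?h \<in> vcarrier X" using uX X.diff_closed by blast
    have uh: "vadd X u ?h = v" using X.diff_add[of v u] X.add_commute uX h by metis
    have "f v = vadd Y (f u) (A ?h)" using affine[of u ?h] u v h uh by simp
    then have "vdiff Y (f v) (f u) = A ?h" using Y.add_diff f u A h by simp
    then have "vnorm Y (vdiff Y (f v) (f u)) \<le> K * vnorm X ?h" using A_bound h by simp
    also have "\<dots> \<le> (\<bar>K\<bar> + 1) * vnorm X ?h" using X.norm_nonneg[OF h] by (intro mult_right_mono) auto
    also have "\<dots> \<le> \<epsilon>" using d uX by (simp add: X.dist_eq field_simps)
    finally show "vnorm Y (vdiff Y (f v) (f u)) \<le> \<epsilon>" .
  qed
  have zz: "vadd Y (vzero Y) (vzero Y) = vzero Y" "vdiff Y (vzero Y) (vzero Y) = vzero Y"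
    by (simp_all add: Y.add_zero Y.diff_zero Y.zero_closed)
  have op_zero: "op_norm_le X Y j (\<lambda>hs. vzero Y) K" if "K \<ge> 0" for j K
    using that pos by (simp add: op_norm_le_def Y.norm_zero)
  have multi: "multilinear_on X Y j (D j u)" and bound: "\<exists>K. op_norm_le X Y j (D j u) K"
    if u: "u \<in> U" for j u
  proof -
    consider "j = 0" | "j = Suc 0" | i where "j = Suc (Suc i)" by (metis nat.exhaust)
    then have "multilinear_on X Y j (D j u) \<and> (\<exists>K. op_norm_le X Y j (D j u) K)"
    proof cases
      case 1
      show ?thesis unfolding 1 D0 multilinear_on_0 op_norm_le_0 using f[OF u] by blast
    next
      case 2
      have "multilinear_on X Y (Suc 0) (D (Suc 0) u)"
        by (rule multilinear_on_Suc_0) (simp_all add: D1 A A_add A_scale)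
      moreover have "op_norm_le X Y (Suc 0) (D (Suc 0) u) K"
        by (simp add: op_norm_le_Suc_0 D1 A_bound)
      ultimately show ?thesis unfolding 2 by blast
    next
      case 3
      have "multilinear_on X Y j (D j u)"
        by (simp add: 3 D2 multilinear_on_def zz Y.scale_zero Y.zero_closed)
      then show ?thesis using op_zero[of 0] unfolding 3 D2 by blast
    qed
    then show "multilinear_on X Y j (D j u)" and "\<exists>K. op_norm_le X Y j (D j u) K" by auto
  qed
  have cont: "op_continuous_on X U Y j (D j)" for j
    unfolding op_continuous_on_def
  proof (intro ballI allI impI)
    fix u and \<epsilon> :: real assume u: "u \<in> U" and e: "0 < \<epsilon>"
    show "\<exists>\<delta>>0. \<forall>v\<in>U. vdist X v u < \<delta> \<longrightarrow>
            op_norm_le X Y j (\<lambda>hs. vdiff Y (D j v hs) (D j u hs)) \<epsilon>"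
    proof (cases "j = 0")
      case True
      show ?thesis unfolding True D0 op_norm_le_0 using small[OF u e] .
    next
      case False
      have "op_norm_le X Y j (\<lambda>hs. vdiff Y (D j v hs) (D j u hs)) \<epsilon>" for v
      proof (cases "j = Suc 0")
        case True
        show ?thesis
          unfolding True D1 op_norm_le_Suc_0 using e A X.norm_nonneg
          by (simp add: Y.diff_self Y.norm_zero)
      next
        case False
        with \<open>j \<noteq> 0\<close> obtain i where j: "j = Suc (Suc i)" by (metis nat.exhaust)
        show ?thesis unfolding j D2 zz using op_zero e by simp
      qed
      then show ?thesis using zero_less_one by blast
    qed
  qed
  have deriv: "op_has_derivative_on X U Y j (D j) (D (Suc j))" for j
    unfolding op_has_derivative_on_def
  proof (intro ballI allI impI)
    fix u and \<epsilon> :: real assume u: "u \<in> U" and e: "0 < \<epsilon>"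
    have "op_norm_le X Y j
        (\<lambda>hs. vdiff Y (vdiff Y (D j (vadd X u h) hs) (D j u hs)) (D (Suc j) u (h # hs))) (\<epsilon> * vnorm X h)"
      if h: "h \<in> vcarrier X" and uh: "vadd X u h \<in> U" for h
    proof -
      have eh: "0 \<le> \<epsilon> * vnorm X h" using e X.norm_nonneg[OF h] by simp
      consider "j = 0" | "j = Suc 0" | i where "j = Suc (Suc i)" by (metis nat.exhaust)
      then show ?thesis
      proof cases
        case 1
        have "vdiff Y (vdiff Y (f (vadd X u h)) (f u)) (A h) = vzero Y"
          unfolding affine[OF u h uh] Y.add_diff[OF f[OF u] A[OF h]] by (rule Y.diff_self[OF A[OF h]])
        then show ?thesis unfolding 1 D0 D1 op_norm_le_0 using eh by (simp add: Y.norm_zero)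
      next
        case 2
        show ?thesis
          unfolding 2 D1 D2 op_norm_le_Suc_0 using eh X.norm_nonneg
          by (simp add: A Y.diff_self zz Y.norm_zero)
      next
        case 3
        show ?thesis unfolding 3 D2 zz using op_zero eh by simp
      qed
    qed
    then show "\<exists>\<delta>>0. \<forall>h\<in>vcarrier X. vadd X u h \<in> U \<and> vnorm X h < \<delta> \<longrightarrow> op_norm_le X Y j
        (\<lambda>hs. vdiff Y (vdiff Y (D j (vadd X u h) hs) (D j u hs)) (D (Suc j) u (h # hs))) (\<epsilon> * vnorm X h)"
      using zero_less_one by blast
  qed
  have "\<forall>u\<in>U. D 0 u [] = f u" by (simp add: D0)
  then show ?thesis
    unfolding Ck_on_def bounded_multilinear_on_def using multi bound cont deriv by blast
qed

lemma Ck_on_cong: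
  assumes "Ck_on k X U Y f" "\<And>u. u \<in> U \<Longrightarrow> f' u = f u"
  shows "Ck_on k X U Y f'"
  using assms unfolding Ck_on_def by metis

section \<open>Functions modulo null sets, and the completed measure\<close>

text \<open>A function that agrees with a measurable one off a null set has preimages that differ from
  measurable sets by subsets of null sets.\<close>

lemma measurable_completion_AE:
  fixes f h :: "'a \<Rightarrow> real"
  assumes eq: "AE t in M. f t = h t" and h: "h \<in> borel_measurable M"
  shows "f \<in> borel_measurable (completion M)"
proof (rule measurableI)
  fix A :: "real set" assume A: "A \<in> sets borel"
  have hA: "h -` A \<inter> space (completion M) \<in> sets (completion M)"
    using measurable_sets[OF measurable_completion[OF h] A] .
  show "f -` A \<inter> space (completion M) \<in> sets (completion M)"
  proof (rule completion.in_sets_AE[OF _ hA])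
    show "AE t in completion M. t \<in> h -` A \<inter> space (completion M) \<longleftrightarrow> t \<in> f -` A \<inter> space (completion M)"
      by (rule AE_completion) (use eq in eventually_elim, simp)
  qed auto
qed auto

lemma integral_completion_AE:
  fixes f h :: "'a \<Rightarrow> real"
  assumes eq: "AE t in M. f t = h t" and h: "h \<in> borel_measurable M"
  shows integrable_completion_cong: "integrable (completion M) f \<longleftrightarrow> integrable M h"
    and integral_completion_cong: "integral\<^sup>L (completion M) f = integral\<^sup>L M h"
proof -
  note fm = measurable_completion_AE[OF eq h] and hm = measurable_completion[OF h]
  note eq' = AE_completion[OF eq]
  show "integrable (completion M) f \<longleftrightarrow> integrable M h"
    using integrable_cong_AE[OF fm hm eq'] integrable_completion[OF h] by simp
  show "integral\<^sup>L (completion M) f = integral\<^sup>L M h"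
    using integral_cong_AE[OF fm hm eq'] integral_completion[OF h] by simp
qed

lemma ae_class_cong:
  assumes "AE t in M. f t = h t"
  shows "ae_class M f = ae_class M h"
proof -
  have "(AE t in M. k t = f t) \<longleftrightarrow> (AE t in M. k t = h t)" for k
  proof
    show "AE t in M. k t = h t" if "AE t in M. k t = f t" using that assms by eventually_elim simp
    show "AE t in M. k t = f t" if "AE t in M. k t = h t" using that assms by eventually_elim simp
  qed
  then show ?thesis by (simp add: ae_class_def)
qed

lemma rep_ae_class:
  assumes "f \<in> borel_measurable M"
  shows rep_ae_class_measurable: "rep (ae_class M f) \<in> borel_measurable M"
    and rep_ae_class_AE: "AE t in M. rep (ae_class M f) t = f t"
proof -
  have "f \<in> ae_class M f" using assms by (simp add: ae_class_def)
  then have "rep (ae_class M f) \<in> ae_class M f" unfolding rep_def by (rule someI[of "\<lambda>k. k \<in> ae_class M f"])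
  then show "rep (ae_class M f) \<in> borel_measurable M" "AE t in M. rep (ae_class M f) t = f t"
    by (simp_all add: ae_class_def)
qed

lemma ae_class_eq_iff:
  assumes "f \<in> borel_measurable M"
  shows "ae_class M f = ae_class M h \<longleftrightarrow> (AE t in M. f t = h t)"
proof
  assume "ae_class M f = ae_class M h"
  moreover have "f \<in> ae_class M f" using assms by (simp add: ae_class_def)
  ultimately show "AE t in M. f t = h t" by (simp add: ae_class_def)
qed (rule ae_class_cong)

lemma ae_class_in_L0: "f \<in> borel_measurable M \<Longrightarrow> ae_class M f \<in> L0 M"
  by (simp add: L0_def)

lemma L0_rep:
  assumes "u \<in> L0 M"
  shows rep_measurable: "rep u \<in> borel_measurable M" and ae_class_rep: "ae_class M (rep u) = u"
proof -
  obtain f where f: "f \<in> borel_measurable M" "u = ae_class M f" using assms by (auto simp: L0_def)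
  then show "rep u \<in> borel_measurable M" "ae_class M (rep u) = u"
    using rep_ae_class_measurable[OF f(1)] ae_class_cong[OF rep_ae_class_AE[OF f(1)]] by simp_all
qed

lemma ae_class_lin:
  assumes f: "f \<in> borel_measurable M" and h: "h \<in> borel_measurable M"
  shows ae_class_add: "ae_class M (\<lambda>t. rep (ae_class M f) t + rep (ae_class M h) t) = ae_class M (\<lambda>t. f t + h t)"
    and ae_class_scale: "ae_class M (\<lambda>t. a * rep (ae_class M f) t) = ae_class M (\<lambda>t. a * f t)"
proof -
  note ae = rep_ae_class_AE[OF f] rep_ae_class_AE[OF h]
  show "ae_class M (\<lambda>t. rep (ae_class M f) t + rep (ae_class M h) t) = ae_class M (\<lambda>t. f t + h t)"
    by (rule ae_class_cong) (use ae in eventually_elim, simp)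
  show "ae_class M (\<lambda>t. a * rep (ae_class M f) t) = ae_class M (\<lambda>t. a * f t)"
    by (rule ae_class_cong) (use ae(1) in eventually_elim, simp)
qed

lemma integral_strict_mono:
  fixes f h :: "'a \<Rightarrow> real"
  assumes f: "integrable M f" and h: "integrable M h" and less: "\<And>t. t \<in> space M \<Longrightarrow> f t < h t"
    and M: "\<not> (AE t in M. False)"
  shows "integral\<^sup>L M f < integral\<^sup>L M h"
proof -
  have i: "integrable M (\<lambda>t. h t - f t)" using f h by simp
  have nn: "AE t in M. 0 \<le> h t - f t" using less by (intro AE_I2) (simp add: less_imp_le)
  have "integral\<^sup>L M (\<lambda>t. h t - f t) \<noteq> 0"
  proof
    assume "integral\<^sup>L M (\<lambda>t. h t - f t) = 0"
    then have "AE t in M. h t - f t = 0"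
      using integral_nonneg_eq_0_iff_AE[OF i nn] by simp
    then have "AE t in M. False" using AE_space by eventually_elim (use less in fastforce)
    with M show False by simp
  qed
  moreover have "0 \<le> integral\<^sup>L M (\<lambda>t. h t - f t)" using nn by (rule integral_nonneg_AE)
  ultimately show ?thesis using f h by simp
qed

section \<open>Families of convex functions with integrable superposition\<close>

text \<open>The slopes \<open>(f (x + h) - f x) / h\<close> increase with \<open>h > 0\<close> and are bounded below by the slope to the
  left of \<open>x\<close>, so they converge to their infimum as \<open>h\<close> tends to \<open>0\<close>. Being a lower bound of
  all slopes, the limit gives the supporting line on the right; the left slope keeps it positive when
  \<open>f\<close> is strictly increasing.\<close>

lemma convex_has_right_derivative:
  fixes f :: "real \<Rightarrow> real"
  assumes f: "convex_on UNIV f"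
  obtains D where "(f has_vector_derivative D) (at_right x)"
    and "\<And>h. 0 \<le> h \<Longrightarrow> h * D \<le> f (x + h) - f x" and "f x - f (x - 1) \<le> D"
proof -
  define s where "s h = (f (x + h) - f x) / h" for h
  have s_mono: "s h \<le> s k" if "0 < h" "h \<le> k" for h k
  proof -
    \<comment> \<open>\<open>x + h\<close> lies between \<open>x\<close> and \<open>x + k\<close>, with weight \<open>h / k\<close>.\<close>
    have "f ((1 - h / k) *\<^sub>R x + (h / k) *\<^sub>R (x + k)) \<le> (1 - h / k) * f x + h / k * f (x + k)"
      using that by (intro convex_onD[OF f]) auto
    moreover have "(1 - h / k) *\<^sub>R x + (h / k) *\<^sub>R (x + k) = x + h"
      using that by (simp add: field_simps)
    ultimately have "f (x + h) - f x \<le> h / k * (f (x + k) - f x)"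
      by (simp add: algebra_simps)
    then show ?thesis using that by (simp add: s_def field_simps)
  qed
  have s_lower: "f x - f (x - 1) \<le> s h" if "0 < h" for h
  proof -
    \<comment> \<open>The weight for which \<open>x\<close> is a convex combination of \<open>x - 1\<close> and \<open>x + h\<close>.\<close>
    define r where "r = 1 / (1 + h)"
    have r: "0 < r" "r < 1" "r * h = 1 - r" using that by (auto simp: r_def field_simps)
    have "f ((1 - r) *\<^sub>R (x - 1) + r *\<^sub>R (x + h)) \<le> (1 - r) * f (x - 1) + r * f (x + h)"
      using r by (intro convex_onD[OF f]) auto
    moreover have "(1 - r) *\<^sub>R (x - 1) + r *\<^sub>R (x + h) = x"
      using r(3) by (simp add: distrib_left right_diff_distrib left_diff_distrib)
    ultimately have "f x \<le> (1 - r) * f (x - 1) + r * f (x + h)" by simp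
    then have "(1 - r) * (f x - f (x - 1)) \<le> r * (f (x + h) - f x)"
      by (simp add: left_diff_distrib right_diff_distrib)
    then have "r * (h * (f x - f (x - 1))) \<le> r * (f (x + h) - f x)"
      using r by (simp add: mult.assoc[symmetric])
    then have "h * (f x - f (x - 1)) \<le> f (x + h) - f x"
      using r by (simp only: mult_le_cancel_left_pos)
    then show ?thesis using that by (simp add: s_def field_simps)
  qed
  define D where "D = Inf (s ` {0<..})"
  have bdd: "bdd_below (s ` {0<..})" using s_lower by (intro bdd_belowI2) auto
  have D_le: "D \<le> s h" if "0 < h" for h unfolding D_def using that bdd by (intro cInf_lower) auto
  have "(s \<longlongrightarrow> D) (at_right 0)"
  proof (rule order_tendstoI)
    fix a assume "a < D"
    then have "\<And>h. 0 < h \<Longrightarrow> a < s h" using D_le by force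
    then show "\<forall>\<^sub>F h in at_right 0. a < s h"
      by (auto simp: eventually_at_right_field intro!: exI[of _ 1])
  next
    fix a assume "D < a"
    then obtain k where "0 < k" "s k < a"
      unfolding D_def using bdd by (subst (asm) cInf_less_iff) auto
    then show "\<forall>\<^sub>F h in at_right 0. s h < a"
      using s_mono by (auto simp: eventually_at_right_field intro!: exI[of _ k]) (meson less_imp_le order_le_less_trans)
  qed
  then have "((\<lambda>y. s (y - x)) \<longlongrightarrow> D) (at_right x)"
    by (simp add: filterlim_at_right_to_0[of _ _ x])
  then have "((\<lambda>y. (f y - f x) / (y - x)) \<longlongrightarrow> D) (at_right x)"
    by (simp add: s_def)
  then have "(f has_vector_derivative D) (at_right x)"
    by (simp add: has_real_derivative_iff_has_vector_derivative[symmetric] has_field_derivative_iff)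
  moreover have "h * D \<le> f (x + h) - f x" if "0 \<le> h" for h
    using that D_le[of h] by (cases "h = 0") (simp_all add: s_def field_simps)
  moreover have "f x - f (x - 1) \<le> D"
    unfolding D_def using s_lower by (intro cInf_greatest) auto
  ultimately show thesis by (rule that)
qed

lemma ennreal_mult_add:
  assumes "0 \<le> p" "0 \<le> q" "0 \<le> x" "0 \<le> y"
  shows "ennreal (p * x + q * y) = ennreal p * ennreal x + ennreal q * ennreal y"
  using assms by (simp add: ennreal_plus ennreal_mult)

text \<open>The properties of a \<open>\<phi>\<close>-function, for real arguments and at every point \<open>t\<close>. The model case is
  \<open>g t = exp\<close>. Divergence at \<open>+\<infinity>\<close> is a consequence of convexity and strict monotonicity.\<close>

locale deformed_exponential =
  fixes M :: "'a measure" and g :: "'a \<Rightarrow> real \<Rightarrow> real"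
  assumes g_measurable: "\<And>y. (\<lambda>t. g t y) \<in> borel_measurable M"
    and g_convex: "\<And>t. convex_on UNIV (g t)"
    and g_strict_mono: "\<And>t. strict_mono (g t)"
    and g_pos: "\<And>t y. 0 < g t y"
    and g_at_bot: "\<And>t. (g t \<longlongrightarrow> 0) at_bot"
begin

lemma g_convexD: "0 \<le> r \<Longrightarrow> r \<le> 1 \<Longrightarrow> g t ((1 - r) * x + r * y) \<le> (1 - r) * g t x + r * g t y"
  using convex_onD[OF g_convex[of t], of r x y] by simp

lemma g_mono: "x \<le> y \<Longrightarrow> g t x \<le> g t y"
  using g_strict_mono by (simp add: strict_mono_less_eq)

lemma g_continuous: "continuous_on A (g t)"
  using convex_on_continuous[OF open_UNIV g_convex] continuous_on_subset by blast

text \<open>The increment vanishes at \<open>0\<close> and is convex, so it shrinks at least linearly.\<close>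

lemma g_increment_scale:
  assumes "0 \<le> a" "a \<le> 1"
  shows "g t (x + a * y) - g t x \<le> a * (g t (x + y) - g t x)"
proof -
  have "(1 - a) * x + a * (x + y) = x + a * y" by (simp add: algebra_simps)
  then show ?thesis using g_convexD[OF assms, of t x "x + y"] by (simp add: algebra_simps)
qed

text \<open>Only measurability in \<open>t\<close> for a fixed argument is given. For an argument with countably many values the
  superposition is glued from countably many pieces; rounding \<open>u\<close> down to multiples of \<open>1 / (n + 1)\<close>
  and continuity of \<open>g t\<close> give the general case.\<close>

lemma g_comp_measurable [measurable]:
  assumes u: "u \<in> borel_measurable M"
  shows "(\<lambda>t. g t (u t)) \<in> borel_measurable M"
proof (rule borel_measurable_LIMSEQ_real)
  define v where "v n t = of_int \<lfloor>real (Suc n) * u t\<rfloor> / real (Suc n)" for n t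
  show "(\<lambda>t. g t (v n t)) \<in> borel_measurable M" for n
    unfolding v_def
    by (rule measurable_compose_countable[where g="\<lambda>t. \<lfloor>real (Suc n) * u t\<rfloor>"])
       (use u g_measurable in measurable)
  fix t
  have "(\<lambda>n. v n t) \<longlonglongrightarrow> u t"
  proof (rule tendsto_sandwich)
    have floor: "x - 1 / N \<le> of_int \<lfloor>N * x\<rfloor> / N" "of_int \<lfloor>N * x\<rfloor> / N \<le> x" if "N > 0" for N x :: real
    proof -
      have "(N * x - 1) / N \<le> of_int \<lfloor>N * x\<rfloor> / N" "of_int \<lfloor>N * x\<rfloor> / N \<le> (N * x) / N"
        using that real_of_int_floor_gt_diff_one[of "N * x"] of_int_floor_le[of "N * x"]
        by (intro divide_right_mono; simp)+
      then show "x - 1 / N \<le> of_int \<lfloor>N * x\<rfloor> / N" "of_int \<lfloor>N * x\<rfloor> / N \<le> x"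
        using that by (simp_all add: diff_divide_distrib)
    qed
    have "\<And>n. u t - 1 / real (Suc n) \<le> v n t"
      unfolding v_def by (rule floor) simp
    then show "\<forall>\<^sub>F n in sequentially. u t - 1 / real (Suc n) \<le> v n t" by simp
    have "\<And>n. v n t \<le> u t"
      unfolding v_def by (rule floor) simp
    then show "\<forall>\<^sub>F n in sequentially. v n t \<le> u t" by simp
    show "(\<lambda>n. u t - 1 / real (Suc n)) \<longlonglongrightarrow> u t"
      using tendsto_diff[OF tendsto_const LIMSEQ_inverse_real_of_nat, of "u t"]
      by (simp add: inverse_eq_divide)
  qed simp
  then show "(\<lambda>n. g t (v n t)) \<longlonglongrightarrow> g t (u t)"
    using g_continuous[of UNIV t] isCont_tendsto_compose[of "u t" "g t" "\<lambda>n. v n t" sequentially]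
    by (simp add: continuous_on_eq_continuous_at)
qed

definition right_deriv :: "('a \<Rightarrow> real) \<Rightarrow> 'a \<Rightarrow> real" where
  "right_deriv c t = vector_derivative (g t) (at_right (c t))"

lemma right_deriv:
  shows right_deriv_has: "(g t has_vector_derivative right_deriv c t) (at_right (c t))"
    and right_deriv_le: "0 \<le> h \<Longrightarrow> h * right_deriv c t \<le> g t (c t + h) - g t (c t)"
    and right_deriv_pos: "0 < right_deriv c t"
proof -
  obtain D where D: "(g t has_vector_derivative D) (at_right (c t))"
     "\<And>h. 0 \<le> h \<Longrightarrow> h * D \<le> g t (c t + h) - g t (c t)" "g t (c t) - g t (c t - 1) \<le> D"
    using convex_has_right_derivative[OF g_convex] by blast
  have "right_deriv c t = D"
    unfolding right_deriv_def using D(1) by (intro vector_derivative_within) (auto simp: trivial_limit_at_right_real)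
  moreover have "g t (c t - 1) < g t (c t)" using g_strict_mono by (simp add: strict_mono_less)
  ultimately show "(g t has_vector_derivative right_deriv c t) (at_right (c t))"
    "0 \<le> h \<Longrightarrow> h * right_deriv c t \<le> g t (c t + h) - g t (c t)" "0 < right_deriv c t"
    using D by auto
qed

text \<open>The right derivative is the limit of difference quotients along \<open>1 / (n + 1)\<close>.\<close>

lemma right_deriv_measurable [measurable]:
  assumes c [measurable]: "c \<in> borel_measurable M"
  shows "right_deriv c \<in> borel_measurable M"
proof (rule borel_measurable_LIMSEQ_real)
  let ?q = "\<lambda>n t. (g t (c t + 1 / real (Suc n)) - g t (c t)) / (1 / real (Suc n))"
  show "?q n \<in> borel_measurable M" for n by measurable
  fix t
  have *: "((\<lambda>y. (g t y - g t (c t)) / (y - c t)) \<longlongrightarrow> right_deriv c t) (at_right (c t))"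
    using right_deriv_has[of t c]
    by (simp add: has_real_derivative_iff_has_vector_derivative[symmetric] has_field_derivative_iff)
  have "filterlim (\<lambda>n. c t + 1 / real (Suc n)) (at_right (c t)) sequentially"
    unfolding filterlim_at
  proof
    show "\<forall>\<^sub>F n in sequentially. c t + 1 / real (Suc n) \<in> {c t<..} \<and> c t + 1 / real (Suc n) \<noteq> c t"
      by simp
    show "(\<lambda>n. c t + 1 / real (Suc n)) \<longlonglongrightarrow> c t"
      using tendsto_add[OF tendsto_const LIMSEQ_inverse_real_of_nat, of "c t"]
      by (simp add: inverse_eq_divide)
  qed
  from filterlim_compose[OF * this] show "(\<lambda>n. ?q n t) \<longlonglongrightarrow> right_deriv c t" by simp
qed

definition g_integrable :: "('a \<Rightarrow> real) \<Rightarrow> bool" where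
  "g_integrable u \<longleftrightarrow> u \<in> borel_measurable M \<and> integrable M (\<lambda>t. g t (u t))"

lemma g_integrable_measurable: "g_integrable u \<Longrightarrow> u \<in> borel_measurable M"
  by (simp add: g_integrable_def)

lemma g_integrable_mono:
  assumes "g_integrable b" "a \<in> borel_measurable M" "\<And>t. t \<in> space M \<Longrightarrow> a t \<le> b t"
  shows "g_integrable a"
  unfolding g_integrable_def
proof
  show "integrable M (\<lambda>t. g t (a t))"
  proof (rule Bochner_Integration.integrable_bound)
    show "integrable M (\<lambda>t. g t (b t))" using assms(1) by (simp add: g_integrable_def)
    show "AE t in M. norm (g t (a t)) \<le> norm (g t (b t))"
      using g_pos g_mono[OF assms(3)] by (intro AE_I2) (simp add: abs_of_pos)
  qed (use assms(2) in measurable)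
qed fact

lemma g_integrable_cong_AE:
  assumes "g_integrable c" "AE t in M. c t = d t" "d \<in> borel_measurable M"
  shows "g_integrable d"
proof -
  have m: "(\<lambda>t. g t (c t)) \<in> borel_measurable M" "(\<lambda>t. g t (d t)) \<in> borel_measurable M"
    using assms g_integrable_measurable by measurable
  have "AE t in M. g t (c t) = g t (d t)" using assms(2) by eventually_elim simp
  from integrable_cong_AE[OF m this] show ?thesis using assms by (simp add: g_integrable_def)
qed

lemma g_integrable_convex:
  assumes "g_integrable a" "g_integrable b" "0 \<le> r" "r \<le> 1"
  shows "g_integrable (\<lambda>t. (1 - r) * a t + r * b t)"
proof -
  have [measurable]: "a \<in> borel_measurable M" "b \<in> borel_measurable M"
    using assms by (simp_all add: g_integrable_def)
  have "integrable M (\<lambda>t. g t ((1 - r) * a t + r * b t))"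
  proof (rule Bochner_Integration.integrable_bound)
    show "integrable M (\<lambda>t. (1 - r) * g t (a t) + r * g t (b t))"
      using assms by (simp add: g_integrable_def)
    show "AE t in M. norm (g t ((1 - r) * a t + r * b t)) \<le> norm ((1 - r) * g t (a t) + r * g t (b t))"
    proof (rule AE_I2)
      fix t
      show "norm (g t ((1 - r) * a t + r * b t)) \<le> norm ((1 - r) * g t (a t) + r * g t (b t))"
        using g_convexD[OF assms(3,4), of t "a t" "b t"] g_pos[of t "(1 - r) * a t + r * b t"]
        by simp
    qed
  qed measurable
  then show ?thesis by (simp add: g_integrable_def)
qed

text \<open>Integrability of \<open>g\<close> along a line is a convex condition on the parameter.\<close>

lemma g_integrable_between:
  assumes "g_integrable (\<lambda>t. c t + a * u t)" "g_integrable (\<lambda>t. c t + b * u t)" "a \<le> r" "r \<le> b"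
  shows "g_integrable (\<lambda>t. c t + r * u t)"
proof (cases "a = b")
  case True
  then show ?thesis using assms by simp
next
  case False
  define s where "s = (r - a) / (b - a)"
  have s: "0 \<le> s" "s \<le> 1" using assms False by (auto simp: s_def field_simps)
  have "r - a = s * (b - a)" using False by (simp add: s_def)
  then have "(1 - s) * (c t + a * u t) + s * (c t + b * u t) = c t + r * u t" for t
    by algebra
  then show ?thesis using g_integrable_convex[OF assms(1,2) s] by simp
qed

lemma g_integrable_abs:
  assumes "g_integrable (\<lambda>t. c t + u t)" "g_integrable (\<lambda>t. c t - u t)"
    and [measurable]: "c \<in> borel_measurable M" "u \<in> borel_measurable M"
  shows "g_integrable (\<lambda>t. c t + \<bar>u t\<bar>)"
proof -
  have "integrable M (\<lambda>t. g t (c t + \<bar>u t\<bar>))"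
  proof (rule Bochner_Integration.integrable_bound)
    show "integrable M (\<lambda>t. g t (c t + u t) + g t (c t - u t))"
      using assms by (simp add: g_integrable_def)
    have "g t (c t + \<bar>u t\<bar>) \<le> g t (c t + u t) + g t (c t - u t)" for t
      using g_pos[of t "c t + u t"] g_pos[of t "c t - u t"] by (cases "0 \<le> u t") simp_all
    then show "AE t in M. norm (g t (c t + \<bar>u t\<bar>)) \<le> norm (g t (c t + u t) + g t (c t - u t))"
      using g_pos by (intro AE_I2) (simp add: abs_of_pos add_pos_pos)
  qed measurable
  then show ?thesis by (simp add: g_integrable_def)
qed

end

section \<open>The modular and the Luxemburg norm\<close>

context deformed_exponential begin

definition g_modular :: "('a \<Rightarrow> real) \<Rightarrow> ('a \<Rightarrow> real) \<Rightarrow> ennreal" where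
  "g_modular c w = (\<integral>\<^sup>+t. ennreal (g t (c t + \<bar>w t\<bar>) - g t (c t)) \<partial>M)"

definition orlicz :: "('a \<Rightarrow> real) \<Rightarrow> ('a \<Rightarrow> real) \<Rightarrow> bool" where
  "orlicz c w \<longleftrightarrow> w \<in> borel_measurable M \<and> (\<exists>r>0. g_modular c (\<lambda>t. r * w t) < \<infinity>)"

definition luxemburg :: "('a \<Rightarrow> real) \<Rightarrow> ('a \<Rightarrow> real) \<Rightarrow> real" where
  "luxemburg c w = Inf {r. 0 < r \<and> g_modular c (\<lambda>t. w t / r) \<le> 1}"

lemma orlicz_measurable: "orlicz c w \<Longrightarrow> w \<in> borel_measurable M"
  by (simp add: orlicz_def)

lemma g_modular_mono_AE:
  assumes "AE t in M. \<bar>w t\<bar> \<le> \<bar>v t\<bar>"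
  shows "g_modular c w \<le> g_modular c v"
  unfolding g_modular_def
proof (rule nn_integral_mono_AE)
  show "AE t in M. ennreal (g t (c t + \<bar>w t\<bar>) - g t (c t)) \<le> ennreal (g t (c t + \<bar>v t\<bar>) - g t (c t))"
    using assms
  proof eventually_elim
    case (elim t)
    then show ?case using g_mono[of "c t + \<bar>w t\<bar>" "c t + \<bar>v t\<bar>" t] by (intro ennreal_leI) simp
  qed
qed

lemma g_modular_mono: "(\<And>t. \<bar>w t\<bar> \<le> \<bar>v t\<bar>) \<Longrightarrow> g_modular c w \<le> g_modular c v"
  by (rule g_modular_mono_AE) simp

lemma g_modular_cong_AE:
  assumes "AE t in M. w t = v t"
  shows "g_modular c w = g_modular c v"
proof (rule antisym)
  show "g_modular c w \<le> g_modular c v" by (rule g_modular_mono_AE) (use assms in eventually_elim, simp)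
  show "g_modular c v \<le> g_modular c w" by (rule g_modular_mono_AE) (use assms in eventually_elim, simp)
qed

lemma g_modular_zero: "g_modular c (\<lambda>t. 0) = 0"
  by (simp add: g_modular_def)

lemma g_modular_scale:
  assumes a: "0 \<le> a" "a \<le> 1" and [measurable]: "c \<in> borel_measurable M" "w \<in> borel_measurable M"
  shows "g_modular c (\<lambda>t. a * w t) \<le> ennreal a * g_modular c w"
proof -
  have "g_modular c (\<lambda>t. a * w t) \<le> (\<integral>\<^sup>+t. ennreal a * ennreal (g t (c t + \<bar>w t\<bar>) - g t (c t)) \<partial>M)"
    unfolding g_modular_def
  proof (rule nn_integral_mono)
    fix t
    have "g t (c t + \<bar>a * w t\<bar>) - g t (c t) \<le> a * (g t (c t + \<bar>w t\<bar>) - g t (c t))"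
      using g_increment_scale[OF a, of t "c t" "\<bar>w t\<bar>"] a by (simp add: abs_mult)
    then show "ennreal (g t (c t + \<bar>a * w t\<bar>) - g t (c t))
        \<le> ennreal a * ennreal (g t (c t + \<bar>w t\<bar>) - g t (c t))"
      using a by (simp add: ennreal_mult'[symmetric] ennreal_leI)
  qed
  also have "\<dots> = ennreal a * g_modular c w"
    unfolding g_modular_def by (rule nn_integral_cmult) measurable
  finally show ?thesis .
qed

text \<open>Because \<open>g(c)\<close> is integrable, subtracting it in the modular does not affect finiteness.\<close>

lemma g_modular_finite_iff:
  assumes c: "g_integrable c" and w [measurable]: "w \<in> borel_measurable M"
  shows "g_modular c w < \<infinity> \<longleftrightarrow> g_integrable (\<lambda>t. c t + \<bar>w t\<bar>)"
proof -
  have [measurable]: "c \<in> borel_measurable M" and ci: "integrable M (\<lambda>t. g t (c t))"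
    using c by (simp_all add: g_integrable_def)
  let ?f = "\<lambda>t. g t (c t + \<bar>w t\<bar>) - g t (c t)"
  have nn: "0 \<le> ?f t" for t using g_mono[of "c t" "c t + \<bar>w t\<bar>" t] by simp
  have "g_modular c w < \<infinity> \<longleftrightarrow> integrable M ?f"
    unfolding g_modular_def integrable_iff_bounded using nn by simp
  also have "\<dots> \<longleftrightarrow> integrable M (\<lambda>t. g t (c t + \<bar>w t\<bar>))"
  proof
    assume "integrable M ?f"
    from Bochner_Integration.integrable_add[OF this ci]
    show "integrable M (\<lambda>t. g t (c t + \<bar>w t\<bar>))" by simp
  next
    assume "integrable M (\<lambda>t. g t (c t + \<bar>w t\<bar>))"
    from Bochner_Integration.integrable_diff[OF this ci] show "integrable M ?f" .
  qed
  finally show ?thesis by (simp add: g_integrable_def)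
qed

lemma orlicz_zero: "orlicz c (\<lambda>t. 0)"
  unfolding orlicz_def by (auto simp: g_modular_zero intro!: exI[of _ 1])

lemma orliczI:
  assumes "g_integrable c" "w \<in> borel_measurable M" "0 < r" "g_integrable (\<lambda>t. c t + r * \<bar>w t\<bar>)"
  shows "orlicz c w"
proof -
  have "g_modular c (\<lambda>t. r * w t) < \<infinity>"
    using assms by (subst g_modular_finite_iff) (simp_all add: abs_mult)
  then show ?thesis using assms unfolding orlicz_def by blast
qed

lemma orliczD:
  assumes "g_integrable c" "orlicz c w"
  obtains r where "0 < r" "g_integrable (\<lambda>t. c t + r * \<bar>w t\<bar>)"
proof -
  obtain r where r: "0 < r" "g_modular c (\<lambda>t. r * w t) < \<infinity>" and [measurable]: "w \<in> borel_measurable M"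
    using assms unfolding orlicz_def by blast
  have "(\<lambda>t. r * w t) \<in> borel_measurable M" by measurable
  from g_modular_finite_iff[OF assms(1) this] r have "g_integrable (\<lambda>t. c t + r * \<bar>w t\<bar>)"
    by (simp add: abs_mult)
  then show thesis using that r(1) by blast
qed

lemma orlicz_cong_AE:
  assumes "orlicz c w" "AE t in M. w t = v t" "v \<in> borel_measurable M"
  shows "orlicz c v"
proof -
  obtain r where r: "0 < r" "g_modular c (\<lambda>t. r * w t) < \<infinity>"
    using assms unfolding orlicz_def by blast
  moreover have "g_modular c (\<lambda>t. r * w t) = g_modular c (\<lambda>t. r * v t)"
    by (rule g_modular_cong_AE) (use assms(2) in eventually_elim, simp)
  ultimately show ?thesis using assms(3) unfolding orlicz_def by auto
qed

lemma luxemburg_cong_AE: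
  assumes "AE t in M. w t = v t"
  shows "luxemburg c w = luxemburg c v"
proof -
  have "g_modular c (\<lambda>t. w t / r) = g_modular c (\<lambda>t. v t / r)" for r
    by (rule g_modular_cong_AE) (use assms in eventually_elim, simp)
  then show ?thesis by (simp add: luxemburg_def)
qed

lemma orlicz_scale:
  assumes c: "g_integrable c" and w: "orlicz c w"
  shows "orlicz c (\<lambda>t. a * w t)"
proof (cases "a = 0")
  case True
  have "g_modular c (\<lambda>t. 1 * (a * w t)) < \<infinity>" using True by (simp add: g_modular_zero)
  then show ?thesis using orlicz_measurable[OF w] True unfolding orlicz_def by (auto intro!: exI[of _ 1])
next
  case False
  obtain r where r: "0 < r" "g_integrable (\<lambda>t. c t + r * \<bar>w t\<bar>)" using orliczD[OF c w] .
  have "(\<lambda>t. c t + r / \<bar>a\<bar> * \<bar>a * w t\<bar>) = (\<lambda>t. c t + r * \<bar>w t\<bar>)"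
    using False by (simp add: abs_mult)
  then show ?thesis
    using r False orlicz_measurable[OF w] c by (intro orliczI[of c _ "r / \<bar>a\<bar>"]) auto
qed

lemma orlicz_add:
  assumes c: "g_integrable c" and u: "orlicz c u" and v: "orlicz c v"
  shows "orlicz c (\<lambda>t. u t + v t)"
proof -
  have [measurable]: "c \<in> borel_measurable M" "u \<in> borel_measurable M" "v \<in> borel_measurable M"
    using c u v by (simp_all add: orlicz_measurable g_integrable_measurable)
  obtain r where r: "0 < r" "g_integrable (\<lambda>t. c t + r * \<bar>u t\<bar>)" using orliczD[OF c u] .
  obtain s where s: "0 < s" "g_integrable (\<lambda>t. c t + s * \<bar>v t\<bar>)" using orliczD[OF c v] .
  define m where "m = min r s / 2"
  have m: "0 < m" "2 * m \<le> r" "2 * m \<le> s" using r s by (auto simp: m_def)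
  show ?thesis
  proof (rule orliczI[OF c _ m(1)])
    show "g_integrable (\<lambda>t. c t + m * \<bar>u t + v t\<bar>)"
    proof (rule g_integrable_mono)
      show "g_integrable (\<lambda>t. (1 - 1/2) * (c t + r * \<bar>u t\<bar>) + 1/2 * (c t + s * \<bar>v t\<bar>))"
        by (rule g_integrable_convex) (use r s in auto)
      fix t
      have "m * \<bar>u t + v t\<bar> \<le> m * \<bar>u t\<bar> + m * \<bar>v t\<bar>"
        using m(1) abs_triangle_ineq[of "u t" "v t"] by (simp flip: distrib_left)
      moreover have "2 * m * \<bar>u t\<bar> \<le> r * \<bar>u t\<bar>" "2 * m * \<bar>v t\<bar> \<le> s * \<bar>v t\<bar>"
        using m by (intro mult_right_mono; simp)+
      ultimately have "m * \<bar>u t + v t\<bar> \<le> 1/2 * (r * \<bar>u t\<bar>) + 1/2 * (s * \<bar>v t\<bar>)"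
        by linarith
      then show "c t + m * \<bar>u t + v t\<bar> \<le> (1 - 1/2) * (c t + r * \<bar>u t\<bar>) + 1/2 * (c t + s * \<bar>v t\<bar>)"
        by (simp add: field_simps)
    qed measurable
  qed measurable
qed

lemma orlicz_diff:
  assumes "g_integrable c" "orlicz c u" "orlicz c v"
  shows "orlicz c (\<lambda>t. u t - v t)"
  using orlicz_add[OF assms(1,2) orlicz_scale[OF assms(1,3), of "-1"]] by simp

text \<open>A finite modular can be brought below \<open>1\<close> by scaling, by convexity; this is how bounds on the modular
  become bounds on the Luxemburg norm.\<close>

lemma g_modular_normalize:
  assumes c: "c \<in> borel_measurable M" and w: "w \<in> borel_measurable M"
    and B: "g_modular c w \<le> ennreal B"
  shows "g_modular c (\<lambda>t. w t / max 1 B) \<le> 1"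
proof -
  have "g_modular c (\<lambda>t. (1 / max 1 B) * w t) \<le> ennreal (1 / max 1 B) * g_modular c w"
    by (rule g_modular_scale[OF _ _ c w]) auto
  also have "\<dots> \<le> ennreal (1 / max 1 B) * ennreal (max 1 B)"
    using B by (intro mult_left_mono order_trans[OF B] ennreal_leI) auto
  also have "\<dots> = 1" by (simp add: ennreal_mult'[symmetric] max_def)
  finally show ?thesis by simp
qed

lemma luxemburg_attainable:
  assumes c: "c \<in> borel_measurable M" and w: "orlicz c w"
  obtains r where "0 < r" "g_modular c (\<lambda>t. w t / r) \<le> 1"
proof -
  obtain r where r: "0 < r" "g_modular c (\<lambda>t. r * w t) < \<infinity>" using w unfolding orlicz_def by blast
  then obtain B where B: "g_modular c (\<lambda>t. r * w t) = ennreal B"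
    by (cases "g_modular c (\<lambda>t. r * w t)") auto
  have "g_modular c (\<lambda>t. (r * w t) / max 1 B) \<le> 1"
    using c B by (intro g_modular_normalize borel_measurable_times borel_measurable_const orlicz_measurable[OF w]) simp_all
  moreover have "(\<lambda>t. (r * w t) / max 1 B) = (\<lambda>t. w t / (max 1 B / r))"
    using r by (simp add: field_simps)
  ultimately show thesis using r that[of "max 1 B / r"] by simp
qed

lemma luxemburg_bdd: "bdd_below {r. 0 < r \<and> g_modular c (\<lambda>t. w t / r) \<le> 1}"
  by (rule bdd_belowI[of _ 0]) auto

lemma luxemburg_le: "0 < r \<Longrightarrow> g_modular c (\<lambda>t. w t / r) \<le> 1 \<Longrightarrow> luxemburg c w \<le> r"
  unfolding luxemburg_def by (rule cInf_lower) (auto simp: luxemburg_bdd)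

lemma luxemburg_nonneg:
  assumes "c \<in> borel_measurable M" "orlicz c w"
  shows "0 \<le> luxemburg c w"
  unfolding luxemburg_def using luxemburg_attainable[OF assms] by (intro cInf_greatest) auto

text \<open>The scaled modular decreases in \<open>r\<close>, so every \<open>r\<close> above the infimum belongs to the set that defines
  the norm.\<close>

lemma luxemburg_less:
  assumes "c \<in> borel_measurable M" "orlicz c w" "luxemburg c w < r"
  shows "0 < r" "g_modular c (\<lambda>t. w t / r) \<le> 1"
proof -
  have "{r. 0 < r \<and> g_modular c (\<lambda>t. w t / r) \<le> 1} \<noteq> {}" using luxemburg_attainable[OF assms(1,2)] by blast
  then obtain s where s: "0 < s" "g_modular c (\<lambda>t. w t / s) \<le> 1" "s < r"
    using assms(3) unfolding luxemburg_def by (subst (asm) cInf_less_iff[OF _ luxemburg_bdd]) auto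
  then show "0 < r" by simp
  have "g_modular c (\<lambda>t. w t / r) \<le> g_modular c (\<lambda>t. w t / s)"
    using s by (intro g_modular_mono) (simp add: frac_le)
  then show "g_modular c (\<lambda>t. w t / r) \<le> 1" using s by simp
qed

lemma luxemburg_leI:
  assumes "\<And>r. luxemburg c w < r \<Longrightarrow> y \<le> k * r" "0 \<le> k"
  shows "y \<le> k * luxemburg c w"
proof (rule field_le_epsilon)
  fix e :: real assume e: "0 < e"
  have "y \<le> k * (luxemburg c w + e / (k + 1))" using assms e by (intro assms(1)) simp
  also have "\<dots> \<le> k * luxemburg c w + e"
    using assms(2) e by (simp add: field_simps)
  finally show "y \<le> k * luxemburg c w + e" .
qed

lemma luxemburg_abs_mono:
  assumes "c \<in> borel_measurable M" "orlicz c v" "AE t in M. \<bar>w t\<bar> \<le> \<bar>v t\<bar>"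
  shows "luxemburg c w \<le> luxemburg c v"
proof -
  have "luxemburg c w \<le> 1 * luxemburg c v"
  proof (rule luxemburg_leI)
    fix r assume "luxemburg c v < r"
    from luxemburg_less[OF assms(1,2) this] have r: "0 < r" "g_modular c (\<lambda>t. v t / r) \<le> 1" .
    have "g_modular c (\<lambda>t. w t / r) \<le> g_modular c (\<lambda>t. v t / r)"
      by (rule g_modular_mono_AE, use assms(3) in eventually_elim) (use r in \<open>simp add: divide_right_mono\<close>)
    then show "luxemburg c w \<le> 1 * r" using r luxemburg_le[of r c w] by simp
  qed simp
  then show ?thesis by simp
qed

text \<open>With \<open>k = s / (r + s)\<close> the function \<open>(u + v) / (r + s)\<close> is the convex combination of \<open>u / r\<close> and
  \<open>v / s\<close> with weights \<open>1 - k\<close> and \<open>k\<close>, so its modular is at most \<open>1\<close> if theirs are.\<close>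

lemma luxemburg_add:
  assumes c: "g_integrable c" and u: "orlicz c u" and v: "orlicz c v"
  shows "luxemburg c (\<lambda>t. u t + v t) \<le> luxemburg c u + luxemburg c v"
proof (rule field_le_epsilon)
  have [measurable]: "c \<in> borel_measurable M" "u \<in> borel_measurable M" "v \<in> borel_measurable M"
    using c u v by (simp_all add: orlicz_measurable g_integrable_measurable)
  fix e :: real assume e: "0 < e"
  define r s where "r = luxemburg c u + e / 2" and "s = luxemburg c v + e / 2"
  have r: "0 < r" "g_modular c (\<lambda>t. u t / r) \<le> 1" and s: "0 < s" "g_modular c (\<lambda>t. v t / s) \<le> 1"
    using luxemburg_less[OF _ u, of r] luxemburg_less[OF _ v, of s] e by (simp_all add: r_def s_def)
  define k where "k = s / (r + s)"
  have k: "0 \<le> k" "k \<le> 1" "1 - k = r / (r + s)" using r s by (simp_all add: k_def field_simps)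
  let ?F = "\<lambda>w t. g t (c t + \<bar>w t\<bar>) - g t (c t)"
  have nn: "0 \<le> ?F w t" for w t using g_mono[of "c t" "c t + \<bar>w t\<bar>" t] by simp
  have "g_modular c (\<lambda>t. (u t + v t) / (r + s)) \<le>
     (\<integral>\<^sup>+t. ennreal (1 - k) * ennreal (?F (\<lambda>t. u t / r) t) + ennreal k * ennreal (?F (\<lambda>t. v t / s) t) \<partial>M)"
    unfolding g_modular_def
  proof (rule nn_integral_mono)
    fix t
    have "\<bar>u t + v t\<bar> / (r + s) \<le> (\<bar>u t\<bar> + \<bar>v t\<bar>) / (r + s)"
      using r s by (intro divide_right_mono abs_triangle_ineq) simp
    also have "\<dots> = (1 - k) * \<bar>u t / r\<bar> + k * \<bar>v t / s\<bar>"
      using r s by (simp add: k(3) abs_divide) (simp add: k_def add_divide_distrib)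
    finally have "c t + \<bar>(u t + v t) / (r + s)\<bar> \<le> (1 - k) * (c t + \<bar>u t / r\<bar>) + k * (c t + \<bar>v t / s\<bar>)"
      using r s by (simp add: algebra_simps)
    then have "g t (c t + \<bar>(u t + v t) / (r + s)\<bar>) \<le> (1 - k) * g t (c t + \<bar>u t / r\<bar>) + k * g t (c t + \<bar>v t / s\<bar>)"
      using g_mono g_convexD[OF k(1,2)] order_trans by blast
    then have "?F (\<lambda>t. (u t + v t) / (r + s)) t \<le> (1 - k) * ?F (\<lambda>t. u t / r) t + k * ?F (\<lambda>t. v t / s) t"
      by (simp add: algebra_simps)
    then have "ennreal (?F (\<lambda>t. (u t + v t) / (r + s)) t)
       \<le> ennreal ((1 - k) * ?F (\<lambda>t. u t / r) t + k * ?F (\<lambda>t. v t / s) t)"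
      by (rule ennreal_leI)
    also have "\<dots> = ennreal (1 - k) * ennreal (?F (\<lambda>t. u t / r) t) + ennreal k * ennreal (?F (\<lambda>t. v t / s) t)"
      by (rule ennreal_mult_add; (rule nn)?) (use k in auto)
    finally show "ennreal (g t (c t + \<bar>(u t + v t) / (r + s)\<bar>) - g t (c t))
       \<le> ennreal (1 - k) * ennreal (?F (\<lambda>t. u t / r) t) + ennreal k * ennreal (?F (\<lambda>t. v t / s) t)" .
  qed
  also have "\<dots> = ennreal (1 - k) * g_modular c (\<lambda>t. u t / r) + ennreal k * g_modular c (\<lambda>t. v t / s)"
    unfolding g_modular_def by (subst nn_integral_add) (simp_all add: nn_integral_cmult)
  also have "\<dots> \<le> ennreal (1 - k) * 1 + ennreal k * 1"
    using r s by (intro add_mono mult_left_mono) auto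
  also have "\<dots> = 1" using k by (simp flip: ennreal_plus)
  finally have "luxemburg c (\<lambda>t. u t + v t) \<le> r + s" using r s by (intro luxemburg_le) auto
  then show "luxemburg c (\<lambda>t. u t + v t) \<le> luxemburg c u + luxemburg c v + e" by (simp add: r_def s_def)
qed

lemma luxemburg_zero: "luxemburg c (\<lambda>t. 0) = 0"
proof -
  have "{r::real. 0 < r \<and> g_modular c (\<lambda>t. 0 / r) \<le> 1} = {0<..}" by (auto simp: g_modular_zero)
  then show ?thesis by (simp add: luxemburg_def)
qed

lemma luxemburg_scale:
  assumes c: "g_integrable c" and w: "orlicz c w"
  shows "luxemburg c (\<lambda>t. a * w t) = \<bar>a\<bar> * luxemburg c w"
proof (cases "a = 0")
  case True then show ?thesis by (simp add: luxemburg_zero)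
next
  case False
  have le: "luxemburg c (\<lambda>t. b * v t) \<le> \<bar>b\<bar> * luxemburg c v" if v: "orlicz c v" and b: "b \<noteq> 0" for b v
  proof (rule luxemburg_leI)
    fix r assume "luxemburg c v < r"
    from luxemburg_less[OF g_integrable_measurable[OF c] v this] have r: "0 < r" "g_modular c (\<lambda>t. v t / r) \<le> 1" .
    have "g_modular c (\<lambda>t. b * v t / (\<bar>b\<bar> * r)) \<le> g_modular c (\<lambda>t. v t / r)"
      using b r by (intro g_modular_mono) (simp add: abs_mult)
    then show "luxemburg c (\<lambda>t. b * v t) \<le> \<bar>b\<bar> * r" using r b by (intro luxemburg_le) auto
  qed simp
  have "luxemburg c w \<le> \<bar>1 / a\<bar> * luxemburg c (\<lambda>t. a * w t)"
    using le[OF orlicz_scale[OF c w, of a], of "1 / a"] False by simp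
  then have "\<bar>a\<bar> * luxemburg c w \<le> luxemburg c (\<lambda>t. a * w t)" using False by (simp add: field_simps)
  with le[OF w False] show ?thesis by simp
qed

text \<open>Scaling by a small \<open>m\<close> shows that the modular of \<open>w\<close> itself is at most \<open>m\<close>, hence zero, and \<open>g t\<close> is
  strictly increasing.\<close>

lemma luxemburg_eq_zeroD:
  assumes c: "g_integrable c" and w: "orlicz c w" and 0: "luxemburg c w = 0"
  shows "AE t in M. w t = 0"
proof -
  have [measurable]: "c \<in> borel_measurable M" "w \<in> borel_measurable M"
    using c w by (simp_all add: orlicz_measurable g_integrable_measurable)
  have small: "g_modular c w \<le> ennreal r" if r: "0 < r" for r
  proof -
    define m where "m = min r 1"
    have m: "0 < m" "m \<le> 1" "m \<le> r" using r by (auto simp: m_def)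
    have "g_modular c (\<lambda>t. m * (w t / m)) \<le> ennreal m * g_modular c (\<lambda>t. w t / m)"
      using m by (intro g_modular_scale) auto
    also have "\<dots> \<le> ennreal m * 1"
      using luxemburg_less[OF _ w, of m] 0 m by (intro mult_left_mono) auto
    also have "\<dots> \<le> ennreal r" using m by (simp add: ennreal_leI)
    finally show ?thesis using m by simp
  qed
  have "g_modular c w \<le> 0"
    by (rule ennreal_le_epsilon) (unfold add_0, erule small)
  then have "AE t in M. ennreal (g t (c t + \<bar>w t\<bar>) - g t (c t)) = 0"
    unfolding g_modular_def by (subst (asm) le_zero_eq, subst (asm) nn_integral_0_iff_AE) auto
  then show ?thesis
  proof eventually_elim
    case (elim t)
    then have "g t (c t + \<bar>w t\<bar>) \<le> g t (c t)" by (simp add: ennreal_eq_0_iff)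
    then show ?case using g_strict_mono[of t] by (simp add: strict_mono_less_eq)
  qed
qed

lemma luxemburg_sum:
  assumes c: "g_integrable c" and w: "\<And>k. orlicz c (w k)" and "finite A"
  shows "orlicz c (\<lambda>t. \<Sum>k\<in>A. w k t) \<and> luxemburg c (\<lambda>t. \<Sum>k\<in>A. w k t) \<le> (\<Sum>k\<in>A. luxemburg c (w k))"
  using \<open>finite A\<close>
proof (induction A rule: finite_induct)
  case empty
  have "orlicz c (\<lambda>t. 0)" using orlicz_scale[OF c w, of 0] by simp
  then show ?case by (simp add: luxemburg_zero)
next
  case (insert k A)
  then show ?case
    using orlicz_add[OF c w[of k], of "\<lambda>t. \<Sum>k\<in>A. w k t"] luxemburg_add[OF c w[of k], of "\<lambda>t. \<Sum>k\<in>A. w k t"]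
    by simp
qed

text \<open>Riesz--Fischer. The partial sums of the increments \<open>\<bar>u (n + 1) - u n\<bar>\<close> have bounded norm, so by
  monotone convergence they have a supremum of finite modular; since \<open>g t\<close> grows at least linearly,
  the supremum is finite almost everywhere and \<open>u n\<close> converges almost everywhere. Fatou's lemma
  transfers the distance bounds from \<open>u m\<close> to the pointwise limit.\<close>

lemma orlicz_fast_Cauchy_converges:
  assumes c: "g_integrable c" and u: "\<And>n. orlicz c (u n)"
    and fast: "\<And>n. luxemburg c (\<lambda>t. u (Suc n) t - u n t) < (1/2) ^ n"
  obtains l where "orlicz c l" "(\<lambda>n. luxemburg c (\<lambda>t. u n t - l t)) \<longlonglongrightarrow> 0"
proof -
  have [measurable]: "c \<in> borel_measurable M" "\<And>n. u n \<in> borel_measurable M"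
    using g_integrable_measurable[OF c] orlicz_measurable[OF u] by simp_all
  define d where "d k t = \<bar>u (Suc k) t - u k t\<bar>" for k t
  have [measurable]: "d k \<in> borel_measurable M" for k unfolding d_def by measurable
  \<comment> \<open>The sum of the bounds \<open>(1/2) ^ k\<close> over all \<open>k \<ge> n\<close>.\<close>
  define \<rho> :: "nat \<Rightarrow> real" where "\<rho> n = 2 * (1/2) ^ n" for n
  have \<rho>: "0 < \<rho> n" for n by (simp add: \<rho>_def)
  have du: "orlicz c (\<lambda>t. u (Suc k) t - u k t)" for k by (intro orlicz_diff c u)
  have d: "orlicz c (d k)" for k
  proof -
    obtain r where "0 < r" "g_integrable (\<lambda>t. c t + r * \<bar>u (Suc k) t - u k t\<bar>)"
      using orliczD[OF c du[of k]] .
    then show ?thesis by (intro orliczI[OF c, of _ r]) (simp_all add: d_def)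
  qed
  have luxemburg_d: "luxemburg c (d k) < (1/2) ^ k" for k
    using luxemburg_abs_mono[OF _ du[of k], of "d k"] fast[of k] by (simp add: d_def)
  have S: "g_modular c (\<lambda>t. (\<Sum>k=n..<m. d k t) / \<rho> n) \<le> 1" for n m
  proof -
    have "luxemburg c (\<lambda>t. \<Sum>k=n..<m. d k t) \<le> (\<Sum>k=n..<m. luxemburg c (d k))"
      using luxemburg_sum[where w=d, OF c d, of "{n..<m}"] by simp
    also have "\<dots> \<le> (\<Sum>k=n..<m. (1/2) ^ k)" using luxemburg_d by (intro sum_mono) (simp add: less_imp_le)
    also have "\<dots> < \<rho> n"
    proof (cases "n \<le> m")
      case True
      then have "(\<Sum>k=n..<m. (1/2::real) ^ k) = 2 * (1/2)^n - 2 * (1/2)^m"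
        using sum_Suc_diff'[of n m "\<lambda>k. - 2 * (1/2::real) ^ k"] by simp
      then show ?thesis by (simp add: \<rho>_def)
    next
      case False then show ?thesis by (simp add: \<rho>)
    qed
    finally show ?thesis using luxemburg_less(2)[of c "\<lambda>t. \<Sum>k=n..<m. d k t"] luxemburg_sum[where w=d, OF c d, of "{n..<m}"] by simp
  qed
  have tele: "\<bar>u m t - u n t\<bar> \<le> (\<Sum>k=n..<m. d k t)" if "n \<le> m" for m n t
  proof -
    have "u m t - u n t = (\<Sum>k=n..<m. u (Suc k) t - u k t)"
      using sum_Suc_diff'[OF that, of "\<lambda>k. u k t"] by simp
    then show ?thesis unfolding d_def by (metis sum_abs)
  qed
  have close: "g_modular c (\<lambda>t. (u n t - u m t) / \<rho> n) \<le> 1" if "n \<le> m" for m n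
  proof -
    have "g_modular c (\<lambda>t. (u n t - u m t) / \<rho> n) \<le> g_modular c (\<lambda>t. (\<Sum>k=n..<m. d k t) / \<rho> n)"
    proof (rule g_modular_mono)
      fix t
      show "\<bar>(u n t - u m t) / \<rho> n\<bar> \<le> \<bar>(\<Sum>k=n..<m. d k t) / \<rho> n\<bar>"
        using tele[OF that, of t] \<rho>[of n]
        by (simp add: divide_right_mono abs_minus_commute)
    qed
    with S[of n m] show ?thesis by (rule order_trans[rotated])
  qed
  have conv: "AE t in M. convergent (\<lambda>n. u n t)"
  proof -
    let ?F = "\<lambda>m t. ennreal (g t (c t + \<bar>(\<Sum>k=0..<m. d k t) / \<rho> 0\<bar>) - g t (c t))"
    have inc: "incseq ?F"
    proof (intro incseq_SucI le_funI ennreal_leI diff_right_mono g_mono add_left_mono)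
      fix m t
      show "\<bar>(\<Sum>k=0..<m. d k t) / \<rho> 0\<bar> \<le> \<bar>(\<Sum>k=0..<Suc m. d k t) / \<rho> 0\<bar>"
        using \<rho>[of 0] by (simp add: divide_right_mono d_def sum_nonneg abs_of_nonneg)
    qed
    have "(\<integral>\<^sup>+t. (SUP m. ?F m t) \<partial>M) = (SUP m. g_modular c (\<lambda>t. (\<Sum>k=0..<m. d k t) / \<rho> 0))"
      unfolding g_modular_def by (rule nn_integral_monotone_convergence_SUP[OF inc]) measurable
    also have "\<dots> \<le> 1" using S[of 0] by (intro SUP_least) simp
    finally have "(\<integral>\<^sup>+t. (SUP m. ?F m t) \<partial>M) \<noteq> \<infinity>" by (auto simp: top_unique)
    then have "AE t in M. (SUP m. ?F m t) \<noteq> \<infinity>"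
      by (intro nn_integral_PInf_AE) measurable
    then show ?thesis
    proof eventually_elim
      case (elim t)
      then obtain B where B: "(SUP m. ?F m t) = ennreal B" "0 \<le> B"
        by (cases "SUP m. ?F m t") auto
      have "(\<Sum>k<m. norm (d k t)) \<le> B * \<rho> 0 / right_deriv c t" for m
      proof -
        have s: "0 \<le> (\<Sum>k=0..<m. d k t) / \<rho> 0" using \<rho>[of 0] by (simp add: d_def sum_nonneg)
        have "?F m t \<le> ennreal B" unfolding B(1)[symmetric] by (rule SUP_upper) simp
        then have "g t (c t + \<bar>(\<Sum>k=0..<m. d k t) / \<rho> 0\<bar>) - g t (c t) \<le> B"
          using B(2) by (simp add: ennreal_le_iff)
        then have "(\<Sum>k=0..<m. d k t) / \<rho> 0 * right_deriv c t \<le> B"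
          using right_deriv_le[OF s, of c t] unfolding abs_of_nonneg[OF s] by linarith
        then show ?thesis
          using right_deriv_pos[of c t] \<rho>[of 0] by (simp add: field_simps d_def atLeast0LessThan)
      qed
      then have "summable (\<lambda>k. norm (d k t))" by (intro summableI_nonneg_bounded) auto
      then have "summable (\<lambda>k. u (Suc k) t - u k t)"
        by (simp add: d_def summable_rabs_cancel)
      then have "convergent (\<lambda>n. u n t - u 0 t)"
        unfolding summable_iff_convergent sum_lessThan_telescope[where f="\<lambda>k. u k t"] .
      then have "convergent (\<lambda>n. (u n t - u 0 t) + u 0 t)" by (rule convergent_add[OF _ convergent_const])
      then show ?case by simp
    qed
  qed
  define l where "l t = lim (\<lambda>n. u n t)" for t
  have l [measurable]: "l \<in> borel_measurable M" unfolding l_def by measurable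
  have close_l: "g_modular c (\<lambda>t. (u n t - l t) / \<rho> n) \<le> 1" for n
  proof -
    let ?G = "\<lambda>m t. ennreal (g t (c t + \<bar>(u n t - u m t) / \<rho> n\<bar>) - g t (c t))"
    have "g_modular c (\<lambda>t. (u n t - l t) / \<rho> n) = (\<integral>\<^sup>+t. liminf (\<lambda>m. ?G m t) \<partial>M)"
      unfolding g_modular_def
    proof (rule nn_integral_cong_AE, use conv in eventually_elim)
      fix t assume "convergent (\<lambda>n. u n t)"
      then have "(\<lambda>m. u m t) \<longlonglongrightarrow> l t" by (simp add: convergent_LIMSEQ_iff l_def)
      then have "(\<lambda>m. c t + \<bar>(u n t - u m t) / \<rho> n\<bar>) \<longlonglongrightarrow> c t + \<bar>(u n t - l t) / \<rho> n\<bar>"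
        using \<rho>[of n] by (intro tendsto_intros) simp_all
      moreover have "isCont (g t) y" for y
        using g_continuous[of UNIV t] by (simp add: continuous_on_eq_continuous_at)
      ultimately have "(\<lambda>m. g t (c t + \<bar>(u n t - u m t) / \<rho> n\<bar>)) \<longlonglongrightarrow> g t (c t + \<bar>(u n t - l t) / \<rho> n\<bar>)"
        by (rule isCont_tendsto_compose[rotated])
      then have "(\<lambda>m. ?G m t) \<longlonglongrightarrow> ennreal (g t (c t + \<bar>(u n t - l t) / \<rho> n\<bar>) - g t (c t))"
        by (intro tendsto_intros)
      from lim_imp_Liminf[OF _ this]
      show "ennreal (g t (c t + \<bar>(u n t - l t) / \<rho> n\<bar>) - g t (c t)) = liminf (\<lambda>m. ?G m t)" by simp
    qed
    also have "\<dots> \<le> liminf (\<lambda>m. g_modular c (\<lambda>t. (u n t - u m t) / \<rho> n))"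
      unfolding g_modular_def by (rule nn_integral_liminf) measurable
    also have "\<dots> \<le> liminf (\<lambda>m. 1)"
      using close by (intro Liminf_mono eventually_sequentiallyI[of n]) auto
    also have "\<dots> = 1" by (simp add: Liminf_const)
    finally show ?thesis .
  qed
  have ul: "orlicz c (\<lambda>t. u n t - l t)" for n
  proof -
    have "g_modular c (\<lambda>t. 1 / \<rho> n * (u n t - l t)) < \<infinity>"
      using close_l[of n] by (simp add: le_less_trans[of _ 1])
    then show ?thesis using \<rho>[of n] unfolding orlicz_def by (intro conjI exI[of _ "1 / \<rho> n"]) auto
  qed
  show thesis
  proof (rule that)
    show "orlicz c l" using orlicz_diff[OF c u[of 0] ul[of 0]] by simp
    have upper: "luxemburg c (\<lambda>t. u n t - l t) \<le> \<rho> n" for n by (rule luxemburg_le[OF \<rho> close_l])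
    have "\<rho> \<longlonglongrightarrow> 2 * 0" unfolding \<rho>_def by (intro tendsto_intros LIMSEQ_power_zero) simp
    then have \<rho>0: "\<rho> \<longlonglongrightarrow> 0" by simp
    show "(\<lambda>n. luxemburg c (\<lambda>t. u n t - l t)) \<longlonglongrightarrow> 0"
      by (rule tendsto_sandwich[OF _ _ tendsto_const \<rho>0]) (simp_all add: upper luxemburg_nonneg ul)
  qed
qed

text \<open>The kernel of this functional in the Musielak--Orlicz space at \<open>c\<close> is the model space of the chart.\<close>

definition tangent :: "('a \<Rightarrow> real) \<Rightarrow> ('a \<Rightarrow> real) \<Rightarrow> real" where
  "tangent c w = (\<integral>t. w t * right_deriv c t \<partial>M)"

text \<open>The supporting line at \<open>c\<close> bounds \<open>\<bar>w / r\<bar> right_deriv c\<close> by the integrand of the modular of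
  \<open>w / r\<close>, which integrates to at most \<open>1\<close> for every \<open>r\<close> above the norm of \<open>w\<close>.\<close>

lemma tangent_bound:
  assumes c: "g_integrable c" and w: "orlicz c w"
  shows tangent_integrable: "integrable M (\<lambda>t. w t * right_deriv c t)"
    and tangent_le_luxemburg: "\<bar>tangent c w\<bar> \<le> luxemburg c w"
proof -
  have [measurable]: "c \<in> borel_measurable M" "w \<in> borel_measurable M"
    using c w by (simp_all add: orlicz_measurable g_integrable_measurable)
  have nn: "(\<integral>\<^sup>+t. ennreal (norm (w t * right_deriv c t)) \<partial>M) \<le> ennreal r" if "luxemburg c w < r" for r
  proof -
    from luxemburg_less[OF _ w that] have r: "0 < r" "g_modular c (\<lambda>t. w t / r) \<le> 1" by auto
    have "(\<integral>\<^sup>+t. ennreal (norm (w t * right_deriv c t)) \<partial>M)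
        \<le> (\<integral>\<^sup>+t. ennreal r * ennreal (g t (c t + \<bar>w t / r\<bar>) - g t (c t)) \<partial>M)"
    proof (rule nn_integral_mono)
      fix t
      have "norm (w t * right_deriv c t) = r * (\<bar>w t / r\<bar> * right_deriv c t)"
        using r right_deriv_pos[of c t] by (simp add: abs_mult)
      also have "\<dots> \<le> r * (g t (c t + \<bar>w t / r\<bar>) - g t (c t))"
        using r right_deriv_le[of "\<bar>w t / r\<bar>" c t] by (intro mult_left_mono) auto
      finally show "ennreal (norm (w t * right_deriv c t))
          \<le> ennreal r * ennreal (g t (c t + \<bar>w t / r\<bar>) - g t (c t))"
        using r by (simp add: ennreal_mult'[symmetric] ennreal_leI)
    qed
    also have "\<dots> = ennreal r * g_modular c (\<lambda>t. w t / r)"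
      unfolding g_modular_def by (rule nn_integral_cmult) measurable
    also have "\<dots> \<le> ennreal r * 1" using r by (intro mult_left_mono) auto
    finally show ?thesis by simp
  qed
  show I: "integrable M (\<lambda>t. w t * right_deriv c t)"
    unfolding integrable_iff_bounded
    using nn[of "luxemburg c w + 1"] by (auto simp: le_less_trans)
  have "\<bar>tangent c w\<bar> \<le> 1 * luxemburg c w"
  proof (rule luxemburg_leI)
    fix r assume r: "luxemburg c w < r"
    have "ennreal \<bar>tangent c w\<bar> \<le> ennreal r"
      using integral_norm_bound_ennreal[OF I] nn[OF r] unfolding tangent_def by simp
    then show "\<bar>tangent c w\<bar> \<le> 1 * r"
      using luxemburg_less(1)[OF _ w r] by (simp add: ennreal_le_iff)
  qed simp
  then show "\<bar>tangent c w\<bar> \<le> luxemburg c w" by simp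
qed

lemma tangent_add:
  assumes "g_integrable c" "orlicz c u" "orlicz c v"
  shows "tangent c (\<lambda>t. u t + v t) = tangent c u + tangent c v"
  unfolding tangent_def
  using assms by (simp add: distrib_right tangent_integrable)

lemma tangent_scale: "tangent c (\<lambda>t. a * w t) = a * tangent c w"
  unfolding tangent_def by (simp add: mult.assoc)

lemma tangent_diff:
  assumes "g_integrable c" "orlicz c u" "orlicz c v"
  shows "tangent c (\<lambda>t. u t - v t) = tangent c u - tangent c v"
  using tangent_add[OF assms(1,2) orlicz_scale[OF assms(1,3), of "-1"]] tangent_scale[of c "-1" v] by simp

lemma tangent_cong_AE:
  assumes "AE t in M. w t = v t" and [measurable]: "c \<in> borel_measurable M" "w \<in> borel_measurable M"
    "v \<in> borel_measurable M"
  shows "tangent c w = tangent c v"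
  unfolding tangent_def by (rule integral_cong_AE) (use assms in auto)

end

section \<open>Directions with an integrable arc\<close>

context deformed_exponential begin

text \<open>By convexity, integrability in a neighbourhood of \<open>[0, 1]\<close> amounts to integrability at one point on
  either side of it.\<close>

definition arc_integrable :: "('a \<Rightarrow> real) \<Rightarrow> ('a \<Rightarrow> real) \<Rightarrow> bool" where
  "arc_integrable c u \<longleftrightarrow> u \<in> borel_measurable M \<and>
     (\<exists>\<epsilon>>0. g_integrable (\<lambda>t. c t + (- \<epsilon>) * u t) \<and> g_integrable (\<lambda>t. c t + (1 + \<epsilon>) * u t))"

lemma arc_integrable_iff_open:
  assumes u: "u \<in> borel_measurable M"
  shows "arc_integrable c u \<longleftrightarrow> (\<exists>N::real set. open N \<and> {0..1} \<subseteq> N \<and> (\<forall>r\<in>N. g_integrable (\<lambda>t. c t + r * u t)))"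
proof
  assume "arc_integrable c u"
  then obtain e where e: "0 < e" "g_integrable (\<lambda>t. c t + (- e) * u t)" "g_integrable (\<lambda>t. c t + (1 + e) * u t)"
    unfolding arc_integrable_def by blast
  have "\<forall>r\<in>{-e<..<1+e}. g_integrable (\<lambda>t. c t + r * u t)"
    using g_integrable_between[OF e(2,3)] by simp
  then show "\<exists>N::real set. open N \<and> {0..1} \<subseteq> N \<and> (\<forall>r\<in>N. g_integrable (\<lambda>t. c t + r * u t))"
    using e(1) by (intro exI[of _ "{-e<..<1+e}"]) auto
next
  assume "\<exists>N::real set. open N \<and> {0..1} \<subseteq> N \<and> (\<forall>r\<in>N. g_integrable (\<lambda>t. c t + r * u t))"
  then obtain N :: "real set" where N: "open N" "{0..1} \<subseteq> N" "\<forall>r\<in>N. g_integrable (\<lambda>t. c t + r * u t)" by blast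
  then have "0 \<in> N" "1 \<in> N" by auto
  then obtain a b where a: "0 < a" "cball 0 a \<subseteq> N" and b: "0 < b" "cball 1 b \<subseteq> N"
    using N(1) by (meson open_contains_cball)
  define e where "e = min a b"
  have e: "0 < e" "e \<le> a" "e \<le> b" using a b by (auto simp: e_def)
  have "- e \<in> cball 0 a" "1 + e \<in> cball 1 b" using e by (auto simp: dist_real_def)
  then have "- e \<in> N" "1 + e \<in> N" using a b by auto
  then show "arc_integrable c u" using N(3) e(1) u unfolding arc_integrable_def by blast
qed

lemma arc_integrable_endpoint: "arc_integrable c u \<Longrightarrow> g_integrable (\<lambda>t. c t + u t)"
  unfolding arc_integrable_def using g_integrable_between[where r=1] by fastforce

lemma arc_integrable_orlicz:
  assumes c: "g_integrable c" and u: "arc_integrable c u"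
  shows "orlicz c u"
proof -
  from u obtain e where e: "0 < e" "g_integrable (\<lambda>t. c t + (- e) * u t)" "g_integrable (\<lambda>t. c t + (1 + e) * u t)"
    and [measurable]: "u \<in> borel_measurable M"
    unfolding arc_integrable_def by blast
  have "g_integrable (\<lambda>t. c t + e * u t)" using g_integrable_between[OF e(2,3), of e] e(1) by simp
  then have "g_integrable (\<lambda>t. c t + \<bar>e * u t\<bar>)"
    using e(2) g_integrable_measurable[OF c] by (intro g_integrable_abs) auto
  then show ?thesis using e(1) by (intro orliczI[OF c, of _ e]) (auto simp: abs_mult)
qed

lemma arc_integrable_zero: "g_integrable c \<Longrightarrow> arc_integrable c (\<lambda>t. 0)"
  unfolding arc_integrable_def by (auto intro!: exI[of _ 1])

lemma arc_integrable_cong_AE: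
  assumes K: "arc_integrable c u" and eq: "AE t in M. u t = v t"
    and [measurable]: "c \<in> borel_measurable M" "v \<in> borel_measurable M"
  shows "arc_integrable c v"
proof -
  have i: "g_integrable (\<lambda>t. c t + r * v t)" if "g_integrable (\<lambda>t. c t + r * u t)" for r
    by (rule g_integrable_cong_AE[OF that], use eq in eventually_elim) auto
  show ?thesis using K i unfolding arc_integrable_def by fastforce
qed

text \<open>A point \<open>c + r (u + w)\<close> with \<open>r\<close> slightly outside \<open>[0, 1]\<close> is a convex combination, with weights
  \<open>1 - a\<close> and \<open>a\<close>, of the point with parameter \<open>r / (1 - a)\<close> on the line in direction \<open>u\<close> and the point
  with parameter \<open>r / a\<close> on the line in direction \<open>w\<close>. The first is integrable if \<open>a\<close> is small, and
  then the second needs \<open>w\<close> to be integrable up to the large parameter \<open>R\<close>. Directions \<open>w\<close> of small norm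
  satisfy this, and so do directions that are integrable along their whole line.\<close>

lemma arc_integrable_add:
  assumes u: "arc_integrable c u"
  obtains R where "0 < R"
    and "\<And>w. g_integrable (\<lambda>t. c t + (- R) * w t) \<Longrightarrow> g_integrable (\<lambda>t. c t + R * w t) \<Longrightarrow>
           w \<in> borel_measurable M \<Longrightarrow> arc_integrable c (\<lambda>t. u t + w t)"
proof -
  from u obtain e where e: "0 < e" "g_integrable (\<lambda>t. c t + (- e) * u t)" "g_integrable (\<lambda>t. c t + (1 + e) * u t)"
    and [measurable]: "u \<in> borel_measurable M"
    unfolding arc_integrable_def by blast
  \<comment> \<open>Chosen such that \<open>(1 + e / 2) / (1 - a) = 1 + e\<close>.\<close>
  define a where "a = (e / 2) / (1 + e)"
  have a: "0 < a" "a < 1" "1 - a = (1 + e / 2) / (1 + e)" using e(1) by (auto simp: a_def field_simps)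
  define R where "R = (1 + e / 2) / a"
  have R: "0 < R" using e(1) a by (simp add: R_def)
  show thesis
  proof (rule that[OF R])
    fix w assume w: "g_integrable (\<lambda>t. c t + (- R) * w t)" "g_integrable (\<lambda>t. c t + R * w t)"
      and [measurable]: "w \<in> borel_measurable M"
    have *: "g_integrable (\<lambda>t. c t + r * (u t + w t))"
      if r: "- e \<le> r / (1 - a)" "r / (1 - a) \<le> 1 + e" "- R \<le> r / a" "r / a \<le> R" for r
    proof -
      have "g_integrable (\<lambda>t. (1 - a) * (c t + r / (1 - a) * u t) + a * (c t + r / a * w t))"
        using a by (intro g_integrable_convex g_integrable_between[OF e(2,3) r(1,2)] g_integrable_between[OF w r(3,4)]) auto
      moreover have "(1 - a) * (c t + r / (1 - a) * u t) + a * (c t + r / a * w t) = c t + r * (u t + w t)" for t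
        using a(1,2) by (simp add: distrib_left) (simp add: algebra_simps)
      ultimately show ?thesis by simp
    qed
    have up: "g_integrable (\<lambda>t. c t + (1 + e / 2) * (u t + w t))"
    proof (rule *)
      have "(1 + e / 2) / (1 - a) = 1 + e" unfolding a(3) using e(1) by simp
      then show "- e \<le> (1 + e / 2) / (1 - a)" "(1 + e / 2) / (1 - a) \<le> 1 + e" using e(1) by auto
      show "- R \<le> (1 + e / 2) / a" "(1 + e / 2) / a \<le> R" using R by (auto simp: R_def)
    qed
    have down: "g_integrable (\<lambda>t. c t + (- (e / 2)) * (u t + w t))"
    proof (rule *)
      have "- (e / 2) / (1 - a) = - (e * ((1 + e) / (2 + e)))" unfolding a(3) using e(1) by (simp add: field_simps)
      moreover have "0 \<le> (1 + e) / (2 + e)" "(1 + e) / (2 + e) \<le> 1" using e(1) by auto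
      then have "0 \<le> e * ((1 + e) / (2 + e))" "e * ((1 + e) / (2 + e)) \<le> e * 1"
        using e(1) by (auto intro!: mult_nonneg_nonneg mult_left_mono simp del: times_divide_eq_right)
      ultimately show "- e \<le> - (e / 2) / (1 - a)" "- (e / 2) / (1 - a) \<le> 1 + e" using e(1) by linarith+
      have "(e / 2) / a \<le> R" unfolding R_def using a e(1) by (intro divide_right_mono) auto
      then show "- R \<le> - (e / 2) / a" by simp
      show "- (e / 2) / a \<le> R" using R e(1) a(1) by (smt (verit) divide_nonneg_pos divide_minus_left)
    qed
    show "arc_integrable c (\<lambda>t. u t + w t)"
      unfolding arc_integrable_def using up down e(1) by (intro conjI exI[of _ "e / 2"]) auto
  qed
qed

lemma arc_integrable_add_ray:
  assumes u: "arc_integrable c u" and w: "\<And>r. g_integrable (\<lambda>t. c t + r * w t)" "w \<in> borel_measurable M"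
  shows "arc_integrable c (\<lambda>t. u t + s * w t)"
proof -
  obtain R where R: "\<And>w. g_integrable (\<lambda>t. c t + (- R) * w t) \<Longrightarrow> g_integrable (\<lambda>t. c t + R * w t) \<Longrightarrow>
           w \<in> borel_measurable M \<Longrightarrow> arc_integrable c (\<lambda>t. u t + w t)"
    using arc_integrable_add[OF u] by metis
  show ?thesis
    using w(1)[of "- R * s"] w(1)[of "R * s"] w(2) by (intro R) (simp_all add: mult.assoc)
qed

lemma arc_integrable_open:
  assumes c: "g_integrable c" and u: "arc_integrable c u"
  obtains \<delta> where "0 < \<delta>" "\<And>w. orlicz c w \<Longrightarrow> luxemburg c w < \<delta> \<Longrightarrow> arc_integrable c (\<lambda>t. u t + w t)"
proof -
  obtain R where R: "0 < R" "\<And>w. g_integrable (\<lambda>t. c t + (- R) * w t) \<Longrightarrow> g_integrable (\<lambda>t. c t + R * w t) \<Longrightarrow>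
           w \<in> borel_measurable M \<Longrightarrow> arc_integrable c (\<lambda>t. u t + w t)"
    using arc_integrable_add[OF u] by metis
  note [measurable] = g_integrable_measurable[OF c]
  show thesis
  proof (rule that)
    show "0 < 1 / R" using R(1) by simp
    fix w assume w: "orlicz c w" "luxemburg c w < 1 / R"
    have [measurable]: "w \<in> borel_measurable M" using orlicz_measurable[OF w(1)] .
    have "g_modular c (\<lambda>t. R * w t) \<le> 1"
      using luxemburg_less(2)[OF _ w] by (simp add: mult.commute)
    then have "g_modular c (\<lambda>t. R * w t) < \<infinity>" by (rule le_less_trans) simp
    then have i: "g_integrable (\<lambda>t. c t + \<bar>R * w t\<bar>)"
      using g_modular_finite_iff[OF c, of "\<lambda>t. R * w t"] by simp
    have "(- R) * w t \<le> \<bar>R * w t\<bar>" "R * w t \<le> \<bar>R * w t\<bar>" for t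
      using abs_ge_minus_self[of "R * w t"] by simp_all
    then show "arc_integrable c (\<lambda>t. u t + w t)"
      by (intro R(2) g_integrable_mono[OF i]) auto
  qed
qed

text \<open>The segment from \<open>c\<close> to \<open>d\<close>, prolonged beyond both ends, is the segment from \<open>d\<close> to \<open>c\<close> run backwards.\<close>

lemma arc_integrable_sym:
  assumes "arc_integrable c (\<lambda>t. d t - c t)" and [measurable]: "c \<in> borel_measurable M" "d \<in> borel_measurable M"
  shows "arc_integrable d (\<lambda>t. c t - d t)"
proof -
  from assms(1) obtain e where e: "0 < e" "g_integrable (\<lambda>t. c t + (- e) * (d t - c t))"
     "g_integrable (\<lambda>t. c t + (1 + e) * (d t - c t))"
    unfolding arc_integrable_def by blast
  have "(\<lambda>t. c t + (- e) * (d t - c t)) = (\<lambda>t. d t + (1 + e) * (c t - d t))"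
    "(\<lambda>t. c t + (1 + e) * (d t - c t)) = (\<lambda>t. d t + (- e) * (c t - d t))"
    by (auto simp: algebra_simps)
  then show ?thesis unfolding arc_integrable_def using e by auto
qed

text \<open>Let \<open>p = c + (1 + e) (d - c)\<close> be an integrable point beyond \<open>d\<close>. With \<open>a = e / (1 + e)\<close> the point
  \<open>d + a w\<close> is the convex combination \<open>(1 - a) p + a (c + w)\<close>. So the modular at \<open>d\<close> of \<open>a w\<close> is bounded by
  a constant plus \<open>a\<close> times the modular at \<open>c\<close> of \<open>w\<close>.\<close>

lemma base_change:
  assumes c: "g_integrable c" and d: "g_integrable d" and K: "arc_integrable c (\<lambda>t. d t - c t)"
  obtains C where "0 < C" "\<And>w. orlicz c w \<Longrightarrow> orlicz d w" "\<And>w. orlicz c w \<Longrightarrow> luxemburg d w \<le> C * luxemburg c w"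
proof -
  from K obtain e where e: "0 < e" "g_integrable (\<lambda>t. c t + (1 + e) * (d t - c t))" (is "g_integrable ?e")
    unfolding arc_integrable_def by blast
  have cm [measurable]: "c \<in> borel_measurable M" "d \<in> borel_measurable M" "?e \<in> borel_measurable M"
    using g_integrable_measurable[OF c] g_integrable_measurable[OF d] g_integrable_measurable[OF e(2)] by simp_all
  define a where "a = e / (1 + e)"
  have a: "0 < a" "a < 1" "(1 - a) * (1 + e) = 1" using e(1) by (auto simp: a_def field_simps)
  let ?k = "\<lambda>t. (1 - a) * g t (?e t) + a * g t (c t)"
  have knn: "0 \<le> ?k t" for t
    using a g_pos[of t "?e t"] g_pos[of t "c t"] by (intro add_nonneg_nonneg mult_nonneg_nonneg) auto
  have "integrable M ?k" using c e(2) by (simp add: g_integrable_def)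
  then have "(\<integral>\<^sup>+t. ennreal (?k t) \<partial>M) < \<infinity>"
    using knn unfolding integrable_iff_bounded by simp
  then obtain K where K0: "0 \<le> K" "(\<integral>\<^sup>+t. ennreal (?k t) \<partial>M) = ennreal K"
    by (cases "\<integral>\<^sup>+t. ennreal (?k t) \<partial>M") auto
  \<comment> \<open>The modular at \<open>d\<close> of \<open>a w\<close> is at most \<open>K + 1\<close> when that of \<open>w\<close> at \<open>c\<close> is at most \<open>1\<close>.\<close>
  define C where "C = max 1 (K + 1) / a"
  have C: "0 < C" using a by (simp add: C_def)
  have unit: "g_modular d (\<lambda>t. w t / C) \<le> 1" if w [measurable]: "w \<in> borel_measurable M" and w1: "g_modular c w \<le> 1" for w
  proof -
    have "g_modular d (\<lambda>t. a * w t) \<le> (\<integral>\<^sup>+t. ennreal (?k t) + ennreal a * ennreal (g t (c t + \<bar>w t\<bar>) - g t (c t)) \<partial>M)"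
      unfolding g_modular_def
    proof (rule nn_integral_mono)
      fix t
      have "(1 - a) * ?e t = (1 - a) * c t + ((1 - a) * (1 + e)) * (d t - c t)" by (simp add: algebra_simps)
      then have "(1 - a) * ?e t + a * (c t + \<bar>w t\<bar>) = d t + \<bar>a * w t\<bar>"
        using a(1) unfolding a(3) by (simp add: algebra_simps abs_mult)
      then have "g t (d t + \<bar>a * w t\<bar>) \<le> (1 - a) * g t (?e t) + a * g t (c t + \<bar>w t\<bar>)"
        using g_convexD[of a t "?e t" "c t + \<bar>w t\<bar>"] a by simp
      then have "g t (d t + \<bar>a * w t\<bar>) - g t (d t) \<le> ?k t + a * (g t (c t + \<bar>w t\<bar>) - g t (c t))"
        using g_pos[of t "d t"] by (simp add: algebra_simps)
      then have "ennreal (g t (d t + \<bar>a * w t\<bar>) - g t (d t)) \<le> ennreal (?k t + a * (g t (c t + \<bar>w t\<bar>) - g t (c t)))"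
        by (rule ennreal_leI)
      also have "\<dots> = ennreal (?k t) + ennreal (a * (g t (c t + \<bar>w t\<bar>) - g t (c t)))"
        using a g_pos[of t "?e t"] g_pos[of t "c t"] g_mono[of "c t" "c t + \<bar>w t\<bar>" t]
        by (intro ennreal_plus add_nonneg_nonneg mult_nonneg_nonneg) auto
      finally show "ennreal (g t (d t + \<bar>a * w t\<bar>) - g t (d t))
          \<le> ennreal (?k t) + ennreal a * ennreal (g t (c t + \<bar>w t\<bar>) - g t (c t))"
        using a g_mono[of "c t" "c t + \<bar>w t\<bar>" t] by (simp add: ennreal_mult)
    qed
    also have "\<dots> = ennreal K + ennreal a * g_modular c w"
      unfolding g_modular_def by (subst nn_integral_add) (simp_all add: K0 nn_integral_cmult)
    also have "\<dots> \<le> ennreal K + 1 * 1"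
      using a w1 by (intro add_mono mult_mono) auto
    also have "\<dots> = ennreal (K + 1)" using K0 by simp
    finally have "g_modular d (\<lambda>t. (a * w t) / max 1 (K + 1)) \<le> 1" by (intro g_modular_normalize) auto
    moreover have "(\<lambda>t. (a * w t) / max 1 (K + 1)) = (\<lambda>t. w t / C)"
      using a(1) by (simp add: C_def field_simps)
    ultimately show ?thesis by simp
  qed
  have step: "g_modular d (\<lambda>t. w t / (C * r)) \<le> 1" if w: "orlicz c w" and r: "0 < r" "g_modular c (\<lambda>t. w t / r) \<le> 1" for w r
  proof -
    have [measurable]: "w \<in> borel_measurable M" using orlicz_measurable[OF w] .
    have "g_modular d (\<lambda>t. (w t / r) / C) \<le> 1" by (rule unit) (use r in auto)
    then show ?thesis by (simp add: mult.commute)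
  qed
  show thesis
  proof (rule that[OF C])
    fix w assume w: "orlicz c w"
    obtain r where r: "0 < r" "g_modular c (\<lambda>t. w t / r) \<le> 1" using luxemburg_attainable[OF cm(1) w] .
    have "g_modular d (\<lambda>t. 1 / (C * r) * w t) \<le> 1" using step[OF w r] by simp
    then have "g_modular d (\<lambda>t. 1 / (C * r) * w t) < \<infinity>" by (rule le_less_trans) simp
    then show "orlicz d w"
      unfolding orlicz_def using C r(1) orlicz_measurable[OF w] by (intro conjI exI[of _ "1 / (C * r)"]) auto
    show "luxemburg d w \<le> C * luxemburg c w"
    proof (rule luxemburg_leI)
      fix r assume "luxemburg c w < r"
      from luxemburg_less[OF cm(1) w this] have r: "0 < r" "g_modular c (\<lambda>t. w t / r) \<le> 1" .
      show "luxemburg d w \<le> C * r" by (rule luxemburg_le[OF _ step[OF w r]]) (use C r in simp)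
    qed (use C in simp)
  qed
qed

text \<open>Two base points are compared through the common point \<open>c + f\<close>, to which both are joined by an arc.\<close>

lemma overlap_base_change:
  assumes c: "g_integrable c" and d: "g_integrable d" and f: "arc_integrable c f" and h: "arc_integrable d (\<lambda>t. c t + f t - d t)"
  obtains C where "0 < C" "\<And>w. orlicz c w \<Longrightarrow> orlicz d w" "\<And>w. orlicz c w \<Longrightarrow> luxemburg d w \<le> C * luxemburg c w"
proof -
  let ?e = "\<lambda>t. c t + f t"
  have e: "g_integrable ?e" by (rule arc_integrable_endpoint[OF f])
  have "arc_integrable c (\<lambda>t. ?e t - c t)" using f by simp
  from base_change[OF c e this] obtain C where
    C: "0 < C" "\<And>w. orlicz c w \<Longrightarrow> orlicz ?e w" "\<And>w. orlicz c w \<Longrightarrow> luxemburg ?e w \<le> C * luxemburg c w" by blast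
  have "arc_integrable ?e (\<lambda>t. d t - ?e t)" by (rule arc_integrable_sym[OF h g_integrable_measurable[OF d] g_integrable_measurable[OF e]])
  from base_change[OF e d this] obtain D where
    D: "0 < D" "\<And>w. orlicz ?e w \<Longrightarrow> orlicz d w" "\<And>w. orlicz ?e w \<Longrightarrow> luxemburg d w \<le> D * luxemburg ?e w" by blast
  show thesis
  proof (rule that[of "D * C"])
    show "0 < D * C" using C D by simp
    fix w assume w: "orlicz c w"
    show "orlicz d w" using C(2) D(2) w by blast
    have "luxemburg d w \<le> D * luxemburg ?e w" using D(3) C(2) w by blast
    also have "\<dots> \<le> D * (C * luxemburg c w)" using C(3)[OF w] D(1) by (intro mult_left_mono) auto
    finally show "luxemburg d w \<le> D * C * luxemburg c w" by (simp add: mult.assoc)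
  qed
qed

end

section \<open>Normalization along \<open>u0\<close>\<close>

context deformed_exponential begin

text \<open>Convexity makes \<open>g t\<close> grow at least linearly, so the intermediate value theorem applies.\<close>

lemma g_surj:
  assumes "0 < p"
  shows "\<exists>y. g t y = p"
proof -
  obtain x where x: "g t x < p"
    using order_tendstoD(2)[OF g_at_bot assms, of t] by (auto simp: eventually_at_bot_linorder)
  define m where "m = g t (x + 1) - g t x"
  have m: "0 < m" using g_strict_mono[of t] by (simp add: m_def strict_mono_less)
  define n where "n = max 1 ((p - g t x) / m)"
  have n: "1 \<le> n" "p - g t x \<le> n * m" using m by (auto simp: n_def field_simps max_def)
  have "m \<le> 1 / n * (g t (x + n) - g t x)"
    using g_increment_scale[of "1 / n" t x n] n(1) by (simp add: m_def)
  then have "n * m \<le> g t (x + n) - g t x" using n(1) by (simp add: field_simps)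
  then have "p \<le> g t (x + n)" using n(2) by simp
  then show ?thesis
    using IVT'[of "g t" x p "x + n"] x n(1) g_continuous by auto
qed

text \<open>The inverse \<open>c\<close> of \<open>g\<close> at \<open>q\<close> satisfies \<open>c t \<le> y\<close> if and only if \<open>q t \<le> g t y\<close>, so its
  measurability needs only that of \<open>g\<close> at fixed arguments.\<close>

lemma measurable_inverse:
  assumes p [measurable]: "p \<in> borel_measurable M" and pos: "AE t in M. 0 < p t"
  obtains c where "c \<in> borel_measurable M" "AE t in M. g t (c t) = p t"
proof -
  \<comment> \<open>The default value \<open>1\<close> keeps \<open>q\<close> in the range of \<open>g t\<close> on the null set where \<open>p\<close> is not positive.\<close>
  define q where "q t = (if 0 < p t then p t else 1)" for t
  have q [measurable]: "q \<in> borel_measurable M" unfolding q_def by measurable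
  have "\<exists>y. g t y = q t" for t by (rule g_surj) (simp add: q_def)
  then obtain c where c: "\<And>t. g t (c t) = q t" by metis
  have "c \<in> borel_measurable M"
  proof (rule borel_measurableI_le)
    fix y
    have "c t \<le> y \<longleftrightarrow> q t \<le> g t y" for t
      using g_strict_mono[of t] by (simp add: c[symmetric] strict_mono_less_eq)
    then have "{t \<in> space M. c t \<le> y} = {t \<in> space M. q t \<le> g t y}" by simp
    also have "\<dots> \<in> sets M" using g_measurable[of y] q by (rule borel_measurable_le[rotated])
    finally show "{t \<in> space M. c t \<le> y} \<in> sets M" .
  qed
  moreover have "AE t in M. g t (c t) = p t"
    using pos by eventually_elim (simp add: c q_def)
  ultimately show thesis by (rule that)
qed

definition normalized :: "('a \<Rightarrow> real) \<Rightarrow> bool" where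
  "normalized c \<longleftrightarrow> g_integrable c \<and> (\<integral>t. g t (c t) \<partial>M) = 1"

lemma normalized_integrable: "normalized c \<Longrightarrow> g_integrable c"
  by (simp add: normalized_def)

lemma normalized_nontrivial: "normalized c \<Longrightarrow> \<not> (AE t in M. False)"
proof
  assume c: "normalized c" and "AE t in M. False"
  then have "(\<integral>t. g t (c t) \<partial>M) = 0"
    by (intro integral_eq_zero_AE) (auto elim: eventually_mono)
  with c show False by (simp add: normalized_def)
qed

end

text \<open>The integrability assumption on \<open>u0\<close> is what allows densities to be normalized by moving them along
  \<open>u0\<close>.\<close>

locale normalized_exponential = deformed_exponential +
  fixes u0 :: "'a \<Rightarrow> real"
  assumes u0_measurable [measurable]: "u0 \<in> borel_measurable M"
    and u0_pos: "\<And>t. t \<in> space M \<Longrightarrow> 0 < u0 t"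
    and u0_shift_integrable: "\<And>c r. \<lbrakk>normalized c; 0 < r\<rbrakk> \<Longrightarrow> g_integrable (\<lambda>t. c t + r * u0 t)"
begin

lemma u0_ray: "normalized c \<Longrightarrow> g_integrable (\<lambda>t. c t + r * u0 t)"
proof (cases "0 < r")
  case False
  assume c: "normalized c"
  note [measurable] = g_integrable_measurable[OF normalized_integrable[OF c]]
  show ?thesis
  proof (rule g_integrable_mono[OF normalized_integrable[OF c]])
    fix t assume "t \<in> space M"
    then show "c t + r * u0 t \<le> c t" using False u0_pos[of t] by (simp add: mult_nonpos_nonneg)
  qed measurable
qed (rule u0_shift_integrable)

lemma u0_orlicz: "normalized c \<Longrightarrow> orlicz c u0"
proof -
  assume c: "normalized c"
  note [measurable] = g_integrable_measurable[OF normalized_integrable[OF c]]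
  have "g_integrable (\<lambda>t. c t + \<bar>u0 t\<bar>)"
    using u0_ray[OF c, of 1] u0_ray[OF c, of "-1"] by (intro g_integrable_abs) auto
  then show ?thesis by (intro orliczI[OF normalized_integrable[OF c], of _ 1]) auto
qed

text \<open>The line spanned by \<open>u0\<close> is a complement of the kernel of \<open>tangent c\<close>.\<close>

lemma tangent_u0_pos:
  assumes c: "normalized c"
  shows "0 < tangent c u0"
proof -
  have "(\<integral>t. 0 \<partial>M) < tangent c u0"
    unfolding tangent_def
  proof (rule integral_strict_mono)
    show "integrable M (\<lambda>t. u0 t * right_deriv c t)"
      using tangent_integrable[OF normalized_integrable[OF c] u0_orlicz[OF c]] .
    show "0 < u0 t * right_deriv c t" if "t \<in> space M" for t using u0_pos[OF that] right_deriv_pos by simp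
  qed (simp_all add: normalized_nontrivial[OF c])
  then show ?thesis by simp
qed

lemma arc_integrable_add_u0: "normalized c \<Longrightarrow> arc_integrable c u \<Longrightarrow> arc_integrable c (\<lambda>t. u t + s * u0 t)"
  using arc_integrable_add_ray[OF _ u0_ray u0_measurable] by blast

text \<open>The mean \<open>h s\<close> of \<open>g(c + u - s u0)\<close> is finite for every real \<open>s\<close>, since arc-integrable directions may be
  moved along \<open>u0\<close>. It inherits convexity from \<open>g\<close>, whence continuity, and it is strictly decreasing
  because \<open>u0\<close> is positive. Dominated convergence gives the limit \<open>0\<close> at \<open>+\<infinity>\<close>, and a convex
  strictly decreasing function is unbounded at \<open>-\<infinity>\<close>.\<close>

lemma ex1_normalizing:
  assumes c: "normalized c" and u: "arc_integrable c u"
  shows "\<exists>!s. normalized (\<lambda>t. c t + u t - s * u0 t)"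
proof -
  have i: "g_integrable (\<lambda>t. c t + u t - s * u0 t)" for s
    using arc_integrable_endpoint[OF arc_integrable_add_u0[OF c u, of "- s"]] by (simp add: add_diff_eq)
  define h where "h s = (\<integral>t. g t (c t + u t - s * u0 t) \<partial>M)" for s
  have ii: "integrable M (\<lambda>t. g t (c t + u t - s * u0 t))" for s using i by (simp add: g_integrable_def)
  have normalized_iff: "normalized (\<lambda>t. c t + u t - s * u0 t) \<longleftrightarrow> h s = 1" for s
    using i by (simp add: normalized_def h_def)
  have dec: "h b < h a" if "a < b" for a b
    unfolding h_def
  proof (rule integral_strict_mono[OF ii ii _ normalized_nontrivial[OF c]])
    fix t assume "t \<in> space M"
    then have "c t + u t - b * u0 t < c t + u t - a * u0 t" using that u0_pos by simp
    then show "g t (c t + u t - b * u0 t) < g t (c t + u t - a * u0 t)"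
      using g_strict_mono[of t] by (simp add: strict_mono_less)
  qed
  have conv: "h ((1 - k) * a + k * b) \<le> (1 - k) * h a + k * h b" if k: "0 \<le> k" "k \<le> 1" for k a b
  proof -
    have "h ((1 - k) * a + k * b)
        \<le> (\<integral>t. (1 - k) * g t (c t + u t - a * u0 t) + k * g t (c t + u t - b * u0 t) \<partial>M)"
      unfolding h_def
    proof (rule integral_mono)
      fix t
      have "c t + u t - ((1 - k) * a + k * b) * u0 t
          = (1 - k) * (c t + u t - a * u0 t) + k * (c t + u t - b * u0 t)" by (simp add: algebra_simps)
      then show "g t (c t + u t - ((1 - k) * a + k * b) * u0 t)
          \<le> (1 - k) * g t (c t + u t - a * u0 t) + k * g t (c t + u t - b * u0 t)"
        using g_convexD[OF k] by simp
    qed (use ii in auto)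
    also have "\<dots> = (1 - k) * h a + k * h b" unfolding h_def using ii by simp
    finally show ?thesis .
  qed
  then have "convex_on UNIV h"
    by (intro convex_onI) auto
  then have cont: "continuous_on A h" for A
    using convex_on_continuous[OF open_UNIV] continuous_on_subset by blast
  have "(\<lambda>n. h (real n)) \<longlonglongrightarrow> (\<integral>t. 0 \<partial>M)"
    unfolding h_def
  proof (rule integral_dominated_convergence)
    show "integrable M (\<lambda>t. g t (c t + u t))" using ii[of 0] by simp
    show "AE t in M. (\<lambda>n. g t (c t + u t - real n * u0 t)) \<longlonglongrightarrow> 0"
    proof (rule AE_I2)
      fix t assume "t \<in> space M"
      then have "0 < u0 t" by (rule u0_pos)
      then have "filterlim (\<lambda>n. c t + u t - real n * u0 t) at_bot sequentially" by real_asymp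
      then show "(\<lambda>n. g t (c t + u t - real n * u0 t)) \<longlonglongrightarrow> 0"
        using filterlim_compose[OF g_at_bot] by blast
    qed
    show "AE t in M. norm (g t (c t + u t - real n * u0 t)) \<le> g t (c t + u t)" for n
    proof (rule AE_I2)
      fix t assume "t \<in> space M"
      then have "g t (c t + u t - real n * u0 t) \<le> g t (c t + u t)"
        using u0_pos[of t] by (intro g_mono) simp
      then show "norm (g t (c t + u t - real n * u0 t)) \<le> g t (c t + u t)"
        using g_pos[of t "c t + u t - real n * u0 t"] by simp
    qed
  qed (use ii[of 0] ii in auto)
  then have "(\<lambda>n. h (real n)) \<longlonglongrightarrow> 0" by simp
  from order_tendstoD(2)[OF this, of 1] obtain n where n: "h (real n) < 1"
    by (auto simp: eventually_sequentially)
  have low: "h 0 + y * (h 0 - h 1) \<le> h (- y)" if y: "0 \<le> y" for y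
  proof -
    \<comment> \<open>The weight for which \<open>0\<close> is a convex combination of \<open>- y\<close> and \<open>1\<close>.\<close>
    define k where "k = y / (y + 1)"
    have k: "0 \<le> k" "k \<le> 1" "(1 - k) * (- y) + k * 1 = 0" "k * (y + 1) = y" "(1 - k) * (y + 1) = 1"
      using y by (auto simp: k_def field_simps)
    have "h 0 \<le> (1 - k) * h (- y) + k * h 1" using conv[OF k(1,2), of "- y" 1] k(3) by simp
    then have "(y + 1) * h 0 \<le> (y + 1) * ((1 - k) * h (- y) + k * h 1)"
      using y by (intro mult_left_mono) auto
    also have "\<dots> = ((1 - k) * (y + 1)) * h (- y) + (k * (y + 1)) * h 1" by (simp add: algebra_simps)
    also have "\<dots> = h (- y) + y * h 1" using k by simp
    finally show ?thesis by (simp add: algebra_simps)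
  qed
  have d: "0 < h 0 - h 1" using dec[of 0 1] by simp
  define y where "y = max 0 ((1 - h 0) / (h 0 - h 1))"
  have "1 - h 0 \<le> y * (h 0 - h 1)" using d by (simp add: y_def max_def field_simps)
  then have y: "0 \<le> y" "1 \<le> h (- y)" using low[of y] by (auto simp: y_def)
  have "\<exists>s\<ge>- y. s \<le> real n \<and> h s = 1"
    by (rule IVT2') (use y n cont in auto)
  then obtain s where s: "h s = 1" by blast
  have "s' = s" if "h s' = 1" for s' using dec[of s s'] dec[of s' s] s that by linarith
  with s show ?thesis unfolding normalized_iff by blast
qed

end

context normalized_exponential begin

text \<open>The projection along \<open>u0\<close> onto the kernel of \<open>tangent d\<close>.\<close>

definition kernel_proj :: "('a \<Rightarrow> real) \<Rightarrow> ('a \<Rightarrow> real) \<Rightarrow> 'a \<Rightarrow> real" where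
  "kernel_proj d w t = w t - tangent d w / tangent d u0 * u0 t"

lemma kernel_proj_measurable: "w \<in> borel_measurable M \<Longrightarrow> kernel_proj d w \<in> borel_measurable M"
  unfolding kernel_proj_def
  by (intro borel_measurable_diff borel_measurable_times borel_measurable_const u0_measurable)

lemma kernel_proj_cong_AE:
  assumes "AE t in M. v t = w t" "d \<in> borel_measurable M" "v \<in> borel_measurable M" "w \<in> borel_measurable M"
  shows "AE t in M. kernel_proj d v t = kernel_proj d w t"
  using assms(1) by eventually_elim (simp add: kernel_proj_def tangent_cong_AE[OF assms])

lemma kernel_proj_orlicz: "normalized d \<Longrightarrow> orlicz d w \<Longrightarrow> orlicz d (kernel_proj d w)"
  unfolding kernel_proj_def by (intro orlicz_diff orlicz_scale normalized_integrable u0_orlicz)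

lemma tangent_kernel_proj:
  assumes d: "normalized d" and w: "orlicz d w"
  shows "tangent d (kernel_proj d w) = 0"
proof -
  define s where "s = tangent d w / tangent d u0"
  have "tangent d (\<lambda>t. w t - s * u0 t) = tangent d w - s * tangent d u0"
    using tangent_diff[OF normalized_integrable[OF d] w orlicz_scale[OF normalized_integrable[OF d] u0_orlicz[OF d]], of s]
    by (simp only: tangent_scale)
  then show ?thesis using tangent_u0_pos[OF d] by (simp add: kernel_proj_def[abs_def] s_def)
qed

lemma kernel_proj_add:
  assumes "normalized d" "orlicz d v" "orlicz d w"
  shows "kernel_proj d (\<lambda>t. v t + w t) = (\<lambda>t. kernel_proj d v t + kernel_proj d w t)"
  using tangent_add[OF normalized_integrable assms(2,3)] assms(1)
  by (simp add: kernel_proj_def fun_eq_iff add_divide_distrib distrib_right)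

lemma kernel_proj_scale: "kernel_proj d (\<lambda>t. a * w t) = (\<lambda>t. a * kernel_proj d w t)"
  by (simp add: kernel_proj_def tangent_scale fun_eq_iff right_diff_distrib mult.assoc)

lemma luxemburg_kernel_proj:
  assumes d: "normalized d" and w: "orlicz d w"
  shows "luxemburg d (kernel_proj d w) \<le> (1 + luxemburg d u0 / tangent d u0) * luxemburg d w"
proof -
  note di = normalized_integrable[OF d] and u = u0_orlicz[OF d]
  define s where "s = - (tangent d w / tangent d u0)"
  have "kernel_proj d w = (\<lambda>t. w t + s * u0 t)" by (simp add: kernel_proj_def s_def fun_eq_iff)
  then have "luxemburg d (kernel_proj d w) \<le> luxemburg d w + luxemburg d (\<lambda>t. s * u0 t)"
    using luxemburg_add[OF di w orlicz_scale[OF di u, of s]] by simp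
  also have "luxemburg d (\<lambda>t. s * u0 t) = \<bar>tangent d w\<bar> * (luxemburg d u0 / tangent d u0)"
    unfolding luxemburg_scale[OF di u] s_def using tangent_u0_pos[OF d] by (simp add: abs_divide)
  also have "\<dots> \<le> luxemburg d w * (luxemburg d u0 / tangent d u0)"
    using tangent_u0_pos[OF d] luxemburg_nonneg[OF g_integrable_measurable[OF di] u] tangent_le_luxemburg[OF di w]
    by (intro mult_right_mono) auto
  finally show ?thesis by (simp add: algebra_simps)
qed

lemma arc_integrable_kernel_proj: "normalized d \<Longrightarrow> arc_integrable d w \<Longrightarrow> arc_integrable d (kernel_proj d w)"
  using arc_integrable_add_u0[of d w "- (tangent d w / tangent d u0)"] by (simp add: kernel_proj_def[abs_def])

end

section \<open>The spaces of classes\<close>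

text \<open>The passage from \<open>\<phi>\<close> to its real-valued version changes the values on a null set only. All notions
  built from \<open>\<phi>\<close> are therefore notions built from \<open>g\<close>, and integrals over the completed measure
  become integrals over \<open>M\<close>.\<close>

locale phi_model = deformed_exponential M g
  for M :: "'a measure" and g +
  fixes \<phi> :: "'a \<Rightarrow> ereal \<Rightarrow> ennreal"
  assumes phi_eq: "AE t in M. \<forall>y::real. \<phi> t (ereal y) = ennreal (g t y)"
begin

lemma bphi_AE: "AE t in M. bphi \<phi> c t = g t (c t)"
  using phi_eq
proof eventually_elim
  case (elim t)
  then show ?case using g_pos[of t "c t"] by (simp add: bphi_def)
qed

lemma ae_class_bphi: "ae_class M (bphi \<phi> c) = ae_class M (\<lambda>t. g t (c t))"
  by (rule ae_class_cong[OF bphi_AE])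

lemma phi_integrable_iff: "c \<in> borel_measurable M \<Longrightarrow> phi_integrable M \<phi> c \<longleftrightarrow> g_integrable c"
  unfolding phi_integrable_def g_integrable_def using integrable_completion_cong[OF bphi_AE] by simp

lemma modular_eq: "modular M \<phi> c w = g_modular c w"
  unfolding modular_def g_modular_def nn_integral_completion
proof (rule nn_integral_cong_AE, use phi_eq in eventually_elim)
  fix t assume "\<forall>y::real. \<phi> t (ereal y) = ennreal (g t y)"
  then show "\<phi> t (ereal (c t + \<bar>w t\<bar>)) - \<phi> t (ereal (c t)) = ennreal (g t (c t + \<bar>w t\<bar>) - g t (c t))"
    using g_pos[of t "c t"] by (simp add: ennreal_minus less_imp_le)
qed

lemma bphi_right_deriv_AE: "AE t in M. bphi_right_deriv \<phi> c t = right_deriv c t"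
  using phi_eq
proof eventually_elim
  case (elim t)
  then have "(\<lambda>y. enn2real (\<phi> t (ereal y))) = g t" using g_pos by (simp add: fun_eq_iff less_imp_le)
  then show ?case by (simp add: bphi_right_deriv_def right_deriv_def)
qed

lemma bphi_in_P_mu_iff:
  assumes c: "c \<in> borel_measurable M"
  shows "ae_class M (bphi \<phi> c) \<in> P_mu M \<longleftrightarrow> normalized c"
proof -
  let ?p = "rep (ae_class M (\<lambda>t. g t (c t)))"
  have m: "(\<lambda>t. g t (c t)) \<in> borel_measurable M" using c by measurable
  note pm = rep_ae_class_measurable[OF m] and eq = rep_ae_class_AE[OF m]
  have "AE t in M. 0 < ?p t" using eq by eventually_elim (simp add: g_pos)
  then show ?thesis
    unfolding ae_class_bphi P_mu_def normalized_def g_integrable_def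
    using c ae_class_in_L0[OF m] integrable_cong_AE[OF pm m eq] integral_cong_AE[OF pm m eq] by auto
qed

text \<open>Every probability density has the form \<open>g(c)\<close>, because \<open>g t\<close> maps onto the positive reals.\<close>

lemma P_mu_eq: "P_mu M = {ae_class M (bphi \<phi> c) | c. normalized c}"
proof (intro set_eqI iffI)
  fix p assume p: "p \<in> P_mu M"
  then have p0: "p \<in> L0 M" "AE t in M. 0 < rep p t" by (simp_all add: P_mu_def)
  obtain c where c: "c \<in> borel_measurable M" "AE t in M. g t (c t) = rep p t"
    using measurable_inverse[OF rep_measurable[OF p0(1)] p0(2)] .
  then have "ae_class M (bphi \<phi> c) = p"
    using ae_class_cong[OF c(2)] ae_class_rep[OF p0(1)] by (simp add: ae_class_bphi)
  then show "p \<in> {ae_class M (bphi \<phi> c) | c. normalized c}" using bphi_in_P_mu_iff[OF c(1)] p by blast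
next
  fix p assume "p \<in> {ae_class M (bphi \<phi> c) | c. normalized c}"
  then show "p \<in> P_mu M" using bphi_in_P_mu_iff g_integrable_measurable[OF normalized_integrable] by auto
qed

lemma L_carrier: "vcarrier (L_space M \<phi> c) = {ae_class M f | f. orlicz c f}"
proof (intro set_eqI iffI)
  fix u assume "u \<in> vcarrier (L_space M \<phi> c)"
  then have u: "u \<in> L0 M" "\<exists>r>0. g_modular c (\<lambda>t. r * rep u t) < \<infinity>" by (auto simp: L_space_def modular_eq)
  then have "orlicz c (rep u)" by (simp add: orlicz_def rep_measurable)
  then show "u \<in> {ae_class M f | f. orlicz c f}" using ae_class_rep[OF u(1)] by force
next
  fix u assume "u \<in> {ae_class M f | f. orlicz c f}"
  then obtain f where f: "u = ae_class M f" "orlicz c f" by blast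
  note fm = orlicz_measurable[OF f(2)]
  have "AE t in M. f t = rep (ae_class M f) t" using rep_ae_class_AE[OF fm] by eventually_elim simp
  from orlicz_cong_AE[OF f(2) this rep_ae_class_measurable[OF fm]]
  show "u \<in> vcarrier (L_space M \<phi> c)"
    using f(1) ae_class_in_L0[OF fm] by (auto simp: L_space_def modular_eq orlicz_def)
qed

lemma orlicz_rep:
  assumes "u \<in> vcarrier (L_space M \<phi> c)"
  shows "orlicz c (rep u)" "u = ae_class M (rep u)"
proof -
  obtain f where f: "u = ae_class M f" "orlicz c f" using assms by (auto simp: L_carrier)
  note fm = orlicz_measurable[OF f(2)]
  have "AE t in M. f t = rep (ae_class M f) t" using rep_ae_class_AE[OF fm] by eventually_elim simp
  from orlicz_cong_AE[OF f(2) this rep_ae_class_measurable[OF fm]]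
  show "orlicz c (rep u)" by (simp add: f(1))
  show "u = ae_class M (rep u)" using ae_class_rep[OF ae_class_in_L0[OF fm]] by (simp add: f(1))
qed

lemma L_add: "\<lbrakk>f \<in> borel_measurable M; h \<in> borel_measurable M\<rbrakk> \<Longrightarrow>
    vadd (L_space M \<phi> c) (ae_class M f) (ae_class M h) = ae_class M (\<lambda>t. f t + h t)"
  by (simp add: L_space_def ae_class_add)

lemma L_scale: "f \<in> borel_measurable M \<Longrightarrow>
    vscale (L_space M \<phi> c) a (ae_class M f) = ae_class M (\<lambda>t. a * f t)"
  by (simp add: L_space_def ae_class_scale)

lemma L_zero: "vzero (L_space M \<phi> c) = ae_class M (\<lambda>t. 0)"
  by (simp add: L_space_def)

lemma L_diff: "\<lbrakk>f \<in> borel_measurable M; h \<in> borel_measurable M\<rbrakk> \<Longrightarrow>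
    vdiff (L_space M \<phi> c) (ae_class M f) (ae_class M h) = ae_class M (\<lambda>t. f t - h t)"
  by (simp add: vdiff_def L_scale L_add)

lemma L_norm:
  assumes "f \<in> borel_measurable M"
  shows "vnorm (L_space M \<phi> c) (ae_class M f) = luxemburg c f"
proof -
  have "vnorm (L_space M \<phi> c) (ae_class M f) = luxemburg c (rep (ae_class M f))"
    by (simp add: L_space_def modular_eq luxemburg_def)
  also have "\<dots> = luxemburg c f" by (rule luxemburg_cong_AE[OF rep_ae_class_AE[OF assms]])
  finally show ?thesis .
qed

lemma L_normed:
  assumes c: "g_integrable c"
  shows "normed_on (L_space M \<phi> c)"
proof -
  let ?L = "L_space M \<phi> c"
  have E: thesis if "u \<in> vcarrier ?L" "\<And>f. \<lbrakk>u = ae_class M f; f \<in> borel_measurable M; orlicz c f\<rbrakk> \<Longrightarrow> thesis" for u thesis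
    using that orlicz_measurable by (auto simp: L_carrier)
  have I: "ae_class M f \<in> vcarrier ?L" if "orlicz c f" for f using that by (auto simp: L_carrier)
  note [simp] = L_add L_scale L_diff L_norm L_zero
  show ?thesis
  proof
    fix u v assume u: "u \<in> vcarrier ?L" and v: "v \<in> vcarrier ?L"
    from u obtain f where f: "u = ae_class M f" "f \<in> borel_measurable M" "orlicz c f" by (rule E)
    from v obtain h where h: "v = ae_class M h" "h \<in> borel_measurable M" "orlicz c h" by (rule E)
    show "vadd ?L u v \<in> vcarrier ?L" using f h orlicz_add[OF c f(3) h(3)] I by simp
    show "vadd ?L u v = vadd ?L v u" using f h by (simp add: add.commute)
    show "vscale ?L a (vadd ?L u v) = vadd ?L (vscale ?L a u) (vscale ?L a v)" for a
      using f h by (simp add: distrib_left)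
    show "vnorm ?L (vadd ?L u v) \<le> vnorm ?L u + vnorm ?L v"
      using f h luxemburg_add[OF c f(3) h(3)] by simp
    fix w assume "w \<in> vcarrier ?L"
    then obtain k where k: "w = ae_class M k" "k \<in> borel_measurable M" "orlicz c k" by (rule E)
    show "vadd ?L (vadd ?L u v) w = vadd ?L u (vadd ?L v w)"
      using f h k by (simp add: add.assoc)
  next
    from I[OF orlicz_zero] show "vzero ?L \<in> vcarrier ?L" by simp
  next
    fix u assume "u \<in> vcarrier ?L"
    then obtain f where f: "u = ae_class M f" "f \<in> borel_measurable M" "orlicz c f" by (rule E)
    show "vscale ?L a u \<in> vcarrier ?L" for a using f orlicz_scale[OF c f(3)] I by simp
    show "vadd ?L u (vzero ?L) = u" using f by simp
    show "vdiff ?L u u = vzero ?L" using f by simp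
    show "vscale ?L (a + b) u = vadd ?L (vscale ?L a u) (vscale ?L b u)" for a b
      using f by (simp add: distrib_right)
    show "vscale ?L a (vscale ?L b u) = vscale ?L (a * b) u" for a b
      using f by (simp add: mult.assoc)
    show "vscale ?L 1 u = u" using f by simp
    show "0 \<le> vnorm ?L u" using f luxemburg_nonneg[OF g_integrable_measurable[OF c]] by simp
    show "vnorm ?L u = 0 \<longleftrightarrow> u = vzero ?L"
    proof
      show "u = vzero ?L" if "vnorm ?L u = 0"
        using that luxemburg_eq_zeroD[OF c f(3)] ae_class_cong[of f "\<lambda>t. 0" M] f by simp
      show "vnorm ?L u = 0" if "u = vzero ?L" using that by (simp add: luxemburg_zero)
    qed
    show "vnorm ?L (vscale ?L a u) = \<bar>a\<bar> * vnorm ?L u" for a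
      using f luxemburg_scale[OF c f(3)] by simp
  qed
qed

lemma B_carrier:
  assumes c: "g_integrable c"
  shows "vcarrier (B_space M \<phi> c) = {ae_class M f | f. orlicz c f \<and> tangent c f = 0}"
proof -
  have *: "(\<integral>t. rep u t * bphi_right_deriv \<phi> c t \<partial>completion M) = tangent c (rep u)"
    if "u \<in> vcarrier (L_space M \<phi> c)" for u
    unfolding tangent_def
  proof (rule integral_completion_cong)
    show "AE t in M. rep u t * bphi_right_deriv \<phi> c t = rep u t * right_deriv c t"
      using bphi_right_deriv_AE[of c] by eventually_elim simp
    show "(\<lambda>t. rep u t * right_deriv c t) \<in> borel_measurable M"
      using orlicz_measurable[OF orlicz_rep(1)[OF that]] g_integrable_measurable[OF c] by measurable
  qed
  have **: "tangent c (rep (ae_class M f)) = tangent c f" if "orlicz c f" for f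
    using orlicz_measurable[OF that] g_integrable_measurable[OF c]
    by (intro tangent_cong_AE rep_ae_class_AE rep_ae_class_measurable)
  have "vcarrier (B_space M \<phi> c) = {u \<in> vcarrier (L_space M \<phi> c). tangent c (rep u) = 0}"
    using * by (auto simp: B_space_def)
  also have "\<dots> = {ae_class M f | f. orlicz c f \<and> tangent c f = 0}"
    using ** by (auto simp: L_carrier)
  finally show ?thesis .
qed

lemma B_ops [simp]:
  "vadd (B_space M \<phi> c) = vadd (L_space M \<phi> c)" "vscale (B_space M \<phi> c) = vscale (L_space M \<phi> c)"
  "vzero (B_space M \<phi> c) = vzero (L_space M \<phi> c)" "vnorm (B_space M \<phi> c) = vnorm (L_space M \<phi> c)"
  "vdiff (B_space M \<phi> c) = vdiff (L_space M \<phi> c)"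
  by (simp_all add: B_space_def vdiff_def fun_eq_iff)

lemma B_normed:
  assumes c: "g_integrable c"
  shows "normed_on (B_space M \<phi> c)"
proof -
  let ?L = "L_space M \<phi> c" and ?B = "vcarrier (B_space M \<phi> c)"
  have "normed_on (?L\<lparr>vcarrier := ?B\<rparr>)"
  proof (rule normed_on_subspace[OF L_normed[OF c]])
    show "?B \<subseteq> vcarrier ?L" by (auto simp: B_carrier[OF c] L_carrier)
    note orlicz_zero
    moreover have "tangent c (\<lambda>t. 0) = 0" by (simp add: tangent_def)
    ultimately show "vzero ?L \<in> ?B" by (auto simp: B_carrier[OF c] L_zero)
    fix u assume "u \<in> ?B"
    then obtain f where f: "u = ae_class M f" "orlicz c f" "tangent c f = 0" by (auto simp: B_carrier[OF c])
    then show "vscale ?L a u \<in> ?B" for a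
      using orlicz_scale[OF c f(2), of a] tangent_scale[of c a f]
      by (auto simp: B_carrier[OF c] L_scale orlicz_measurable)
    fix v assume "v \<in> ?B"
    then obtain h where h: "v = ae_class M h" "orlicz c h" "tangent c h = 0" by (auto simp: B_carrier[OF c])
    with f show "vadd ?L u v \<in> ?B"
      using orlicz_add[OF c f(2) h(2)] tangent_add[OF c f(2) h(2)]
      by (auto simp: B_carrier[OF c] L_add orlicz_measurable)
  qed
  then show ?thesis by (simp add: B_space_def)
qed

text \<open>The functional \<open>tangent c\<close> is bounded by the norm, so limits of sequences in its kernel stay in it.\<close>

lemma B_banach:
  assumes c: "g_integrable c"
  shows "banach_on (B_space M \<phi> c)"
proof (rule banach_onI[OF B_normed[OF c]])
  let ?B = "B_space M \<phi> c"
  interpret B: normed_on ?B by (rule B_normed[OF c])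
  show "Metric_space.mcomplete (vcarrier ?B) (vdist ?B)"
  proof (rule B.mcompleteI_fast)
    fix u assume uB: "\<And>n. u n \<in> vcarrier ?B"
      and fast: "\<And>n::nat. vnorm ?B (vdiff ?B (u (Suc n)) (u n)) < (1/2) ^ n"
    have "\<forall>n. \<exists>f. u n = ae_class M f \<and> orlicz c f \<and> tangent c f = 0"
      using uB by (auto simp: B_carrier[OF c])
    then obtain f where f: "\<And>n. u n = ae_class M (f n)" "\<And>n. orlicz c (f n)" "\<And>n. tangent c (f n) = 0"
      by metis
    note fm = orlicz_measurable[OF f(2)]
    have "luxemburg c (\<lambda>t. f (Suc n) t - f n t) < (1/2) ^ n" for n
      using fast[of n] fm by (simp add: f(1) L_diff L_norm)
    from orlicz_fast_Cauchy_converges[OF c f(2) this] obtain l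
      where l: "orlicz c l" "(\<lambda>n. luxemburg c (\<lambda>t. f n t - l t)) \<longlonglongrightarrow> 0" by blast
    have "\<bar>tangent c l\<bar> \<le> luxemburg c (\<lambda>t. f n t - l t)" for n
      using tangent_le_luxemburg[OF c orlicz_diff[OF c f(2) l(1)], of n] tangent_diff[OF c f(2) l(1), of n] f(3)[of n]
      by simp
    then have "\<bar>tangent c l\<bar> \<le> 0" using l(2) by (intro LIMSEQ_le_const) auto
    then have "ae_class M l \<in> vcarrier ?B" using l(1) by (auto simp: B_carrier[OF c])
    moreover have "vnorm ?B (vdiff ?B (u n) (ae_class M l)) = luxemburg c (\<lambda>t. f n t - l t)" for n
      using fm orlicz_measurable[OF l(1)] by (simp add: f(1) L_diff L_norm)
    ultimately show "\<exists>l\<in>vcarrier ?B. (\<lambda>n. vnorm ?B (vdiff ?B (u n) l)) \<longlonglongrightarrow> 0"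
      using l(2) by (intro bexI[of _ "ae_class M l"]) simp_all
  qed
qed

end

section \<open>Charts and transition maps\<close>

locale phi_charts = normalized_exponential M g u0 + phi_model M g \<phi>
  for M :: "'a measure" and g u0 \<phi>
begin

lemma B_domain_eq:
  assumes c: "g_integrable c"
  shows "B_domain M \<phi> c = {ae_class M f | f. arc_integrable c f \<and> tangent c f = 0}"
proof -
  note cm [measurable] = g_integrable_measurable[OF c]
  have K: "u \<in> K_set M \<phi> c \<longleftrightarrow> arc_integrable c (rep u)" if u: "u \<in> vcarrier (L_space M \<phi> c)" for u
  proof -
    have [measurable]: "rep u \<in> borel_measurable M" using orlicz_measurable[OF orlicz_rep(1)[OF u]] .
    show ?thesis using u unfolding K_set_def by (simp add: arc_integrable_iff_open phi_integrable_iff)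
  qed
  have rep: "arc_integrable c (rep (ae_class M f)) \<longleftrightarrow> arc_integrable c f" if [measurable]: "f \<in> borel_measurable M" for f
  proof -
    note ae = rep_ae_class_AE[OF that]
    have ae': "AE t in M. f t = rep (ae_class M f) t" using ae by eventually_elim simp
    show ?thesis
      using arc_integrable_cong_AE[OF _ ae cm that] arc_integrable_cong_AE[OF _ ae' cm rep_ae_class_measurable[OF that]] by blast
  qed
  have L: "ae_class M f \<in> vcarrier (L_space M \<phi> c)" if "orlicz c f" for f using that by (auto simp: L_carrier)
  show ?thesis
  proof (intro set_eqI iffI)
    fix u assume "u \<in> B_domain M \<phi> c"
    then obtain f where f: "u = ae_class M f" "orlicz c f" "tangent c f = 0" and uK: "u \<in> K_set M \<phi> c"
      unfolding B_domain_def B_carrier[OF c] by blast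
    have "arc_integrable c f" using uK K[OF L[OF f(2)]] rep[OF orlicz_measurable[OF f(2)]] f(1) by simp
    with f show "u \<in> {ae_class M f | f. arc_integrable c f \<and> tangent c f = 0}" by blast
  next
    fix u assume "u \<in> {ae_class M f | f. arc_integrable c f \<and> tangent c f = 0}"
    then obtain f where f: "u = ae_class M f" "arc_integrable c f" "tangent c f = 0" by blast
    note o = arc_integrable_orlicz[OF c f(2)]
    have "u \<in> K_set M \<phi> c" using f K[OF L[OF o]] rep[OF orlicz_measurable[OF o]] by simp
    then show "u \<in> B_domain M \<phi> c" using f o unfolding B_domain_def B_carrier[OF c] by blast
  qed
qed

text \<open>The normalizing constant is pinned down by uniqueness, so it suffices to exhibit one that works.\<close>

lemma phi_chart_eq:
  assumes c: "normalized c" and f: "arc_integrable c f" and s: "normalized (\<lambda>t. c t + f t - s * u0 t)"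
  shows "phi_chart M \<phi> u0 c (ae_class M f) = ae_class M (bphi \<phi> (\<lambda>t. c t + f t - s * u0 t))"
proof -
  have fm [measurable]: "f \<in> borel_measurable M" using f by (simp add: arc_integrable_def)
  note cm [measurable] = g_integrable_measurable[OF normalized_integrable[OF c]]
  let ?r = "rep (ae_class M f)"
  note rm [measurable] = rep_ae_class_measurable[OF fm]
  have eq: "ae_class M (bphi \<phi> (\<lambda>t. c t + ?r t - s * u0 t)) = ae_class M (bphi \<phi> (\<lambda>t. c t + f t - s * u0 t))" for s
    unfolding ae_class_bphi by (rule ae_class_cong, use rep_ae_class_AE[OF fm] in eventually_elim) simp
  have iff: "ae_class M (bphi \<phi> (\<lambda>t. c t + ?r t - s * u0 t)) \<in> P_mu M \<longleftrightarrow> normalized (\<lambda>t. c t + f t - s * u0 t)" for s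
    unfolding eq by (rule bphi_in_P_mu_iff) measurable
  have "normalizing M \<phi> u0 c (ae_class M f) = s"
    unfolding normalizing_def iff using ex1_normalizing[OF c f] s by (intro the1_equality)
  then show ?thesis by (simp add: phi_chart_def eq)
qed

lemma phi_chart_in: "normalized c \<Longrightarrow> u \<in> B_domain M \<phi> c \<Longrightarrow> phi_chart M \<phi> u0 c u \<in> P_mu M"
proof -
  assume c: "normalized c" and "u \<in> B_domain M \<phi> c"
  then obtain f where f: "u = ae_class M f" "arc_integrable c f" by (auto simp: B_domain_eq normalized_integrable)
  obtain s where s: "normalized (\<lambda>t. c t + f t - s * u0 t)" using ex1_normalizing[OF c f(2)] by blast
  show ?thesis unfolding f(1) phi_chart_eq[OF c f(2) s] P_mu_eq using s by blast
qed

lemma bphi_class_inj: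
  assumes "c \<in> borel_measurable M" "ae_class M (bphi \<phi> c) = ae_class M (bphi \<phi> d)"
  shows "AE t in M. c t = d t"
proof -
  have "AE t in M. g t (c t) = g t (d t)"
    using assms ae_class_eq_iff[OF g_comp_measurable[OF assms(1)]] by (simp add: ae_class_bphi)
  then show ?thesis by eventually_elim (use g_strict_mono in \<open>simp add: strict_mono_eq\<close>)
qed

text \<open>If two directions have the same image, they differ by a multiple of \<open>u0\<close>; both lie in the kernel of
  \<open>tangent c\<close> and \<open>u0\<close> does not, so the multiple is zero.\<close>

lemma phi_chart_inj:
  assumes c: "normalized c"
  shows "inj_on (phi_chart M \<phi> u0 c) (B_domain M \<phi> c)"
proof (rule inj_onI)
  note ci = normalized_integrable[OF c]
  fix u v assume "u \<in> B_domain M \<phi> c" "v \<in> B_domain M \<phi> c"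
    and eq: "phi_chart M \<phi> u0 c u = phi_chart M \<phi> u0 c v"
  then obtain f h where f: "u = ae_class M f" "arc_integrable c f" "tangent c f = 0"
    and h: "v = ae_class M h" "arc_integrable c h" "tangent c h = 0" by (auto simp: B_domain_eq[OF ci])
  note fo = arc_integrable_orlicz[OF ci f(2)] and ho = arc_integrable_orlicz[OF ci h(2)]
  note [measurable] = orlicz_measurable[OF fo] orlicz_measurable[OF ho] g_integrable_measurable[OF ci]
  obtain s where s: "normalized (\<lambda>t. c t + f t - s * u0 t)" using ex1_normalizing[OF c f(2)] by blast
  obtain r where r: "normalized (\<lambda>t. c t + h t - r * u0 t)" using ex1_normalizing[OF c h(2)] by blast
  have "AE t in M. c t + f t - s * u0 t = c t + h t - r * u0 t"
    using eq unfolding f(1) h(1) phi_chart_eq[OF c f(2) s] phi_chart_eq[OF c h(2) r]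
    by (intro bphi_class_inj) measurable
  then have ae: "AE t in M. f t - h t = (s - r) * u0 t"
    by eventually_elim (simp add: algebra_simps)
  have "tangent c (\<lambda>t. f t - h t) = tangent c (\<lambda>t. (s - r) * u0 t)"
    by (rule tangent_cong_AE[OF ae]) measurable
  then have "(s - r) * tangent c u0 = 0"
    using tangent_diff[OF ci fo ho] f(3) h(3) by (simp add: tangent_scale)
  then have "s = r" using tangent_u0_pos[OF c] by simp
  with ae have "AE t in M. f t - h t = 0" by simp
  then have "AE t in M. f t = h t" by eventually_elim simp
  then show "u = v" unfolding f(1) h(1) by (rule ae_class_cong)
qed

lemma B_domain_open:
  assumes c: "g_integrable c"
  shows "openin (vtopology (B_space M \<phi> c)) (B_domain M \<phi> c)"
proof -
  interpret B: normed_on "B_space M \<phi> c" by (rule B_normed[OF c])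
  show ?thesis
    unfolding B.openin_vtopology
  proof (intro conjI ballI)
    show "B_domain M \<phi> c \<subseteq> vcarrier (B_space M \<phi> c)" by (auto simp: B_domain_def)
    fix u assume "u \<in> B_domain M \<phi> c"
    then obtain f where f: "u = ae_class M f" "arc_integrable c f" by (auto simp: B_domain_eq[OF c])
    note fo = arc_integrable_orlicz[OF c f(2)]
    obtain r where r: "0 < r" "\<And>w. orlicz c w \<Longrightarrow> luxemburg c w < r \<Longrightarrow> arc_integrable c (\<lambda>t. f t + w t)"
      using arc_integrable_open[OF c f(2)] by blast
    show "\<exists>r>0. \<forall>v\<in>vcarrier (B_space M \<phi> c). vnorm (B_space M \<phi> c) (vdiff (B_space M \<phi> c) v u) < r
        \<longrightarrow> v \<in> B_domain M \<phi> c"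
    proof (intro exI[of _ r] conjI ballI impI r(1))
      fix v assume "v \<in> vcarrier (B_space M \<phi> c)" and n: "vnorm (B_space M \<phi> c) (vdiff (B_space M \<phi> c) v u) < r"
      then obtain h where h: "v = ae_class M h" "orlicz c h" "tangent c h = 0" by (auto simp: B_carrier[OF c])
      have "luxemburg c (\<lambda>t. h t - f t) < r"
        using n orlicz_measurable[OF fo] orlicz_measurable[OF h(2)] by (simp add: f(1) h(1) L_diff L_norm)
      from r(2)[OF orlicz_diff[OF c h(2) fo] this] have "arc_integrable c h" by simp
      with h show "v \<in> B_domain M \<phi> c" by (auto simp: B_domain_eq[OF c])
    qed
  qed
qed

text \<open>The candidate for the transition map, read off from the equation \<open>c + u - s u0 = d + v - r u0\<close>.\<close>

definition transition :: "('a \<Rightarrow> real) \<Rightarrow> ('a \<Rightarrow> real) \<Rightarrow> ('a \<Rightarrow> real) set \<Rightarrow> ('a \<Rightarrow> real) set" where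
  "transition c d u = ae_class M (kernel_proj d (\<lambda>t. c t + rep u t - d t))"

lemma transition_eq:
  assumes [measurable]: "c \<in> borel_measurable M" "d \<in> borel_measurable M" and f [measurable]: "f \<in> borel_measurable M"
  shows "transition c d (ae_class M f) = ae_class M (kernel_proj d (\<lambda>t. c t + f t - d t))"
  unfolding transition_def
proof (rule ae_class_cong, rule kernel_proj_cong_AE)
  note [measurable] = rep_ae_class_measurable[OF f]
  show "AE t in M. c t + rep (ae_class M f) t - d t = c t + f t - d t"
    using rep_ae_class_AE[OF f] by eventually_elim simp
  show "(\<lambda>t. c t + rep (ae_class M f) t - d t) \<in> borel_measurable M" by measurable
qed measurable

text \<open>The direction from \<open>d\<close> to the density in question is \<open>c + f - d\<close> up to a multiple of \<open>u0\<close>, and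
  adding such a multiple affects neither arc-integrability nor the normalized density. So the density
  lies in the image of the chart at \<open>d\<close> as soon as \<open>c + f - d\<close> is an arc-integrable direction at \<open>d\<close>, and its
  preimage is the projection of that direction to the kernel of \<open>tangent d\<close>.\<close>

lemma overlap_iff:
  assumes c: "normalized c" and d: "normalized d" and f: "arc_integrable c f"
  shows "phi_chart M \<phi> u0 c (ae_class M f) \<in> phi_chart M \<phi> u0 d ` B_domain M \<phi> d \<longleftrightarrow>
    arc_integrable d (\<lambda>t. c t + f t - d t)" (is "?in \<longleftrightarrow> ?K")
    and "arc_integrable d (\<lambda>t. c t + f t - d t) \<Longrightarrow> transition c d (ae_class M f) \<in> B_domain M \<phi> d"
    and "arc_integrable d (\<lambda>t. c t + f t - d t) \<Longrightarrow>
      phi_chart M \<phi> u0 d (transition c d (ae_class M f)) = phi_chart M \<phi> u0 c (ae_class M f)"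
proof -
  note ci = normalized_integrable[OF c] and di = normalized_integrable[OF d]
  have fm [measurable]: "f \<in> borel_measurable M" using f by (simp add: arc_integrable_def)
  note cm [measurable] = g_integrable_measurable[OF ci] and dm [measurable] = g_integrable_measurable[OF di]
  let ?w = "\<lambda>t. c t + f t - d t"
  have T: "transition c d (ae_class M f) = ae_class M (kernel_proj d ?w)" by (rule transition_eq) measurable
  obtain s where s: "normalized (\<lambda>t. c t + f t - s * u0 t)" using ex1_normalizing[OF c f] by blast
  have dom: "transition c d (ae_class M f) \<in> B_domain M \<phi> d"
    and eq: "phi_chart M \<phi> u0 d (transition c d (ae_class M f)) = phi_chart M \<phi> u0 c (ae_class M f)"
    if K: "arc_integrable d ?w"
  proof -
    note P = arc_integrable_kernel_proj[OF d K]
    show "transition c d (ae_class M f) \<in> B_domain M \<phi> d"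
      unfolding T B_domain_eq[OF di] using P tangent_kernel_proj[OF d arc_integrable_orlicz[OF di K]] by blast
    \<comment> \<open>The projection already subtracts a multiple of \<open>u0\<close>; the rest is left to the normalization.\<close>
    define r where "r = s - tangent d ?w / tangent d u0"
    have fn: "(\<lambda>t. d t + kernel_proj d ?w t - r * u0 t) = (\<lambda>t. c t + f t - s * u0 t)"
      by (simp add: kernel_proj_def r_def fun_eq_iff algebra_simps)
    then have r: "normalized (\<lambda>t. d t + kernel_proj d ?w t - r * u0 t)" using s by simp
    show "phi_chart M \<phi> u0 d (transition c d (ae_class M f)) = phi_chart M \<phi> u0 c (ae_class M f)"
      unfolding T phi_chart_eq[OF d P r] phi_chart_eq[OF c f s] fn ..
  qed
  show "arc_integrable d ?w \<Longrightarrow> transition c d (ae_class M f) \<in> B_domain M \<phi> d"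
    "arc_integrable d ?w \<Longrightarrow> phi_chart M \<phi> u0 d (transition c d (ae_class M f)) = phi_chart M \<phi> u0 c (ae_class M f)"
    by (fact dom, fact eq)
  show "?in \<longleftrightarrow> ?K"
  proof
    assume ?K then show ?in using dom eq by (metis imageI)
  next
    assume ?in
    then obtain h where h: "arc_integrable d h" "phi_chart M \<phi> u0 c (ae_class M f) = phi_chart M \<phi> u0 d (ae_class M h)"
      unfolding B_domain_eq[OF di] by blast
    have [measurable]: "h \<in> borel_measurable M" using h(1) by (simp add: arc_integrable_def)
    obtain r where r: "normalized (\<lambda>t. d t + h t - r * u0 t)" using ex1_normalizing[OF d h(1)] by blast
    have "AE t in M. c t + f t - s * u0 t = d t + h t - r * u0 t"
      using h(2) unfolding phi_chart_eq[OF c f s] phi_chart_eq[OF d h(1) r]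
      by (intro bphi_class_inj) measurable
    then have "AE t in M. h t + (s - r) * u0 t = c t + f t - d t"
      by eventually_elim (simp add: algebra_simps)
    from arc_integrable_cong_AE[OF arc_integrable_add_u0[OF d h(1)] this] show ?K by simp
  qed
qed

text \<open>By \<open>overlap_iff\<close> the overlap is the preimage of an open set under a translation, which is continuous from
  the space at \<open>c\<close> to that at \<open>d\<close> by the comparison of the norms.\<close>

lemma overlap_open:
  assumes c: "normalized c" and d: "normalized d"
  shows "openin (vtopology (B_space M \<phi> c))
    {u \<in> B_domain M \<phi> c. phi_chart M \<phi> u0 c u \<in> phi_chart M \<phi> u0 d ` B_domain M \<phi> d}" (is "openin _ ?U")
proof -
  note ci = normalized_integrable[OF c] and di = normalized_integrable[OF d]
  note cm [measurable] = g_integrable_measurable[OF ci] and dm [measurable] = g_integrable_measurable[OF di]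
  interpret B: normed_on "B_space M \<phi> c" by (rule B_normed[OF ci])
  show ?thesis
    unfolding B.openin_vtopology
  proof (intro conjI ballI)
    show "?U \<subseteq> vcarrier (B_space M \<phi> c)" by (auto simp: B_domain_def)
    fix u assume u: "u \<in> ?U"
    then obtain f where f: "u = ae_class M f" "arc_integrable c f" by (auto simp: B_domain_eq[OF ci])
    note fo = arc_integrable_orlicz[OF ci f(2)]
    have K: "arc_integrable d (\<lambda>t. c t + f t - d t)" using u overlap_iff(1)[OF c d f(2)] by (simp add: f(1))
    obtain C where C: "0 < C" "\<And>w. orlicz c w \<Longrightarrow> orlicz d w" "\<And>w. orlicz c w \<Longrightarrow> luxemburg d w \<le> C * luxemburg c w"
      using overlap_base_change[OF ci di f(2) K] by blast
    obtain r where r: "0 < r" "\<And>w. orlicz c w \<Longrightarrow> luxemburg c w < r \<Longrightarrow> arc_integrable c (\<lambda>t. f t + w t)"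
      using arc_integrable_open[OF ci f(2)] by blast
    obtain s where s: "0 < s" "\<And>w. orlicz d w \<Longrightarrow> luxemburg d w < s \<Longrightarrow> arc_integrable d (\<lambda>t. c t + f t - d t + w t)"
      using arc_integrable_open[OF di K] by blast
    show "\<exists>r>0. \<forall>v\<in>vcarrier (B_space M \<phi> c). vnorm (B_space M \<phi> c) (vdiff (B_space M \<phi> c) v u) < r \<longrightarrow> v \<in> ?U"
    proof (intro exI[of _ "min r (s / C)"] conjI ballI impI)
      show "0 < min r (s / C)" using r s C by simp
      fix v assume "v \<in> vcarrier (B_space M \<phi> c)"
        and n: "vnorm (B_space M \<phi> c) (vdiff (B_space M \<phi> c) v u) < min r (s / C)"
      then obtain h where h: "v = ae_class M h" "orlicz c h" "tangent c h = 0" by (auto simp: B_carrier[OF ci])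
      let ?w = "\<lambda>t. h t - f t"
      have w: "orlicz c ?w" by (rule orlicz_diff[OF ci h(2) fo])
      have lw: "luxemburg c ?w < r" "luxemburg c ?w < s / C"
        using n orlicz_measurable[OF fo] orlicz_measurable[OF h(2)] by (simp_all add: f(1) h(1) L_diff L_norm)
      have hK: "arc_integrable c h" using r(2)[OF w lw(1)] by simp
      have "luxemburg d ?w < s" using C(3)[OF w] lw(2) C(1) by (simp add: field_simps)
      from s(2)[OF C(2)[OF w] this] have "arc_integrable d (\<lambda>t. c t + h t - d t)"
        by (simp add: algebra_simps)
      then have "phi_chart M \<phi> u0 c v \<in> phi_chart M \<phi> u0 d ` B_domain M \<phi> d"
        unfolding h(1) overlap_iff(1)[OF c d hK] .
      then show "v \<in> ?U" using hK h by (auto simp: B_domain_eq[OF ci])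
    qed
  qed
qed

text \<open>Projecting \<open>c + u - d\<close> to the kernel of \<open>tangent d\<close> is affine in \<open>u\<close>. Its linear part is the
  projection alone, bounded because the projection is bounded at \<open>d\<close> and the norm at \<open>d\<close> is bounded by
  the norm at \<open>c\<close>.\<close>

lemma transition_Ck:
  assumes c: "normalized c" and d: "normalized d"
  shows "Ck_on k (B_space M \<phi> c)
    {u \<in> B_domain M \<phi> c. phi_chart M \<phi> u0 c u \<in> phi_chart M \<phi> u0 d ` B_domain M \<phi> d}
    (B_space M \<phi> d) (transition c d)" (is "Ck_on k ?X ?U ?Y _")
proof (cases "?U = {}")
  case True
  show ?thesis
    unfolding True Ck_on_def op_continuous_on_def op_has_derivative_on_def by simp
next
  case False
  note ci = normalized_integrable[OF c] and di = normalized_integrable[OF d]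
  note cm [measurable] = g_integrable_measurable[OF ci] and dm [measurable] = g_integrable_measurable[OF di]
  have U: "\<exists>f. u = ae_class M f \<and> arc_integrable c f \<and> arc_integrable d (\<lambda>t. c t + f t - d t)" if "u \<in> ?U" for u
    using that overlap_iff(1)[OF c d] by (auto simp: B_domain_eq[OF ci])
  from False obtain f0 where "arc_integrable c f0" "arc_integrable d (\<lambda>t. c t + f0 t - d t)" using U by blast
  from overlap_base_change[OF ci di this] obtain C where
    C: "0 < C" "\<And>w. orlicz c w \<Longrightarrow> orlicz d w" "\<And>w. orlicz c w \<Longrightarrow> luxemburg d w \<le> C * luxemburg c w" by blast
  define A where "A u = ae_class M (kernel_proj d (rep u))" for u
  have A: "A (ae_class M w) = ae_class M (kernel_proj d w)" if "w \<in> borel_measurable M" for w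
    unfolding A_def
    by (rule ae_class_cong, rule kernel_proj_cong_AE[OF rep_ae_class_AE[OF that] dm rep_ae_class_measurable[OF that] that])
  have E: thesis if "h \<in> vcarrier ?X"
    "\<And>w. \<lbrakk>h = ae_class M w; orlicz c w; orlicz d w; w \<in> borel_measurable M\<rbrakk> \<Longrightarrow> thesis" for h thesis
    using that C(2) orlicz_measurable by (auto simp: B_carrier[OF ci])
  note pm = kernel_proj_measurable
  define q where "q = 1 + luxemburg d u0 / tangent d u0"
  have q: "0 \<le> q"
    using tangent_u0_pos[OF d] luxemburg_nonneg[OF dm u0_orlicz[OF d]] by (simp add: q_def)
  show ?thesis
  proof (rule Ck_on_affine[where A=A and K="q * C", OF B_normed[OF ci] B_normed[OF di]])
    show "?U \<subseteq> vcarrier ?X" by (auto simp: B_domain_def)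
    fix u assume u: "u \<in> ?U"
    then obtain f where f: "u = ae_class M f" "arc_integrable c f" "arc_integrable d (\<lambda>t. c t + f t - d t)" using U by blast
    show "transition c d u \<in> vcarrier ?Y"
      using overlap_iff(2)[OF c d f(2,3)] by (simp add: f(1) B_domain_def)
    fix h assume "h \<in> vcarrier ?X"
    then obtain w where w: "h = ae_class M w" "orlicz c w" "orlicz d w" "w \<in> borel_measurable M" by (rule E)
    note fm = orlicz_measurable[OF arc_integrable_orlicz[OF ci f(2)]]
    note fo = arc_integrable_orlicz[OF di f(3)]
    have "kernel_proj d (\<lambda>t. c t + (f t + w t) - d t) = (\<lambda>t. kernel_proj d (\<lambda>t. c t + f t - d t) t + kernel_proj d w t)"
      using kernel_proj_add[OF d fo w(3)] by (simp add: algebra_simps)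
    then show "transition c d (vadd ?X u h) = vadd ?Y (transition c d u) (A h)"
      using fm w pm[OF orlicz_measurable[OF fo]] pm[OF w(4)]
      by (simp add: f(1) w(1) L_add A transition_eq[OF cm dm])
  next
    fix h assume "h \<in> vcarrier ?X"
    then obtain w where w: "h = ae_class M w" "orlicz c w" "orlicz d w" "w \<in> borel_measurable M" by (rule E)
    show "A h \<in> vcarrier ?Y"
      using kernel_proj_orlicz[OF d w(3)] tangent_kernel_proj[OF d w(3)] by (auto simp: w(1) A[OF w(4)] B_carrier[OF di])
    show "A (vscale ?X a h) = vscale ?Y a (A h)" for a
      using w(4) pm[OF w(4)] by (simp add: w(1) L_scale A kernel_proj_scale)
    have "luxemburg d (kernel_proj d w) \<le> q * luxemburg d w" using luxemburg_kernel_proj[OF d w(3)] by (simp add: q_def)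
    also have "\<dots> \<le> q * (C * luxemburg c w)" using C(3)[OF w(2)] q by (rule mult_left_mono)
    finally show "vnorm ?Y (A h) \<le> q * C * vnorm ?X h"
      using w(4) pm[OF w(4)] by (simp add: w(1) L_norm A mult.assoc)
    fix k assume "k \<in> vcarrier ?X"
    then obtain v where v: "k = ae_class M v" "orlicz c v" "orlicz d v" "v \<in> borel_measurable M" by (rule E)
    show "A (vadd ?X h k) = vadd ?Y (A h) (A k)"
      using w(4) v(4) pm[OF w(4)] pm[OF v(4)] by (simp add: w(1) v(1) L_add A kernel_proj_add[OF d w(3) v(3)])
  qed
qed

text \<open>The transition maps in the two directions are inverse to each other, since both preserve the
  density and charts are injective. So each of them is a \<open>C\<^sup>k\<close>-isomorphism.\<close>

lemma phi_charts_manifold: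
  "Ck_banach_manifold k (P_mu M) {c. normalized c} (B_space M \<phi>) (B_domain M \<phi>) (phi_chart M \<phi> u0)"
proof (rule Ck_banach_manifold.intro)
  let ?x = "phi_chart M \<phi> u0" and ?U = "B_domain M \<phi>"
  fix c assume "c \<in> {c. normalized c}"
  then have c: "normalized c" by simp
  show "banach_on (B_space M \<phi> c)" by (rule B_banach[OF normalized_integrable[OF c]])
  show "openin (vtopology (B_space M \<phi> c)) (?U c)" by (rule B_domain_open[OF normalized_integrable[OF c]])
  show "?x c ` ?U c \<subseteq> P_mu M" using phi_chart_in[OF c] by blast
  show "inj_on (?x c) (?U c)" by (rule phi_chart_inj[OF c])
  fix d W assume "d \<in> {c. normalized c}" and W: "W = ?x c ` ?U c \<inter> ?x d ` ?U d"
  then have d: "normalized d" by simp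
  define V where "V c d = {u \<in> ?U c. ?x c u \<in> ?x d ` ?U d}" for c d
  have VW: "{u \<in> ?U c. ?x c u \<in> W} = V c d" "{u \<in> ?U d. ?x d u \<in> W} = V d c"
    unfolding V_def W by auto
  show "openin (vtopology (B_space M \<phi> c)) {u \<in> ?U c. ?x c u \<in> W} \<and>
        openin (vtopology (B_space M \<phi> d)) {u \<in> ?U d. ?x d u \<in> W}"
    unfolding VW using overlap_open[OF c d] overlap_open[OF d c] by (simp add: V_def)
  have T: "transition a b u \<in> V b a" "?x b (transition a b u) = ?x a u"
    if a: "normalized a" and b: "normalized b" and u: "u \<in> V a b" for a b u
  proof -
    obtain f where f: "u = ae_class M f" "arc_integrable a f" using u by (auto simp: V_def B_domain_eq[OF normalized_integrable[OF a]])
    have K: "arc_integrable b (\<lambda>t. a t + f t - b t)" using u overlap_iff(1)[OF a b f(2)] by (simp add: f(1) V_def)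
    show *: "?x b (transition a b u) = ?x a u" using overlap_iff(3)[OF a b f(2) K] by (simp add: f(1))
    have "transition a b u \<in> ?U b" using overlap_iff(2)[OF a b f(2) K] by (simp add: f(1))
    moreover have "?x b (transition a b u) \<in> ?x a ` ?U a" unfolding * using u by (simp add: V_def)
    ultimately show "transition a b u \<in> V b a" by (simp add: V_def)
  qed
  have VU: "u \<in> ?U a" if "u \<in> V a b" for u a b using that by (simp add: V_def)
  have TT: "transition b a (transition a b u) = u" if a: "normalized a" and b: "normalized b" and u: "u \<in> V a b" for a b u
    using inj_onD[OF phi_chart_inj[OF a], of "transition b a (transition a b u)" u]
      T[OF a b u] T[OF b a T(1)[OF a b u]] u VU by simp
  let ?F = "inv_into (?U d) (?x d) \<circ> ?x c"
  have F: "?F u = transition c d u" if "u \<in> V c d" for u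
    using inv_into_f_f[OF phi_chart_inj[OF d] VU[OF T(1)[OF c d that]]] T(2)[OF c d that] by simp
  have bij: "bij_betw ?F (V c d) (V d c)"
    using F T(1)[OF c d] T(1)[OF d c] TT[OF c d] TT[OF d c]
    by (intro bij_betwI[where g="transition d c"]) auto
  have inv: "inv_into (V c d) ?F v = transition d c v" if v: "v \<in> V d c" for v
    using F[OF T(1)[OF d c v]] TT[OF d c v] bij
    by (intro inv_into_f_eq T(1)[OF d c v]) (auto simp: bij_betw_def)
  show "Ck_isomorphism k (B_space M \<phi> c) {u \<in> ?U c. ?x c u \<in> W} (B_space M \<phi> d) {u \<in> ?U d. ?x d u \<in> W} ?F"
    unfolding VW Ck_isomorphism_def
  proof (intro conjI bij)
    show "Ck_on k (B_space M \<phi> c) (V c d) (B_space M \<phi> d) ?F"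
      by (rule Ck_on_cong[OF _ F]) (use transition_Ck[OF c d] in \<open>simp_all add: V_def\<close>)
    show "Ck_on k (B_space M \<phi> d) (V d c) (B_space M \<phi> c) (inv_into (V c d) ?F)"
      by (rule Ck_on_cong[OF _ inv]) (use transition_Ck[OF d c] in \<open>simp_all add: V_def\<close>)
  qed
next
  let ?x = "phi_chart M \<phi> u0" and ?U = "B_domain M \<phi>"
  show "(\<Union>c\<in>{c. normalized c}. ?x c ` ?U c) = P_mu M"
  proof
    show "(\<Union>c\<in>{c. normalized c}. ?x c ` ?U c) \<subseteq> P_mu M" using phi_chart_in by blast
    show "P_mu M \<subseteq> (\<Union>c\<in>{c. normalized c}. ?x c ` ?U c)"
    proof
      fix p assume "p \<in> P_mu M"
      then obtain c where c: "p = ae_class M (bphi \<phi> c)" "normalized c" unfolding P_mu_eq by blast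
      note K = arc_integrable_zero[OF normalized_integrable[OF c(2)]]
      have "?x c (ae_class M (\<lambda>t. 0)) = p"
        using phi_chart_eq[OF c(2) K, of 0] c by simp
      moreover have "ae_class M (\<lambda>t. 0) \<in> ?U c"
        unfolding B_domain_eq[OF normalized_integrable[OF c(2)]] using K by (auto simp: tangent_def)
      ultimately show "p \<in> (\<Union>c\<in>{c. normalized c}. ?x c ` ?U c)" using c(2) by blast
    qed
  qed
qed

end

section \<open>The real-valued version of a \<open>\<phi>\<close>-function\<close>

text \<open>Finiteness and positivity of \<open>\<phi> t\<close> at real arguments follow from its values at \<open>\<plusminus>\<infinity>\<close> and strict
  monotonicity, and the limit \<open>0\<close> at \<open>-\<infinity>\<close> from surjectivity. On a measurable null set containing
  all bad points \<open>\<phi> t\<close> is replaced by the exponential function, which keeps measurability.\<close>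

lemma phi_function_model:
  fixes \<phi> :: "'a \<Rightarrow> ereal \<Rightarrow> ennreal"
  assumes phi: "phi_function M \<phi>"
  obtains g where "phi_model M g \<phi>"
proof -
  define good where "good t \<longleftrightarrow>
    (\<forall>u v. \<forall>r::real. 0 < r \<and> r < 1 \<longrightarrow>
       \<phi> t (ereal (1 - r) * u + ereal r * v) \<le> ennreal (1 - r) * \<phi> t u + ennreal r * \<phi> t v) \<and>
    \<phi> t (-\<infinity>) = 0 \<and> \<phi> t \<infinity> = \<infinity> \<and> range (\<phi> t) = UNIV \<and> strict_mono (\<phi> t)" for t
  have "AE t in M. good t"
    using conjunct1[OF phi[unfolded phi_function_def]]
    by (rule eventually_mono) (simp add: good_def)
  then obtain N where N: "{t \<in> space M. \<not> good t} \<subseteq> N" "N \<in> null_sets M"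
    by (auto elim!: AE_E intro!: null_setsI)
  define G where "G = space M - N"
  have G [measurable]: "G \<in> sets M" using N by (auto simp: G_def)
  have GN: "AE t in M. t \<in> G"
    using AE_not_in[OF N(2)] AE_space by eventually_elim (simp add: G_def)
  have good: "good t" if "t \<in> G" for t using that N by (auto simp: G_def)
  define g where "g t y = (if t \<in> G then enn2real (\<phi> t (ereal y)) else exp y)" for t and y :: real
  have fin: "\<phi> t (ereal y) = ennreal (g t y) \<and> 0 < g t y" if t: "t \<in> G" for t y
  proof -
    have lim: "\<phi> t (-\<infinity>) = 0" "\<phi> t \<infinity> = \<infinity>" and mono: "strict_mono (\<phi> t)"
      using good[OF t] by (auto simp: good_def)
    have "\<phi> t (-\<infinity>) < \<phi> t (ereal y)" "\<phi> t (ereal y) < \<phi> t \<infinity>"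
      by (rule strict_monoD[OF mono]; simp)+
    then have "0 < \<phi> t (ereal y)" "\<phi> t (ereal y) < \<infinity>" unfolding lim .
    then show ?thesis using t by (simp add: g_def enn2real_positive_iff)
  qed
  have outside: "g t = exp" if "t \<notin> G" for t using that by (simp add: g_def fun_eq_iff)
  have pos: "0 < g t y" for t y using fin[of t y] by (cases "t \<in> G") (auto simp: outside)
  show thesis
  proof (rule that, unfold_locales)
    show "(\<lambda>t. g t y) \<in> borel_measurable M" for y
    proof -
      have [measurable]: "(\<lambda>t. \<phi> t (ereal y)) \<in> borel_measurable M"
        using phi by (simp add: phi_function_def)
      show ?thesis unfolding g_def by measurable
    qed
    show "0 < g t y" for t y by (rule pos)
    show "convex_on UNIV (g t)" for t
    proof (cases "t \<in> G")
      case t: True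
      show ?thesis
      proof (rule convex_onI)
        fix r x y :: real assume r: "0 < r" "r < 1"
        have "ennreal (g t ((1 - r) * x + r * y)) = \<phi> t (ereal (1 - r) * ereal x + ereal r * ereal y)"
          using fin[OF t, of "(1 - r) * x + r * y"] by simp
        also have "\<dots> \<le> ennreal (1 - r) * \<phi> t (ereal x) + ennreal r * \<phi> t (ereal y)"
          using good[OF t] r unfolding good_def by blast
        also have "\<dots> = ennreal ((1 - r) * g t x + r * g t y)"
          using fin[OF t, of x] fin[OF t, of y] ennreal_mult_add[of "1 - r" r "g t x" "g t y"] r by simp
        finally have "g t ((1 - r) * x + r * y) \<le> (1 - r) * g t x + r * g t y"
          using r pos[of t x] pos[of t y] by (subst (asm) ennreal_le_iff) auto
        then show "g t ((1 - r) *\<^sub>R x + r *\<^sub>R y) \<le> (1 - r) * g t x + r * g t y" by simp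
      qed simp
    qed (simp add: outside exp_convex)
    show mono: "strict_mono (g t)" for t
    proof (cases "t \<in> G")
      case t: True
      show ?thesis
      proof (rule strict_monoI)
        fix x y :: real assume "x < y"
        then have "\<phi> t (ereal x) < \<phi> t (ereal y)" using good[OF t] by (auto simp: good_def strict_mono_less)
        then show "g t x < g t y" using fin[OF t, of x] fin[OF t, of y] by (simp add: ennreal_less_iff)
      qed
    qed (simp add: outside strict_mono_def)
    show "(g t \<longlongrightarrow> 0) at_bot" for t
    proof (cases "t \<in> G")
      case t: True
      show ?thesis
      proof (rule order_tendstoI)
        fix a :: real assume "a < 0"
        then show "\<forall>\<^sub>F y in at_bot. a < g t y" using pos by (intro always_eventually allI) (rule less_trans)
      next
        fix a :: real assume a: "0 < a"
        obtain z where z: "\<phi> t z = ennreal a" using good[OF t] unfolding good_def by (metis UNIV_I imageE)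
        then obtain x where "z = ereal x" using good[OF t] a by (cases z) (auto simp: good_def)
        then have "g t x = a" using z fin[OF t, of x] a by simp
        then have "\<forall>y<x. g t y < a" using mono[of t] by (auto simp: strict_mono_less)
        then show "\<forall>\<^sub>F y in at_bot. g t y < a" using eventually_at_bot_dense by blast
      qed
    qed (simp add: outside exp_at_bot)
    show "AE t in M. \<forall>y::real. \<phi> t (ereal y) = ennreal (g t y)"
      using GN by eventually_elim (simp add: fin)
  qed
qed

theorem proposition8:
  fixes M :: "'a measure"
    and \<phi> :: "'a \<Rightarrow> ereal \<Rightarrow> ennreal"
    and u0 :: "'a \<Rightarrow> real"
  assumes "sigma_finite_measure M"
    and "non_atomic M"
    and "phi_function M \<phi>"
    and "u0 \<in> borel_measurable M"
    and "\<forall>t\<in>space M. 0 < u0 t"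
    and "\<And>c r. \<lbrakk>c \<in> borel_measurable M; ae_class M (bphi \<phi> c) \<in> P_mu M; 0 < r\<rbrakk>
           \<Longrightarrow> phi_integrable M \<phi> (\<lambda>t. c t + r * u0 t)"
  shows "Ck_banach_manifold \<infinity> (P_mu M)
           {c \<in> borel_measurable M. ae_class M (bphi \<phi> c) \<in> P_mu M}
           (\<lambda>c. B_space M \<phi> c)
           (\<lambda>c. B_domain M \<phi> c)
           (\<lambda>c. phi_chart M \<phi> u0 c)"
proof -
  obtain g where g: "phi_model M g \<phi>" using phi_function_model[OF assms(3)] .
  interpret phi_model M g \<phi> by (rule g)
  interpret phi_charts M g u0 \<phi>
  proof
    show "g_integrable (\<lambda>t. c t + r * u0 t)" if "normalized c" "0 < r" for c r
    proof -
      have c: "c \<in> borel_measurable M" using that(1) by (intro g_integrable_measurable normalized_integrable)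
      then have "phi_integrable M \<phi> (\<lambda>t. c t + r * u0 t)"
        using assms(6) bphi_in_P_mu_iff[OF c] that by blast
      then show ?thesis using c assms(4) phi_integrable_iff by simp
    qed
  qed (use assms(4,5) in auto)
  have "{c \<in> borel_measurable M. ae_class M (bphi \<phi> c) \<in> P_mu M} = {c. normalized c}"
    using bphi_in_P_mu_iff g_integrable_measurable[OF normalized_integrable] by blast
  then show ?thesis using phi_charts_manifold by simp
qed

end
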